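(* Let $k\ge3$. There exists $\varepsilon>0$ such that if $f_2\in\ell^1(\mathbb{Z}^5)$ satisfies $\|f_2\|_{\ell^1}\le\varepsilon$, then for any $p\in[2,+\infty]$ the global solution $u_{(k)}$ of $$\partial_t^2u(x,t)-\Delta u(x,t)=|u(x,t)|^{k-1}u(x,t),\quad u(x,0)=0,\quad \partial_tu(x,0)=f_2(x),\qquad (x,t)\in\mathbb{Z}^5\times\mathbb{R},$$ exists in $\ell^p(\mathbb{Z}^5)$, and there is a constant $C>0$ independent of $t$ such that $$\|u_{(k)}(\cdot,t)\|_{\ell^p}\le C(1+|t|)^{-\frac{11}{6}\left(1-\frac2p\right)}\qquad\text{for all }t\in\mathbb{R}.$$
   Context: $\Delta$ is the discrete Laplacian on $\mathbb{Z}^d$ ($d=5$): $\Delta u(x,t)=\sum_{j=1}^d\big(u(x+\boldsymbol{e_j},t)+u(x-\boldsymbol{e_j},t)-2u(x,t)\big)$, with $\{\boldsymbol{e_j}\}$ the standard basis. A solution is a function satisfying Duhamel's formula $u(t)=G(t)*f_2+\int_0^tG(t-s)*\big(|u(s)|^{k-1}u(s)\big)\,ds$, where $*$ is convolution on $\mathbb{Z}^5$, $G(x,t)=\frac{1}{(2\pi)^5}\int_{[-\pi,\pi]^5}e^{ix\cdot\xi}\frac{\sin(t\omega(\xi))}{\omega(\xi)}\,d\xi$ and $\omega(\xi)=\big(\sum_{j=1}^5(2-2\cos\xi_j)\big)^{1/2}$. The norm on $\ell^p(\mathbb{Z}^5)$ is with respect to the counting measure. *)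

theory Defs
  imports "HOL-Analysis.Analysis"
begin

type_synonym lattice5 = "int ^ 5"

section \<open>The spaces \<open>\<ell>\<^sup>p\<close>\<close>

text \<open>The exponent ranges over \<open>[1, \<infinity>]\<close>, as an extended real.\<close>

definition in_lp :: "ereal \<Rightarrow> ('i \<Rightarrow> 'a::real_normed_vector) \<Rightarrow> bool" where
  "in_lp p f \<longleftrightarrow>
     (if p = \<infinity> then bounded (range f)
      else (\<lambda>x. norm (f x) powr real_of_ereal p) summable_on UNIV)"

definition lp_norm :: "ereal \<Rightarrow> ('i \<Rightarrow> 'a::real_normed_vector) \<Rightarrow> real" where
  "lp_norm p f =
     (if p = \<infinity> then (SUP x. norm (f x))
      else (\<Sum>\<^sub>\<infinity>x. norm (f x) powr real_of_ereal p) powr (1 / real_of_ereal p))"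

section \<open>The wave propagator\<close>

definition omega :: "real ^ 5 \<Rightarrow> real" where
  "omega \<xi> = sqrt (\<Sum>j\<in>UNIV. 2 - 2 * cos (\<xi> $ j))"

text \<open>
  On the cube \<open>omega\<close> vanishes only at the origin. The quotient, whose continuous extension there
  is \<open>t\<close>, takes the value \<open>0\<close> at this single point, which does not affect the integral.
\<close>

definition propagator :: "real \<Rightarrow> lattice5 \<Rightarrow> complex" where
  "propagator t x =
     1 / (2 * pi) ^ 5 *
     (LINT \<xi>:cbox (\<chi> j. - pi) (\<chi> j. pi)|lborel.
        exp (\<i> * of_real (\<Sum>j\<in>UNIV. of_int (x $ j) * \<xi> $ j)) *
        of_real (sin (t * omega \<xi>) / omega \<xi>))"

section \<open>Duhamel's formula\<close>

definition convolvable :: "(lattice5 \<Rightarrow> complex) \<Rightarrow> (lattice5 \<Rightarrow> complex) \<Rightarrow> bool" where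
  "convolvable g f \<longleftrightarrow> (\<forall>x. (\<lambda>y. g (x - y) * f y) summable_on UNIV)"

definition conv :: "(lattice5 \<Rightarrow> complex) \<Rightarrow> (lattice5 \<Rightarrow> complex) \<Rightarrow> lattice5 \<Rightarrow> complex" where
  "conv g f x = (\<Sum>\<^sub>\<infinity>y. g (x - y) * f y)"

definition nonlinearity :: "real \<Rightarrow> (lattice5 \<Rightarrow> complex) \<Rightarrow> lattice5 \<Rightarrow> complex" where
  "nonlinearity k v x = of_real (cmod (v x) powr (k - 1)) * v x"

text \<open>
  The function \<open>u\<close> takes the time first. All sums and integrals in the formula are required to
  converge, since \<open>\<Sum>\<^sub>\<infinity>\<close> and \<open>LBINT\<close> are \<open>0\<close> when they do not. For negative \<open>t\<close> the
  interval integral is the oriented one.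
\<close>

definition duhamel_solution ::
    "real \<Rightarrow> (lattice5 \<Rightarrow> complex) \<Rightarrow> (real \<Rightarrow> lattice5 \<Rightarrow> complex) \<Rightarrow> bool" where
  "duhamel_solution k f u \<longleftrightarrow>
     (\<forall>t. convolvable (propagator t) f \<and>
        (\<forall>s\<in>closed_segment 0 t. convolvable (propagator (t - s)) (nonlinearity k (u s))) \<and>
        (\<forall>x. interval_lebesgue_integrable lborel (ereal 0) (ereal t)
               (\<lambda>s. conv (propagator (t - s)) (nonlinearity k (u s)) x) \<and>
             u t x = conv (propagator t) f x +
               (LBINT s=ereal 0..ereal t.
                  conv (propagator (t - s)) (nonlinearity k (u s)) x)))"

text \<open>
  A global solution in \<open>\<ell>\<^sup>p\<close> is a solution defined for all times with values in \<open>\<ell>\<^sup>p\<close> and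
  with locally bounded \<open>\<ell>\<^sup>p\<close> norm. Local boundedness fixes the class in which one can
  speak of \<^emph>\<open>the\<close> solution; for a solution satisfying a decay estimate it is automatic.
\<close>

definition global_solution_in ::
    "ereal \<Rightarrow> real \<Rightarrow> (lattice5 \<Rightarrow> complex) \<Rightarrow> (real \<Rightarrow> lattice5 \<Rightarrow> complex) \<Rightarrow> bool" where
  "global_solution_in p k f u \<longleftrightarrow>
     duhamel_solution k f u \<and> (\<forall>t. in_lp p (u t)) \<and>
     (\<forall>T. \<exists>B. \<forall>t\<in>{-T..T}. lp_norm p (u t) \<le> B)"

end

theory Submission
  imports Defs "HOL-Complex_Analysis.Complex_Analysis"
begin

text \<open>
  The heart of the matter is \<open>\<bar>G(x, t)\<bar> \<le> C (1 + \<bar>t\<bar>)\<^bsup>-11/6\<^esup>\<close>. For \<open>q = \<omega>(\<xi>)\<close>, the function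
  \<open>sin (t q) / q\<close> is, up to an error \<open>O(t\<^bsup>-11/6\<^esup>)\<close>, the real part of an integral of
  \<open>z\<^bsup>-1/2\<^esup> exp (- t\<^sup>2 / (4 z)) exp (z q\<^sup>2)\<close> over the half line \<open>z = 1 + \<i> r\<close>, \<open>r \<ge> 0\<close>. Since
  \<open>\<omega>\<^sup>2\<close> is a sum of functions of one variable, the kernel of \<open>exp (z \<omega>\<^sup>2)\<close> is a product of five
  one-dimensional kernels of size \<open>(r max(\<bar>2 r - \<bar>n\<bar>\<bar>, r\<^bsup>1/3\<^esup>))\<^bsup>-1/4\<^esup>\<close>. Five such factors are integrable
  across the turning point \<open>2 r = \<bar>n\<bar>\<close> (as \<open>5/4 > 1\<close>), and estimating the integral over \<open>r\<close> absolutely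
  yields the rate \<open>1/2 + 5/3 - 1/3 = 11/6\<close>.

  Together with a uniform \<open>\<ell>\<^sup>2\<close> bound (\<open>\<omega>\<^sup>-\<^sup>2\<close> is integrable in dimension five), Duhamel's map preserves
  \<open>\<bar>u\<bar> \<le> M (1 + \<bar>t\<bar>)\<^bsup>-11/6\<^esup>\<close> and \<open>\<parallel>u\<parallel>\<^sub>2 \<le> M\<close> for small \<open>M\<close>, and contracts there in the supremum norm
  over space and time. The \<open>\<ell>\<^sup>p\<close> bounds follow by interpolation. Uniqueness among locally bounded solutions
  is Gronwall's argument, using that \<open>G(t)\<close> is in \<open>\<ell>\<^sup>1\<close> locally uniformly in \<open>t\<close>.
\<close>

section \<open>An oscillatory integral in one variable\<close>

text \<open>Origin of 11/6: on z = 1 + i r the factor exp (- t^2 / (4 z)) has modulus exp (- t^2 /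
  (4 |z|^2)), which is traded for t^(-a) |z|^a. If all five coordinates reach their turning point 2
  r = |n| together, the remaining weight r^(a - 1/2 - 5/4) meets a peak of integral r^(-1/12), and a
  = 11/6 is exactly the power for which the result stays bounded in n. Away from the peak the
  integrand is r^(-7/6), which is integrable. The line Re z = 1 avoids the singularity at z = 0 and
  keeps |exp (z \<omega>^2)| below e^20. The segment from 0 to 1 supplies both the sine, as its
  endpoint value at 0, and the error. The real part is taken because the endpoint value at infinity
  is purely imaginary. For the nonlinear problem, the l1 norm of the nonlinearity is at most the sup
  norm times the squared l2 norm, and 11/6 > 1 makes the decay integrable in time. The contraction
  can be measured in the unweighted sup norm because the decay and l2 bounds survive pointwise
  limits.\<close>

lemma has_integral_geometric_exp:
  fixes \<alpha> :: complex and s :: real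
  assumes "norm \<alpha> < 1" "s \<in> {1, -1}"
  shows "((\<lambda>\<theta>. 1 / (1 - \<alpha> * exp (\<i> * of_real (s * \<theta>)))) has_integral of_real (2 * pi)) {-pi..pi}"
proof -
  let ?e = "\<lambda>z. exp (\<i> * of_real s * z)"
  \<comment> \<open>The primitive uses the principal logarithm, legitimate because its argument
    stays in the right half plane. The logarithmic part is periodic, so only the length 2 pi of the
    interval remains.\<close>
  let ?F = "\<lambda>z. z + \<i> * of_real s * Ln (1 - \<alpha> * ?e z)"
  have re: "Re (1 - \<alpha> * ?e (of_real \<theta>)) > 0" for \<theta>
  proof -
    have "Re (\<alpha> * ?e (of_real \<theta>)) \<le> norm (\<alpha> * ?e (of_real \<theta>))" by (rule complex_Re_le_cmod)
    also have "\<dots> = norm \<alpha>" by (simp add: norm_mult)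
    finally show ?thesis using assms by simp
  qed
  have s2: "of_real s * (of_real s :: complex) = 1" using assms by auto
  have der: "((\<lambda>\<theta>. ?F (of_real \<theta>)) has_vector_derivative
      1 / (1 - \<alpha> * ?e (of_real \<theta>))) (at \<theta> within {-pi..pi})" for \<theta>
  proof (rule has_vector_derivative_real_field)
    have r: "1 - \<alpha> * ?e (of_real \<theta>) \<notin> \<real>\<^sub>\<le>\<^sub>0" using re[of \<theta>]
      by (auto simp: complex_nonpos_Reals_iff)
    have nz: "1 - \<alpha> * ?e (of_real \<theta>) \<noteq> 0" using re[of \<theta>] by fastforce
    have "(?F has_field_derivative (1 + \<i> * of_real s * 
        (inverse (1 - \<alpha> * ?e (of_real \<theta>)) * (0 - \<alpha> * (?e (of_real \<theta>) * (\<i> * of_real s))))))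
        (at (of_real \<theta>))"
      by (rule derivative_eq_intros refl r | simp)+
    moreover have "1 + \<i> * of_real s * 
        (inverse (1 - \<alpha> * ?e (of_real \<theta>)) * (0 - \<alpha> * (?e (of_real \<theta>) * (\<i> * of_real s)))) = 
        1 / (1 - \<alpha> * ?e (of_real \<theta>))"
    proof -
      have "\<i> * of_real s * 
        (inverse (1 - \<alpha> * ?e (of_real \<theta>)) * (0 - \<alpha> * (?e (of_real \<theta>) * (\<i> * of_real s)))) = 
        (of_real s * of_real s) * (\<alpha> * ?e (of_real \<theta>)) / (1 - \<alpha> * ?e (of_real \<theta>))"
        by (simp add: field_simps)
      then show ?thesis using nz s2 by (simp add: field_simps)
    qed
    ultimately show "(?F has_field_derivative 1 / (1 - \<alpha> * ?e (of_real \<theta>))) (at (of_real \<theta>))"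
      by simp
  qed
  have "((\<lambda>\<theta>. 1 / (1 - \<alpha> * ?e (of_real \<theta>))) has_integral ?F (of_real pi) - ?F (of_real (-pi))) {-pi..pi}"
    by (rule fundamental_theorem_of_calculus) (use der in \<open>auto simp del: of_real_minus\<close>)
  moreover have "?e (of_real pi) = ?e (of_real (-pi))"
    using assms(2) by (auto simp: exp_minus)
  ultimately show ?thesis by (simp add: mult.assoc)
qed

text \<open>With \<rho> the root of \<rho>^2 - 2 c \<rho> + 1 inside the unit disc, 2 \<rho> (c +
  sin \<theta>) factors as (1 - X) (1 - Y), where X = i \<rho> exp (i \<theta>) and Y = - i \<rho>
  exp (- i \<theta>). Partial fractions reduce the integral to geometric ones. Recording only the
  norm of J avoids a choice of branch for the square root.\<close>

lemma sin_resolvent: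
  fixes c :: complex
  assumes "Im c \<noteq> 0"
  obtains J where "((\<lambda>\<theta>. 1 / (c + of_real (sin \<theta>))) has_integral J) {-pi..pi}"
    "norm J = 2 * pi / sqrt (norm (c\<^sup>2 - 1))"
proof -
  define s where "s = csqrt (c\<^sup>2 - 1)"
  have s2: "s\<^sup>2 = c\<^sup>2 - 1" by (simp add: s_def)
  have prod1: "(c + s) * (c - s) = 1" using s2 by (simp add: algebra_simps power2_eq_square)
  have key: "\<exists>\<rho>. norm \<rho> < 1 \<and> \<rho>\<^sup>2 - 2 * c * \<rho> + 1 = 0"
  proof -
    have root: "(c + s)\<^sup>2 - 2 * c * (c + s) + 1 = 0" "(c - s)\<^sup>2 - 2 * c * (c - s) + 1 = 0"
      using s2 by (simp_all add: algebra_simps power2_eq_square)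
    have np: "norm (c + s) * norm (c - s) = 1" using prod1 by (metis norm_mult norm_one)
    \<comment> \<open>The two roots are mutually inverse. One on the unit circle would have the
      other as its conjugate, and their sum 2 c would be real.\<close>
    have ne1: "norm (c + s) \<noteq> 1"
    proof
      assume n1: "norm (c + s) = 1"
      then have "cnj (c + s) * (c + s) = 1"
        by (metis complex_norm_square mult.commute of_real_1 one_power2)
      then have "cnj (c + s) = c - s" using prod1
        by (metis mult.commute mult_cancel_left n1 norm_zero zero_neq_one)
      then have "2 * c = (c + s) + cnj (c + s)" by simp
      then have "Im (2 * c) = Im ((c + s) + cnj (c + s))" by (rule arg_cong)
      also have "\<dots> = 0" by simp
      finally have "Im (2 * c) = 0" .
      with assms show False by simp
    qed
    show ?thesis
    proof (cases "norm (c + s) < 1")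
      case True then show ?thesis using root(1) by blast
    next
      case False
      then have "norm (c + s) > 1" using ne1 by simp
      then have "norm (c - s) < 1"
        using np by (smt (verit, ccfv_SIG) mult_le_cancel_left1 norm_ge_zero)
      then show ?thesis using root(2) by blast
    qed
  qed
  then obtain \<rho> where r1: "norm \<rho> < 1" and r2: "\<rho>\<^sup>2 - 2 * c * \<rho> + 1 = 0" by blast
  have r0: "\<rho> \<noteq> 0" using r2 by auto
  have r3: "norm (\<rho>\<^sup>2) < 1" using r1 by (simp add: norm_power power_less_one_iff)
  have r4: "1 - \<rho>\<^sup>2 \<noteq> 0" using r3 by (metis eq_iff_diff_eq_0 norm_one order_less_irrefl)
  have c_eq: "c = (1 + \<rho>\<^sup>2) / (2 * \<rho>)" using r2 r0 by (simp add: field_simps)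
  let ?X = "\<lambda>\<theta>. (\<i> * \<rho>) * exp (\<i> * of_real (1 * \<theta>))"
  let ?Y = "\<lambda>\<theta>. (- \<i> * \<rho>) * exp (\<i> * of_real ((-1) * \<theta>))"
  \<comment> \<open>Partial fractions with X Y = \<rho>^2; each of the three terms integrates to 2
    pi.\<close>
  have I: "((\<lambda>\<theta>. 2 * \<rho> / (1 - \<rho>\<^sup>2) * (1 / (1 - ?X \<theta>) + 1 / (1 - ?Y \<theta>) - 1)) has_integral
     2 * \<rho> / (1 - \<rho>\<^sup>2) * (of_real (2 * pi) + of_real (2 * pi) - of_real (2 * pi))) {-pi..pi}"
  proof (intro has_integral_mult_right has_integral_diff has_integral_add)
    show "((\<lambda>\<theta>. 1 / (1 - ?X \<theta>)) has_integral of_real (2 * pi)) {-pi..pi}"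
      by (rule has_integral_geometric_exp) (use r1 in \<open>auto simp: norm_mult\<close>)
    show "((\<lambda>\<theta>. 1 / (1 - ?Y \<theta>)) has_integral of_real (2 * pi)) {-pi..pi}"
      by (rule has_integral_geometric_exp) (use r1 in \<open>auto simp: norm_mult\<close>)
    show "((\<lambda>\<theta>. (1::complex)) has_integral of_real (2 * pi)) {-pi..pi}"
      using has_integral_const_real[of "1::complex" "-pi" pi] by (simp add: scaleR_conv_of_real)
  qed
  have eq: "2 * \<rho> / (1 - \<rho>\<^sup>2) * (1 / (1 - ?X \<theta>) + 1 / (1 - ?Y \<theta>) - 1) = 1 / (c + of_real (sin \<theta>))" for \<theta>
  proof -
    have XY: "?X \<theta> * ?Y \<theta> = \<rho>\<^sup>2" by (simp add: exp_minus power2_eq_square field_simps)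
    have nX: "norm (?X \<theta>) < 1" "norm (?Y \<theta>) < 1" using r1 by (auto simp: norm_mult)
    have X1: "1 - ?X \<theta> \<noteq> 0" "1 - ?Y \<theta> \<noteq> 0" using nX
      by (metis eq_iff_diff_eq_0 norm_one order_less_irrefl)+
    have sn: "of_real (sin \<theta>) = (exp (\<i> * of_real \<theta>) - exp (\<i> * of_real ((-1) * \<theta>))) / (2 * \<i>)"
      using sin_exp_eq[of "of_real \<theta>"] by (simp add: sin_of_real)
    have "2 * \<rho> * (c + of_real (sin \<theta>)) = (1 - ?X \<theta>) * (1 - ?Y \<theta>)"
    proof -
      have "2 * \<rho> * c = 1 + \<rho>\<^sup>2" using c_eq r0 by (simp add: field_simps)
      moreover have "2 * \<rho> * of_real (sin \<theta>) = - ?X \<theta> - ?Y \<theta>"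
        unfolding sn by (simp add: field_simps)
      moreover have "(1 - ?X \<theta>) * (1 - ?Y \<theta>) = 1 - ?X \<theta> - ?Y \<theta> + ?X \<theta> * ?Y \<theta>" by (simp add: algebra_simps)
      ultimately show ?thesis using XY by (simp add: algebra_simps)
    qed
    then have c2: "c + of_real (sin \<theta>) = (1 - ?X \<theta>) * (1 - ?Y \<theta>) / (2 * \<rho>)"
      using r0 by (simp add: field_simps)
    have gen: "2 * \<rho> / (1 - x * y) * (1 / (1 - x) + 1 / (1 - y) - 1) = 1 / ((1 - x) * (1 - y) / (2 * \<rho>))"
      if "1 - x \<noteq> 0" "1 - y \<noteq> 0" "1 - x * y \<noteq> 0" for x y :: complex
    proof -
      have "1 / u + 1 / v - 1 = (u + v - u * v) / (u * v)" if "u \<noteq> 0" "v \<noteq> 0" for u v :: complex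
        using that by (simp add: field_simps)
      from this[OF that(1,2)]
      have "1 / (1 - x) + 1 / (1 - y) - 1 = (1 - x * y) / ((1 - x) * (1 - y))"
        by (simp add: algebra_simps)
      then show ?thesis using that r0 by simp
    qed
    show ?thesis unfolding c2 using gen[OF X1] r4 unfolding XY by blast
  qed
  show ?thesis
  proof
    show "((\<lambda>\<theta>. 1 / (c + of_real (sin \<theta>))) has_integral
       2 * \<rho> / (1 - \<rho>\<^sup>2) * (of_real (2 * pi) + of_real (2 * pi) - of_real (2 * pi))) {-pi..pi}"
      using I unfolding eq .
    have "c\<^sup>2 - 1 = ((1 - \<rho>\<^sup>2) / (2 * \<rho>))\<^sup>2"
      unfolding c_eq using r0 by (simp add: field_simps power2_eq_square)
    then have "sqrt (norm (c\<^sup>2 - 1)) = norm ((1 - \<rho>\<^sup>2) / (2 * \<rho>))"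
      by (simp add: norm_power)
    then show "norm (2 * \<rho> / (1 - \<rho>\<^sup>2) * (of_real (2 * pi) + of_real (2 * pi) - of_real (2 * pi)))
      = 2 * pi / sqrt (norm (c\<^sup>2 - 1))"
      by (simp add: norm_divide norm_mult)
  qed
qed

text \<open>The Lorentzian is - \<mu> / (2 r) times the imaginary part of 1 / (c + sin \<theta>) at
  c = (n + i \<mu>) / (2 r). The exact resolvent integral thus covers the merging of the zeros of n
  + 2 r sin \<theta> at |n| = 2 r without a case distinction.\<close>

lemma lorentzian_sin_integral:
  fixes n r \<mu> :: real
  assumes "r > 0" "\<mu> > 0" "b > 0" "b \<le> max \<bar>2 * r - \<bar>n\<bar>\<bar> \<mu>"
  shows "integral {-pi..pi} (\<lambda>\<theta>. \<mu>\<^sup>2 / (\<mu>\<^sup>2 + (n + 2 * r * sin \<theta>)\<^sup>2)) \<le> 2 * pi * \<mu> / sqrt (2 * r * b)"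
    and "(\<lambda>\<theta>. \<mu>\<^sup>2 / (\<mu>\<^sup>2 + (n + 2 * r * sin \<theta>)\<^sup>2)) integrable_on {-pi..pi}"
proof -
  define c where "c = Complex (n / (2 * r)) (\<mu> / (2 * r))"
  have "Im c \<noteq> 0" using assms by (simp add: c_def)
  from sin_resolvent[OF this] obtain J where
    J: "((\<lambda>\<theta>. 1 / (c + of_real (sin \<theta>))) has_integral J) {-pi..pi}"
    and nJ: "norm J = 2 * pi / sqrt (norm (c\<^sup>2 - 1))" .
  have eq: "\<mu>\<^sup>2 / (\<mu>\<^sup>2 + (n + 2 * r * sin \<theta>)\<^sup>2) = - (\<mu> / (2 * r)) * Im (1 / (c + of_real (sin \<theta>)))" for \<theta>
  proof -
    have "c + of_real (sin \<theta>) = Complex ((n + 2 * r * sin \<theta>) / (2 * r)) (\<mu> / (2 * r))"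
      using assms by (simp add: c_def complex_eq_iff field_simps)
    then have "Im (1 / (c + of_real (sin \<theta>))) = - (\<mu> / (2 * r)) / (((n + 2 * r * sin \<theta>) / (2 * r))\<^sup>2 + (\<mu> / (2 * r))\<^sup>2)"
      by (simp add: Im_divide)
    also have "((n + 2 * r * sin \<theta>) / (2 * r))\<^sup>2 + (\<mu> / (2 * r))\<^sup>2 = (\<mu>\<^sup>2 + (n + 2 * r * sin \<theta>)\<^sup>2) / (2 * r)\<^sup>2"
      by (simp only: power_divide[of _ "2 * r" 2] add_divide_distrib[symmetric] add.commute[of "\<mu>\<^sup>2"])
    finally show ?thesis using assms by (simp add: power2_eq_square)
  qed
  have hI: "((\<lambda>\<theta>. \<mu>\<^sup>2 / (\<mu>\<^sup>2 + (n + 2 * r * sin \<theta>)\<^sup>2)) has_integral (- (\<mu> / (2 * r)) * Im J)) {-pi..pi}"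
    unfolding eq by (intro has_integral_mult_right has_integral_Im J)
  then show "(\<lambda>\<theta>. \<mu>\<^sup>2 / (\<mu>\<^sup>2 + (n + 2 * r * sin \<theta>)\<^sup>2)) integrable_on {-pi..pi}" by blast
  have nc: "norm (c\<^sup>2 - 1) = norm (c - 1) * norm (c + 1)"
    by (simp add: norm_mult[symmetric] algebra_simps power2_eq_square)
  \<comment> \<open>Both c - 1 and c + 1 have modulus at least b / (2 r), and one of them at least 1
    because |n - 2 r| + |n + 2 r| >= 4 r.\<close>
  have lower: "norm (c\<^sup>2 - 1) \<ge> b / (2 * r)"
  proof -
    have re: "\<bar>Re (c - 1)\<bar> = \<bar>n - 2 * r\<bar> / (2 * r)" "\<bar>Re (c + 1)\<bar> = \<bar>n + 2 * r\<bar> / (2 * r)"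
      using assms by (auto simp: c_def abs_divide[symmetric] field_simps)
    have im: "\<bar>Im (c - 1)\<bar> = \<mu> / (2 * r)" "\<bar>Im (c + 1)\<bar> = \<mu> / (2 * r)" using assms by (auto simp: c_def)
    have one: "norm (c - 1) \<ge> b / (2 * r)" "norm (c + 1) \<ge> b / (2 * r)"
    proof -
      have "b \<le> \<bar>n - 2 * r\<bar> \<or> b \<le> \<mu>" "b \<le> \<bar>n + 2 * r\<bar> \<or> b \<le> \<mu>" using assms by linarith+
      then have "b / (2*r) \<le> \<bar>n - 2 * r\<bar> / (2*r) \<or> b / (2*r) \<le> \<mu> / (2*r)"
         "b / (2*r) \<le> \<bar>n + 2 * r\<bar> / (2*r) \<or> b / (2*r) \<le> \<mu> / (2*r)"
        using assms by (auto simp: divide_right_mono)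
      then show "norm (c - 1) \<ge> b / (2 * r)" "norm (c + 1) \<ge> b / (2 * r)"
        using re im abs_Re_le_cmod[of "c - 1"] abs_Im_le_cmod[of "c - 1"]
          abs_Re_le_cmod[of "c + 1"] abs_Im_le_cmod[of "c + 1"] by linarith+
    qed
    have "\<bar>n - 2 * r\<bar> / (2 * r) \<ge> 1 \<or> \<bar>n + 2 * r\<bar> / (2 * r) \<ge> 1" using assms by (auto simp: field_simps)
    then have "norm (c - 1) \<ge> 1 \<or> norm (c + 1) \<ge> 1"
      using re abs_Re_le_cmod[of "c - 1"] abs_Re_le_cmod[of "c + 1"] by linarith
    then show ?thesis unfolding nc
    proof
      assume "norm (c - 1) \<ge> 1"
      then show "b / (2 * r) \<le> norm (c - 1) * norm (c + 1)"
        using one mult_mono[of 1 "norm (c - 1)" "b / (2*r)" "norm (c + 1)"] assms by simp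
    next
      assume "norm (c + 1) \<ge> 1"
      then show "b / (2 * r) \<le> norm (c - 1) * norm (c + 1)"
        using one mult_mono[of "b / (2*r)" "norm (c - 1)" 1 "norm (c + 1)"] assms by simp
    qed
  qed
  have "integral {-pi..pi} (\<lambda>\<theta>. \<mu>\<^sup>2 / (\<mu>\<^sup>2 + (n + 2 * r * sin \<theta>)\<^sup>2)) = - (\<mu> / (2 * r)) * Im J"
    using hI by (rule integral_unique)
  also have "\<dots> \<le> (\<mu> / (2 * r)) * norm J"
  proof -
    have "- Im J \<le> norm J" using abs_Im_le_cmod[of J] by linarith
    then have "(\<mu> / (2 * r)) * (- Im J) \<le> (\<mu> / (2 * r)) * norm J"
      using assms by (intro mult_left_mono) auto
    then show ?thesis by simp
  qed
  also have "\<dots> \<le> (\<mu> / (2 * r)) * (2 * pi / sqrt (b / (2 * r)))"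
  proof -
    have "0 < b / (2 * r)" using assms by simp
    moreover from this have "0 < norm (c\<^sup>2 - 1)" using lower by linarith
    ultimately show ?thesis
      unfolding nJ using assms lower
      by (intro mult_left_mono divide_left_mono mult_pos_pos real_sqrt_le_mono) (auto simp del: zero_less_norm_iff)
  qed
  also have "\<dots> = 2 * pi * \<mu> / sqrt (2 * r * b)"
  proof -
    have "2 * r * sqrt (b / (2 * r)) = sqrt ((2 * r)\<^sup>2) * sqrt (b / (2 * r))"
      using assms by (subst real_sqrt_abs) auto
    also have "\<dots> = sqrt ((2 * r)\<^sup>2 * (b / (2 * r)))" by (simp only: real_sqrt_mult)
    also have "(2 * r)\<^sup>2 * (b / (2 * r)) = 2 * r * b" using assms by (simp add: power2_eq_square)
    finally have e: "2 * r * sqrt (b / (2 * r)) = sqrt (2 * r * b)" .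
    show ?thesis by (simp only: times_divide_times_eq e) (simp add: mult_ac)
  qed
  finally show "integral {-pi..pi} (\<lambda>\<theta>. \<mu>\<^sup>2 / (\<mu>\<^sup>2 + (n + 2 * r * sin \<theta>)\<^sup>2)) \<le> 2 * pi * \<mu> / sqrt (2 * r * b)" .
qed

text \<open>
  The kernel of \<open>exp (z \<omega>\<^sup>2)\<close> in one variable at \<open>z = 1 + \<i> r\<close>, that is
  \<open>2 \<pi> (-1)\<^sup>n e\<^sup>2\<^sup>z I\<^sub>n(2 z)\<close> with the modified Bessel function \<open>I\<^sub>n\<close>.
\<close>

definition heat_kernel :: "real \<Rightarrow> int \<Rightarrow> complex" where
  "heat_kernel r n = integral {-pi..pi}
     (\<lambda>\<theta>. exp (\<i> * of_real (of_int n * \<theta>)) * exp (Complex 1 r * of_real (2 - 2 * cos \<theta>)))"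

text \<open>The integrand is the absolute derivative of
  \<open>arctan ((n + 2 * r * sin \<theta>) / \<mu>) / \<mu>\<close>. Its integral is a total
  variation, at most pi / \<mu> on each of the three intervals where the cosine keeps its
  sign.\<close>

lemma cos_lorentzian_integral:
  fixes n r \<mu> :: real
  assumes "r > 0" "\<mu> > 0"
  shows "(\<lambda>\<theta>. \<bar>2 * r * cos \<theta>\<bar> / (\<mu>\<^sup>2 + (n + 2 * r * sin \<theta>)\<^sup>2)) integrable_on {-pi..pi}"
    and "integral {-pi..pi} (\<lambda>\<theta>. \<bar>2 * r * cos \<theta>\<bar> / (\<mu>\<^sup>2 + (n + 2 * r * sin \<theta>)\<^sup>2)) \<le> 3 * pi / \<mu>"
proof -
  let ?f = "\<lambda>\<theta>. \<bar>2 * r * cos \<theta>\<bar> / (\<mu>\<^sup>2 + (n + 2 * r * sin \<theta>)\<^sup>2)"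
  let ?A = "\<lambda>\<theta>. arctan ((n + 2 * r * sin \<theta>) / \<mu>) / \<mu>"
  have piece: "\<exists>I. (?f has_integral I) {a..b} \<and> I \<le> pi / \<mu>"
    if "a \<le> b" "s \<in> {1, -1}" and pos: "\<And>\<theta>. \<theta> \<in> {a..b} \<Longrightarrow> s * cos \<theta> \<ge> 0" for a b s :: real
  proof -
    have "((\<lambda>\<theta>. s * ?A \<theta>) has_vector_derivative ?f \<theta>) (at \<theta> within {a..b})" if t: "\<theta> \<in> {a..b}" for \<theta>
    proof -
      have "((\<lambda>\<theta>. s * ?A \<theta>) has_real_derivative
         s * ((inverse (1 + ((n + 2 * r * sin \<theta>) / \<mu>)\<^sup>2) * (2 * r * cos \<theta> / \<mu>)) / \<mu>)) (at \<theta> within {a..b})"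
        by (rule derivative_eq_intros refl | use assms in simp)+
      moreover have "s * ((inverse (1 + ((n + 2 * r * sin \<theta>) / \<mu>)\<^sup>2) * (2 * r * cos \<theta> / \<mu>)) / \<mu>) = ?f \<theta>"
      proof -
        have "\<bar>2 * r * cos \<theta>\<bar> = 2 * r * (s * cos \<theta>)" using \<open>s \<in> {1, -1}\<close> pos[OF t] assms(1)
          by (auto simp: abs_mult abs_of_nonneg abs_of_nonpos)
        moreover have "inverse (1 + ((n + 2 * r * sin \<theta>) / \<mu>)\<^sup>2) = \<mu>\<^sup>2 / (\<mu>\<^sup>2 + (n + 2 * r * sin \<theta>)\<^sup>2)"
        proof -
          have "1 + (Y / \<mu>)\<^sup>2 = (\<mu>\<^sup>2 + Y\<^sup>2) / \<mu>\<^sup>2" for Y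
            using assms by (simp add: power_divide add_divide_distrib)
          from this[of "n + 2 * r * sin \<theta>"]
          show ?thesis by simp
        qed
        ultimately show ?thesis using assms by (simp add: power2_eq_square)
      qed
      ultimately show ?thesis by (simp add: has_real_derivative_iff_has_vector_derivative)
    qed
    then have "(?f has_integral (s * ?A b - s * ?A a)) {a..b}"
      using fundamental_theorem_of_calculus[OF \<open>a \<le> b\<close>, of "\<lambda>\<theta>. s * ?A \<theta>" ?f] by blast
    moreover have "s * ?A b - s * ?A a \<le> pi / \<mu>"
    proof -
      have "\<bar>arctan x\<bar> \<le> pi / 2" for x using arctan_bounded[of x] by linarith
      then have ab: "\<bar>?A x\<bar> \<le> (pi / 2) / \<mu>" for x using assms by (simp add: abs_divide divide_right_mono del: times_divide_eq_left divide_divide_eq_left)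
      have "s * X - s * Y \<le> \<bar>X\<bar> + \<bar>Y\<bar>" for X Y using that(2) by auto
      then have "s * ?A b - s * ?A a \<le> \<bar>?A b\<bar> + \<bar>?A a\<bar>" .
      also have "\<dots> \<le> (pi / 2) / \<mu> + (pi / 2) / \<mu>" by (intro add_mono ab)
      finally show ?thesis by simp
    qed
    ultimately show ?thesis by blast
  qed
  obtain I1 where I1: "(?f has_integral I1) {-pi..-(pi/2)}" "I1 \<le> pi / \<mu>"
  proof -
    have "- 1 * cos \<theta> \<ge> 0" if "\<theta> \<in> {-pi..-(pi/2)}" for \<theta>
      using cos_ge_zero[of "\<theta> + pi"] that by simp
    from piece[of "-pi" "-(pi/2)" "-1", OF _ _ this] show ?thesis using that by auto
  qed
  obtain I2 where I2: "(?f has_integral I2) {-(pi/2)..pi/2}" "I2 \<le> pi / \<mu>"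
  proof -
    have "1 * cos \<theta> \<ge> 0" if "\<theta> \<in> {-(pi/2)..pi/2}" for \<theta>
      using cos_ge_zero[of "\<theta>"] that by simp
    from piece[of "-(pi/2)" "pi/2" 1, OF _ _ this] show ?thesis using that by auto
  qed
  obtain I3 where I3: "(?f has_integral I3) {pi/2..pi}" "I3 \<le> pi / \<mu>"
  proof -
    have "- 1 * cos \<theta> \<ge> 0" if "\<theta> \<in> {pi/2..pi}" for \<theta>
      using cos_ge_zero[of "\<theta> - pi"] that by simp
    from piece[of "pi/2" pi "-1", OF _ _ this] show ?thesis using that by auto
  qed
  have "(?f has_integral I1 + I2) {-pi..pi/2}"
    by (rule has_integral_combine[OF _ _ I1(1) I2(1)]) auto
  then have tot: "(?f has_integral (I1 + I2) + I3) {-pi..pi}"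
    by (rule has_integral_combine[rotated 2, OF _ I3(1)]) auto
  then show "?f integrable_on {-pi..pi}" by blast
  have "(I1 + I2) + I3 \<le> 3 * pi / \<mu>" using I1 I2 I3 by simp
  then show "integral {-pi..pi} ?f \<le> 3 * pi / \<mu>" using tot by (simp add: integral_unique)
qed

text \<open>The function y / (\<mu>^2 + y^2) is the regularised 1 / y used for integration by parts;
  the two estimates control it and its derivative.\<close>

lemma lorentzian_deriv_bound:
  fixes y \<mu> :: real
  assumes "\<mu> > 0"
  shows "\<bar>y / (\<mu>\<^sup>2 + y\<^sup>2)\<bar> \<le> 1 / (2 * \<mu>)" "\<bar>(\<mu>\<^sup>2 - y\<^sup>2) / (\<mu>\<^sup>2 + y\<^sup>2)\<^sup>2\<bar> \<le> 1 / (\<mu>\<^sup>2 + y\<^sup>2)"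
proof -
  have p: "\<mu>\<^sup>2 + y\<^sup>2 > 0" using assms by (simp add: add_pos_nonneg)
  have "2 * \<mu> * \<bar>y\<bar> \<le> \<mu>\<^sup>2 + y\<^sup>2" using sum_squares_bound[of \<mu> "\<bar>y\<bar>"] by simp
  then show "\<bar>y / (\<mu>\<^sup>2 + y\<^sup>2)\<bar> \<le> 1 / (2 * \<mu>)" using p assms by (simp add: field_simps)
  have "\<bar>\<mu>\<^sup>2 - y\<^sup>2\<bar> \<le> \<mu>\<^sup>2 + y\<^sup>2" by (simp add: abs_if)
  then have "\<bar>\<mu>\<^sup>2 - y\<^sup>2\<bar> / (\<mu>\<^sup>2 + y\<^sup>2)\<^sup>2 \<le> (\<mu>\<^sup>2 + y\<^sup>2) / (\<mu>\<^sup>2 + y\<^sup>2)\<^sup>2"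
    by (rule divide_right_mono) simp
  then show "\<bar>(\<mu>\<^sup>2 - y\<^sup>2) / (\<mu>\<^sup>2 + y\<^sup>2)\<^sup>2\<bar> \<le> 1 / (\<mu>\<^sup>2 + y\<^sup>2)"
  proof -
    have "S / S\<^sup>2 = 1 / S" if "S > 0" for S :: real using that by (simp add: power2_eq_square)
    from this[OF p] show ?thesis using \<open>_ \<le> (\<mu>\<^sup>2 + y\<^sup>2) / (\<mu>\<^sup>2 + y\<^sup>2)\<^sup>2\<close> by (simp only: abs_divide abs_power2)
  qed
qed

lemma exp_two_cos_le: "exp (2 - 2 * cos \<theta>) \<le> exp (4::real)"
  using cos_ge_minus_one[of \<theta>] by (subst exp_le_cancel_iff) linarith

lemma heat_kernel_integrand:
  "exp (\<i> * of_real (of_int n * \<theta>)) * exp (Complex 1 r * of_real (2 - 2 * cos \<theta>)) =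
   of_real (exp (2 - 2 * cos \<theta>)) * exp (\<i> * of_real (of_int n * \<theta> + r * (2 - 2 * cos \<theta>)))"
proof -
  have c: "Complex 1 r = 1 + \<i> * of_real r" by (simp add: complex_eq_iff)
  have "\<i> * N + (1 + \<i> * R) * C = C + \<i> * (N + R * C)" for N R C :: complex
    by (simp add: algebra_simps)
  then show ?thesis
    unfolding exp_of_real[symmetric] exp_add[symmetric] c of_real_add of_real_mult by simp
qed

text \<open>
  On \<open>{\<theta>. \<bar>\<phi>' \<theta>\<bar> \<ge> \<mu>}\<close> one integrates by parts, the rest is estimated by its measure; both regions are
  cut out smoothly by \<open>\<mu>\<^sup>2 / (\<mu>\<^sup>2 + \<phi>'\<^sup>2)\<close>, where \<open>\<phi>' = n + 2 r sin \<theta>\<close> is the derivative of the phase.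
\<close>

lemma heat_kernel_bound_param:
  assumes "r > 0" "\<mu> > 0" "b > 0" "b \<le> max \<bar>2 * r - \<bar>of_int n\<bar>\<bar> \<mu>"
  shows "norm (heat_kernel r n) \<le> exp 4 * (2 * pi * \<mu> / sqrt (2 * r * b) + 5 * pi / \<mu>)"
proof -
  define a where "a = (\<lambda>\<theta>::real. exp (2 - 2 * cos \<theta>))"
  define y where "y = (\<lambda>\<theta>. of_int n + 2 * r * sin \<theta>)"
  define E where "E = (\<lambda>\<theta>. exp (\<i> * of_real (of_int n * \<theta> + r * (2 - 2 * cos \<theta>))))"
  \<comment> \<open>A substitute for 1 / y that stays finite at the stationary points y = 0. Below,
    \<open>F'\<close> is the derivative of a g E.\<close>
  define g where "g = (\<lambda>\<theta>. y \<theta> / (\<mu>\<^sup>2 + (y \<theta>)\<^sup>2))"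
  define g' where "g' = (\<lambda>\<theta>. (\<mu>\<^sup>2 - (y \<theta>)\<^sup>2) / (\<mu>\<^sup>2 + (y \<theta>)\<^sup>2)\<^sup>2 * (2 * r * cos \<theta>))"
  define F' where "F' = (\<lambda>\<theta>. of_real (a \<theta> * g \<theta>) * (\<i> * of_real (y \<theta>) * E \<theta>)
      + of_real (2 * sin \<theta> * a \<theta> * g \<theta> + a \<theta> * g' \<theta>) * E \<theta>)"
  have p: "\<mu>\<^sup>2 + (y \<theta>)\<^sup>2 > 0" for \<theta> using assms by (simp add: add_pos_nonneg)
  have dE: "(E has_vector_derivative \<i> * of_real (y \<theta>) * E \<theta>) (at \<theta> within S)" for \<theta> S
  proof -
    have "((\<lambda>z. exp (\<i> * (of_int n * z + of_real r * (2 - 2 * cos z)))) has_field_derivative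
      exp (\<i> * (of_int n * of_real \<theta> + of_real r * (2 - 2 * cos (of_real \<theta>)))) * (\<i> * (of_int n + of_real r * (2 * sin (of_real \<theta>))))) (at (of_real \<theta>))"
      by (rule derivative_eq_intros refl | simp)+
    from has_vector_derivative_real_field[OF this, of S] show ?thesis
      by (simp add: E_def y_def cos_of_real sin_of_real mult_ac)
  qed
  have dag: "((\<lambda>\<theta>. a \<theta> * g \<theta>) has_real_derivative (2 * sin \<theta> * a \<theta> * g \<theta> + a \<theta> * g' \<theta>)) (at \<theta> within S)" for \<theta> S
  proof -
    have da: "(a has_real_derivative 2 * sin \<theta> * a \<theta>) (at \<theta> within S)"
      unfolding a_def by (rule derivative_eq_intros refl | simp)+
    have dy: "(y has_real_derivative 2 * r * cos \<theta>) (at \<theta> within S)"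
      unfolding y_def by (rule derivative_eq_intros refl | simp)+
    have dg: "(g has_real_derivative g' \<theta>) (at \<theta> within S)"
    proof -
      have "((\<lambda>\<theta>. y \<theta> * y \<theta>) has_real_derivative (2 * r * cos \<theta>) * y \<theta> + (2 * r * cos \<theta>) * y \<theta>) (at \<theta> within S)"
        by (rule DERIV_mult[OF dy dy])
      from DERIV_add[OF DERIV_const[of "\<mu>\<^sup>2"] this]
      have "((\<lambda>\<theta>. \<mu>\<^sup>2 + (y \<theta>)\<^sup>2) has_real_derivative 0 + ((2 * r * cos \<theta>) * y \<theta> + (2 * r * cos \<theta>) * y \<theta>)) (at \<theta> within S)"
        by (simp only: power2_eq_square)
      from DERIV_divide[OF dy this less_imp_neq[OF p, symmetric]]
      have "(g has_real_derivative ((2 * r * cos \<theta>) * (\<mu>\<^sup>2 + (y \<theta>)\<^sup>2) -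
          y \<theta> * (0 + ((2 * r * cos \<theta>) * y \<theta> + (2 * r * cos \<theta>) * y \<theta>))) / ((\<mu>\<^sup>2 + (y \<theta>)\<^sup>2) * (\<mu>\<^sup>2 + (y \<theta>)\<^sup>2))) (at \<theta> within S)"
        unfolding g_def .
      moreover have "c * (m + Y\<^sup>2) - Y * (0 + (c * Y + c * Y)) = (m - Y\<^sup>2) * c" for c m Y :: real
        by (simp add: algebra_simps power2_eq_square)
      ultimately show ?thesis unfolding g'_def power2_eq_square[of "\<mu>\<^sup>2 + (y \<theta>)\<^sup>2"] by (simp only: times_divide_eq_left)
    qed
    show ?thesis by (rule derivative_eq_intros da dg refl | simp)+
  qed
  have dF: "((\<lambda>\<theta>. of_real (a \<theta> * g \<theta>) * E \<theta>) has_vector_derivative F' \<theta>) (at \<theta> within S)" for \<theta> S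
  proof -
    have "((\<lambda>\<theta>. complex_of_real (a \<theta> * g \<theta>)) has_vector_derivative of_real (2 * sin \<theta> * a \<theta> * g \<theta> + a \<theta> * g' \<theta>)) (at \<theta> within S)"
      using dag[of \<theta> S] by (intro has_vector_derivative_of_real) (simp add: has_real_derivative_iff_has_vector_derivative)
    from has_vector_derivative_mult[OF this dE[of \<theta> S]] show ?thesis unfolding F'_def .
  qed
  have "E pi = E (- pi)"
  proof -
    have "exp (\<i> * of_real (of_int n * pi)) = exp (\<i> * of_real (of_int n * (-pi)))"
      unfolding exp_eq by (rule exI[of _ n]) (simp add: algebra_simps)
    then show ?thesis by (simp add: E_def distrib_left exp_add)
  qed
  then have "(F' has_integral 0) {-pi..pi}"
    using fundamental_theorem_of_calculus[of "-pi" pi "\<lambda>\<theta>. of_real (a \<theta> * g \<theta>) * E \<theta>" F'] dF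
    by (simp add: a_def g_def y_def)
  then have F0: "((\<lambda>\<theta>. \<i> * F' \<theta>) has_integral 0) {-pi..pi}" using has_integral_mult_right[of F' 0 _ \<i>] by simp
  have cont: "continuous_on {-pi..pi} (\<lambda>\<theta>. of_real (a \<theta>) * E \<theta>)"
    unfolding a_def E_def by (intro continuous_intros)
  have kI: "((\<lambda>\<theta>. of_real (a \<theta>) * E \<theta>) has_integral heat_kernel r n) {-pi..pi}"
  proof -
    have "heat_kernel r n = integral {-pi..pi} (\<lambda>\<theta>. of_real (a \<theta>) * E \<theta>)"
      unfolding heat_kernel_def heat_kernel_integrand a_def E_def ..
    then show ?thesis using integrable_integral[OF integrable_continuous_real[OF cont]] by simp
  qed
  \<comment> \<open>Adding i F', whose integral is 0 by periodicity, turns a E into a (1 - g y) E +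
    i (a g)' E. Here 1 - g y is the Lorentzian, and (a g)' has integral of order 1 / \<mu>.\<close>
  have sum: "((\<lambda>\<theta>. of_real (a \<theta>) * E \<theta> + \<i> * F' \<theta>) has_integral heat_kernel r n) {-pi..pi}"
    using has_integral_add[OF kI F0] by simp
  let ?L = "\<lambda>\<theta>. \<mu>\<^sup>2 / (\<mu>\<^sup>2 + (of_int n + 2 * r * sin \<theta>)\<^sup>2)"
  let ?M = "\<lambda>\<theta>. \<bar>2 * r * cos \<theta>\<bar> / (\<mu>\<^sup>2 + (of_int n + 2 * r * sin \<theta>)\<^sup>2)"
  have bd: "norm (of_real (a \<theta>) * E \<theta> + \<i> * F' \<theta>) \<le> exp 4 * (?L \<theta> + (1 / \<mu> + ?M \<theta>))" for \<theta>
  proof -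
    have "of_real (a \<theta>) * E \<theta> + \<i> * F' \<theta> = 
       of_real (a \<theta>) * (of_real (1 - g \<theta> * y \<theta>) + \<i> * of_real (2 * sin \<theta> * g \<theta> + g' \<theta>)) * E \<theta>"
    proof -
      have "A * E + \<i> * (A * G * (\<i> * Y * E) + (2 * S * A * G + A * G') * E) = A * ((1 - G * Y) + \<i> * (2 * S * G + G')) * E"
        for A G S G' Y E :: complex by (simp add: algebra_simps)
      from this[of "of_real (a \<theta>)" "E \<theta>" "of_real (g \<theta>)" "of_real (y \<theta>)" "of_real (sin \<theta>)" "of_real (g' \<theta>)"]
      show ?thesis by (simp only: F'_def of_real_mult of_real_add of_real_diff of_real_1 of_real_numeral)
    qed
    also have "norm \<dots> = a \<theta> * norm (of_real (1 - g \<theta> * y \<theta>) + \<i> * of_real (2 * sin \<theta> * g \<theta> + g' \<theta>))"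
      by (simp add: norm_mult a_def E_def)
    also have "\<dots> \<le> exp 4 * (\<bar>1 - g \<theta> * y \<theta>\<bar> + \<bar>2 * sin \<theta> * g \<theta> + g' \<theta>\<bar>)"
    proof (intro mult_mono)
      show "a \<theta> \<le> exp 4" unfolding a_def by (rule exp_two_cos_le)
      show "norm (of_real (1 - g \<theta> * y \<theta>) + \<i> * of_real (2 * sin \<theta> * g \<theta> + g' \<theta>)) 
         \<le> \<bar>1 - g \<theta> * y \<theta>\<bar> + \<bar>2 * sin \<theta> * g \<theta> + g' \<theta>\<bar>"
        by (rule order.trans[OF norm_triangle_ineq]) (simp only: norm_mult norm_of_real norm_ii mult_1 order.refl)
    qed auto
    also have "\<dots> \<le> exp 4 * (?L \<theta> + (1 / \<mu> + ?M \<theta>))"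
    proof (intro mult_left_mono add_mono)
      have "1 - g \<theta> * y \<theta> = (\<mu>\<^sup>2 + (y \<theta>)\<^sup>2 - y \<theta> * y \<theta>) / (\<mu>\<^sup>2 + (y \<theta>)\<^sup>2)"
      proof -
        have "1 - x / P * x = (P - x * x) / P" if "P \<noteq> 0" for x P :: real
          using that by (simp add: diff_divide_distrib)
        from this[OF less_imp_neq[OF p, symmetric]] show ?thesis unfolding g_def .
      qed
      then have "1 - g \<theta> * y \<theta> = ?L \<theta>" by (simp add: power2_eq_square y_def)
      moreover have "?L \<theta> \<ge> 0" by simp
      ultimately show "\<bar>1 - g \<theta> * y \<theta>\<bar> \<le> ?L \<theta>" by (simp only: abs_of_nonneg)
      have "\<bar>2 * sin \<theta> * g \<theta> + g' \<theta>\<bar> \<le> \<bar>2 * sin \<theta> * g \<theta>\<bar> + \<bar>g' \<theta>\<bar>" by (rule abs_triangle_ineq)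
      also have "\<bar>2 * sin \<theta> * g \<theta>\<bar> \<le> 2 * (1 / (2 * \<mu>))"
      proof -
        have "\<bar>2 * sin \<theta> * g \<theta>\<bar> = 2 * (\<bar>sin \<theta>\<bar> * \<bar>g \<theta>\<bar>)" by (simp add: abs_mult)
        also have "\<dots> \<le> 2 * (1 * (1 / (2 * \<mu>)))"
          unfolding g_def by (intro mult_left_mono mult_mono lorentzian_deriv_bound assms) auto
        finally show ?thesis by simp
      qed
      also have "\<bar>g' \<theta>\<bar> \<le> ?M \<theta>"
      proof -
        have "\<bar>g' \<theta>\<bar> = \<bar>(\<mu>\<^sup>2 - (y \<theta>)\<^sup>2) / (\<mu>\<^sup>2 + (y \<theta>)\<^sup>2)\<^sup>2\<bar> * \<bar>2 * r * cos \<theta>\<bar>" by (simp add: g'_def abs_mult)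
        also have "\<dots> \<le> 1 / (\<mu>\<^sup>2 + (y \<theta>)\<^sup>2) * \<bar>2 * r * cos \<theta>\<bar>"
          by (intro mult_right_mono lorentzian_deriv_bound assms) auto
        finally show ?thesis by (simp add: y_def)
      qed
      finally show "\<bar>2 * sin \<theta> * g \<theta> + g' \<theta>\<bar> \<le> 1 / \<mu> + ?M \<theta>" by simp
    qed simp
    finally show ?thesis .
  qed
  have i1: "?L integrable_on {-pi..pi}" and b1: "integral {-pi..pi} ?L \<le> 2 * pi * \<mu> / sqrt (2 * r * b)"
    using lorentzian_sin_integral[of r \<mu> b "of_int n"] assms by auto
  note i2 = cos_lorentzian_integral[OF assms(1,2), of "of_int n"]
  have i3: "(\<lambda>\<theta>. 1 / \<mu> :: real) integrable_on {-pi..pi}" by (rule integrable_const_ivl)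
  have "norm (heat_kernel r n) = norm (integral {-pi..pi} (\<lambda>\<theta>. of_real (a \<theta>) * E \<theta> + \<i> * F' \<theta>))"
    using sum by (simp add: integral_unique)
  also have "\<dots> \<le> integral {-pi..pi} (\<lambda>\<theta>. exp 4 * (?L \<theta> + (1 / \<mu> + ?M \<theta>)))"
  proof (rule integral_norm_bound_integral)
    show "(\<lambda>\<theta>. of_real (a \<theta>) * E \<theta> + \<i> * F' \<theta>) integrable_on {-pi..pi}" using sum by blast
    show "(\<lambda>\<theta>. exp 4 * (?L \<theta> + (1 / \<mu> + ?M \<theta>))) integrable_on {-pi..pi}"
      by (intro integrable_on_mult_right integrable_add i1 i2 i3)
  qed (rule bd)
  also have "\<dots> = exp 4 * (integral {-pi..pi} ?L + (2 * pi / \<mu> + integral {-pi..pi} ?M))"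
    using integral_add[OF i1 integrable_add[OF i3 i2(1)]] integral_add[OF i3 i2(1)] by simp
  also have "\<dots> \<le> exp 4 * (2 * pi * \<mu> / sqrt (2 * r * b) + (2 * pi / \<mu> + 3 * pi / \<mu>))"
    using b1 i2(2) by (intro mult_left_mono add_mono) auto
  also have "2 * pi / \<mu> + 3 * pi / \<mu> = 5 * pi / \<mu>" by (simp add: add_divide_distrib[symmetric])
  finally show ?thesis .
qed

text \<open>The choice \<mu> = (r b)^(1/4) balances \<mu> / sqrt (r b) against 1 / \<mu>, giving 7 =
  2 + 5. The floor r^(1/3) in b, the Airy scale of the turning point, is the value at which \<mu>
  and b coincide.\<close>

lemma heat_kernel_decay:
  fixes r :: real and n :: int
  assumes "r \<ge> 1"
  defines "b \<equiv> max \<bar>2 * r - \<bar>of_int n\<bar>\<bar> (r powr (1/3))"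
  shows "norm (heat_kernel r n) \<le> 7 * pi * exp 4 * (r * b) powr (-1/4)"
proof -
  define \<mu> where "\<mu> = (r * b) powr (1/4)"
  have r: "r > 0" using assms(1) by simp
  have b: "b > 0" unfolding b_def using r by (intro less_le_trans[OF _ max.cobounded2]) auto
  have rb: "r * b > 0" using r b by simp
  then have \<mu>: "\<mu> > 0" using r b by (simp add: \<mu>_def)
  have "b \<le> max \<bar>2 * r - \<bar>of_int n\<bar>\<bar> \<mu>"
  proof (cases "r powr (1/3) \<le> \<bar>2 * r - \<bar>of_int n\<bar>\<bar>")
    case False
    then have b': "b = r powr (1/3)" by (simp add: b_def)
    have "r * b = r powr (1 + 1/3)" unfolding b' powr_add using r by simp
    then have "\<mu> = b" unfolding \<mu>_def b' by (simp add: powr_powr)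
    then show ?thesis by simp
  qed (simp add: b_def)
  from heat_kernel_bound_param[OF r \<mu> b this]
  have "norm (heat_kernel r n) \<le> exp 4 * (2 * pi * \<mu> / sqrt (2 * r * b) + 5 * pi / \<mu>)" .
  also have "2 * pi * \<mu> / sqrt (2 * r * b) \<le> 2 * pi * \<mu> / sqrt (r * b)"
    using rb \<mu> r b by (intro divide_left_mono real_sqrt_le_mono mult_pos_pos) auto
  also have "2 * pi * \<mu> / sqrt (r * b) = 2 * pi * (r * b) powr (-1/4)"
  proof -
    have "\<mu> / sqrt (r * b) = (r * b) powr (1/4 - 1/2)"
      unfolding \<mu>_def powr_half_sqrt[OF less_imp_le[OF rb], symmetric] powr_diff[symmetric] ..
    also have "(1/4 - 1/2 :: real) = -1/4" by simp
    finally show ?thesis by (simp only: times_divide_eq_right[symmetric])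
  qed
  also have "5 * pi / \<mu> = 5 * pi * (r * b) powr (-1/4)"
    using powr_minus_divide[of "r * b" "1/4"] by (simp add: \<mu>_def)
  finally show ?thesis by (simp add: algebra_simps)
qed

lemma norm_heat_kernel_le: "norm (heat_kernel r n) \<le> 2 * pi * exp 4"
proof -
  have "norm (heat_kernel r n) \<le> exp 4 * (pi - (-pi))"
    unfolding heat_kernel_def
  proof (rule integral_bound)
    show "continuous_on {-pi..pi} (\<lambda>\<theta>. exp (\<i> * of_real (of_int n * \<theta>)) * exp (Complex 1 r * of_real (2 - 2 * cos \<theta>)))"
      by (intro continuous_intros)
    show "norm (exp (\<i> * of_real (of_int n * \<theta>)) * exp (Complex 1 r * of_real (2 - 2 * cos \<theta>))) \<le> exp 4" for \<theta>
      unfolding heat_kernel_integrand norm_mult using exp_two_cos_le[of \<theta>] by simp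
  qed auto
  then show ?thesis by (simp add: mult_ac)
qed

lemma continuous_on_heat_kernel: "continuous_on S (\<lambda>r. heat_kernel r n)"
proof -
  have "continuous_on (UNIV \<times> cbox (-pi) pi) (\<lambda>(r, \<theta>). exp (\<i> * of_real (of_int n * \<theta>)) * exp (Complex 1 r * of_real (2 - 2 * cos \<theta>)))"
    by (auto simp: case_prod_unfold Complex_eq intro!: continuous_intros)
  from integral_continuous_on_param[OF this]
  have "continuous_on UNIV (\<lambda>r. heat_kernel r n)" unfolding heat_kernel_def by simp
  then show ?thesis by (rule continuous_on_subset) simp
qed

section \<open>Weighted fifth-power integral of the one-variable kernel, uniformly in n\<close>

text \<open>Since 5/4 > 1 the bound does not depend on R. The width \<beta> keeps the peak finite,
  and each of its two sides contributes at most 2 \<beta>^(-1/4).\<close>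

lemma integral_peak_le:
  fixes \<beta> M R :: real
  assumes "\<beta> > 0"
  shows "(\<lambda>r. (\<beta> + \<bar>2 * r - M\<bar>) powr (-5/4)) integrable_on {1..R}"
    and "integral {1..R} (\<lambda>r. (\<beta> + \<bar>2 * r - M\<bar>) powr (-5/4)) \<le> 4 * \<beta> powr (-1/4)"
proof -
  let ?f = "\<lambda>r. (\<beta> + \<bar>2 * r - M\<bar>) powr (-5/4)"
  have cont: "continuous_on S ?f" for S
    using assms by (intro continuous_intros) (auto simp: add_pos_nonneg less_imp_neq[THEN not_sym])
  then show int: "?f integrable_on {1..R}" by (rule integrable_continuous_real)
  \<comment> \<open>The interval is enlarged to contain the peak M / 2, where the antiderivative
    changes form.\<close>
  define a where "a = min 1 (M / 2)"
  define c where "c = M / 2"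
  define b where "b = max R (M / 2)"
  have abc: "a \<le> c" "c \<le> b" by (auto simp: a_def c_def b_def)
  have l: "(?f has_integral 2 * (\<beta> + M - 2 * c) powr (-1/4) - 2 * (\<beta> + M - 2 * a) powr (-1/4)) {a..c}"
  proof (rule fundamental_theorem_of_calculus[OF abc(1)])
    fix r assume r: "r \<in> {a..c}"
    then have "\<beta> + M - 2 * r > 0" using assms by (simp add: c_def)
    then have "((\<lambda>r. 2 * (\<beta> + M - 2 * r) powr (-1/4)) has_real_derivative 
        2 * ((-1/4) * (\<beta> + M - 2 * r) powr (-1/4 - 1) * (-2))) (at r within {a..c})"
      by (auto intro!: derivative_eq_intros)
    moreover have "\<beta> + \<bar>2 * r - M\<bar> = \<beta> + M - 2 * r" using r by (auto simp: c_def)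
    ultimately show "((\<lambda>r. 2 * (\<beta> + M - 2 * r) powr (-1/4)) has_vector_derivative ?f r) (at r within {a..c})"
      by (simp only: has_real_derivative_iff_has_vector_derivative) simp
  qed
  have rr: "(?f has_integral (- 2 * (\<beta> + 2 * b - M) powr (-1/4)) - (- 2 * (\<beta> + 2 * c - M) powr (-1/4))) {c..b}"
  proof (rule fundamental_theorem_of_calculus[OF abc(2)])
    fix r assume r: "r \<in> {c..b}"
    then have "\<beta> + 2 * r - M > 0" using assms by (simp add: c_def)
    then have "((\<lambda>r. - 2 * (\<beta> + 2 * r - M) powr (-1/4)) has_real_derivative 
        - 2 * ((-1/4) * (\<beta> + 2 * r - M) powr (-1/4 - 1) * 2)) (at r within {c..b})"
      by (auto intro!: derivative_eq_intros)
    moreover have "\<beta> + \<bar>2 * r - M\<bar> = \<beta> + 2 * r - M" using r by (simp add: c_def)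
    ultimately show "((\<lambda>r. - 2 * (\<beta> + 2 * r - M) powr (-1/4)) has_vector_derivative ?f r) (at r within {c..b})"
      by (simp only: has_real_derivative_iff_has_vector_derivative) simp
  qed
  have "integral {1..R} ?f \<le> integral {a..b} ?f"
    using cont by (intro integral_subset_le) (auto simp: a_def b_def intro!: integrable_continuous_real)
  also have "\<dots> = (2 * (\<beta> + M - 2 * c) powr (-1/4) - 2 * (\<beta> + M - 2 * a) powr (-1/4)) +
      ((- 2 * (\<beta> + 2 * b - M) powr (-1/4)) - (- 2 * (\<beta> + 2 * c - M) powr (-1/4)))"
    using has_integral_combine[OF abc l rr] by (rule integral_unique)
  also have "\<dots> \<le> 2 * (\<beta> + M - 2 * c) powr (-1/4) + 2 * (\<beta> + 2 * c - M) powr (-1/4)"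
    using powr_ge_zero[of "\<beta> + M - 2 * a" "-1/4"] powr_ge_zero[of "\<beta> + 2 * b - M" "-1/4"] by linarith
  also have "\<dots> = 4 * \<beta> powr (-1/4)" by (simp add: c_def)
  finally show "integral {1..R} ?f \<le> 4 * \<beta> powr (-1/4)" .
qed

text \<open>If |2 r - |n|| > r, then b >= r and the size is r^(-7/6). Otherwise |n| / 3 <= r <= |n|,
  so the slowly varying powers of r can be frozen at powers of M, which leaves a pure peak in
  r.\<close>

lemma weight_peak_le:
  fixes r :: real and n :: int
  assumes "r \<ge> 1"
  defines "b \<equiv> max \<bar>2 * r - \<bar>of_int n\<bar>\<bar> (r powr (1/3))"
    and "M \<equiv> max 1 \<bar>of_int n\<bar>"
  defines "\<beta> \<equiv> (M / 3) powr (1/3)"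
  shows "r powr (1/12) * b powr (-5/4) \<le>
     r powr (-7/6) + 4 * (M powr (1/12) * (\<beta> + \<bar>2 * r - M\<bar>) powr (-5/4))"
proof (cases "\<bar>2 * r - \<bar>of_int n\<bar>\<bar> > r")
  case True
  then have "r \<le> b" by (simp add: b_def)
  then have "b powr (-5/4) \<le> r powr (-5/4)" using assms(1) by (intro powr_mono2') auto
  then have "r powr (1/12) * b powr (-5/4) \<le> r powr (1/12) * r powr (-5/4)" by (intro mult_left_mono) auto
  also have "\<dots> = r powr (-7/6)" by (simp add: powr_add[symmetric])
  finally show ?thesis by (simp add: add_increasing2)
next
  case False
  have M: "M = \<bar>of_int n\<bar>" "M / 3 \<le> r" "r \<le> M" "M \<ge> 1" using False assms(1) by (auto simp: M_def)
  have \<beta>: "\<beta> > 0" using M(4) by (simp add: \<beta>_def)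
  have "\<beta> \<le> r powr (1/3)" unfolding \<beta>_def using M by (intro powr_mono2) auto
  \<comment> \<open>A maximum dominates the mean of its two entries; this costs the factor 2^(5/4),
    later rounded up to 4.\<close>
  then have "(\<beta> + \<bar>2 * r - M\<bar>) / 2 \<le> b"
  proof -
    have "(\<beta> + A) / 2 \<le> max A B" if "\<beta> \<le> B" for A B :: real
      using that by (cases "A \<le> B") (auto simp: max_def)
    then show ?thesis using \<open>\<beta> \<le> r powr (1/3)\<close> unfolding b_def M(1) .
  qed
  then have "b powr (-5/4) \<le> ((\<beta> + \<bar>2 * r - M\<bar>) / 2) powr (-5/4)"
    using \<beta> by (intro powr_mono2') (auto simp: add_pos_nonneg)
  also have "\<dots> = (\<beta> + \<bar>2 * r - M\<bar>) powr (-5/4) / 2 powr (-5/4)"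
    using \<beta> by (intro powr_divide)
  also have "\<dots> = 2 powr (5/4) * (\<beta> + \<bar>2 * r - M\<bar>) powr (-5/4)" 
    using powr_minus_divide[of "2::real" "5/4"] by simp
  also have "2 powr (5/4) \<le> (2::real) powr 2" by (intro powr_mono) auto
  finally have "b powr (-5/4) \<le> 4 * (\<beta> + \<bar>2 * r - M\<bar>) powr (-5/4)" by (simp add: mult_right_mono)
  moreover have "r powr (1/12) \<le> M powr (1/12)" using M assms(1) by (intro powr_mono2) auto
  ultimately have "r powr (1/12) * b powr (-5/4) \<le> M powr (1/12) * (4 * (\<beta> + \<bar>2 * r - M\<bar>) powr (-5/4))"
    by (intro mult_mono) auto
  then show ?thesis using powr_ge_zero[of r "-7/6"] by linarith
qed

text \<open>Five kernels contribute (r b)^(-5/4) and the weight is of order r^(4/3), so that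
  r^(1/12) b^(-5/4) remains.\<close>

lemma heat_kernel_weighted_le:
  fixes r :: real and n :: int
  assumes "r \<ge> 1"
  defines "M \<equiv> max 1 \<bar>of_int n\<bar>"
  defines "\<beta> \<equiv> (M / 3) powr (1/3)"
  shows "(1 + r\<^sup>2) powr (2/3) * norm (heat_kernel r n) ^ 5 \<le> 
    4 * (7 * pi * exp 4) ^ 5 * (r powr (-7/6) + 4 * (M powr (1/12) * (\<beta> + \<bar>2 * r - M\<bar>) powr (-5/4)))"
proof -
  define b where "b = max \<bar>2 * r - \<bar>of_int n\<bar>\<bar> (r powr (1/3))"
  have r: "r > 0" using assms(1) by simp
  have b: "b > 0" unfolding b_def using r by (intro less_le_trans[OF _ max.cobounded2]) auto
  have "norm (heat_kernel r n) ^ 5 \<le> (7 * pi * exp 4 * (r * b) powr (-1/4)) ^ 5"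
    unfolding b_def by (intro power_mono heat_kernel_decay assms) simp
  also have "\<dots> = (7 * pi * exp 4) ^ 5 * (r powr (-5/4) * b powr (-5/4))"
    using r b by (simp add: power_mult_distrib powr_mult powr_powr powr_power)
  finally have 1: "norm (heat_kernel r n) ^ 5 \<le> (7 * pi * exp 4) ^ 5 * (r powr (-5/4) * b powr (-5/4))" .
  have "(1 + r\<^sup>2) powr (2/3) \<le> (2 * r\<^sup>2) powr (2/3)"
    using assms(1) by (intro powr_mono2) auto
  also have "\<dots> = 2 powr (2/3) * (r\<^sup>2) powr (2/3)" by (rule powr_mult)
  also have "(r\<^sup>2) powr (2/3) = r powr (4/3)" using r by (simp add: powr_powr flip: powr_numeral)
  also have "2 powr (2/3) \<le> (2::real) powr 2" by (intro powr_mono) auto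
  finally have 2: "(1 + r\<^sup>2) powr (2/3) \<le> 4 * r powr (4/3)" by (simp add: mult_right_mono)
  have "(1 + r\<^sup>2) powr (2/3) * norm (heat_kernel r n) ^ 5 \<le> 
     (4 * r powr (4/3)) * ((7 * pi * exp 4) ^ 5 * (r powr (-5/4) * b powr (-5/4)))"
    by (intro mult_mono 1 2) auto
  also have "\<dots> = 4 * (7 * pi * exp 4) ^ 5 * ((r powr (4/3) * r powr (-5/4)) * b powr (-5/4))" by (simp only: mult_ac)
  also have "r powr (4/3) * r powr (-5/4) = r powr (1/12)" by (simp add: powr_add[symmetric])
  also have "4 * (7 * pi * exp 4) ^ 5 * (r powr (1/12) * b powr (-5/4)) \<le> 
     4 * (7 * pi * exp 4) ^ 5 * (r powr (-7/6) + 4 * (M powr (1/12) * (\<beta> + \<bar>2 * r - M\<bar>) powr (-5/4)))"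
    unfolding b_def M_def \<beta>_def by (intro mult_left_mono weight_peak_le assms) simp
  finally show ?thesis .
qed

text \<open>
  The weight is \<open>\<bar>z\<bar>\<^bsup>11/6\<^esup> \<bar>z\<bar>\<^bsup>-1/2\<^esup>\<close>: the first factor is the price for extracting
  \<open>t\<^bsup>-11/6\<^esup>\<close> from \<open>\<bar>exp (- t\<^sup>2 / (4 z))\<bar>\<close>, the second one comes from the subordination formula.
\<close>

lemma heat_kernel_L5:
  obtains C where "C \<ge> 0" "\<And>n R. R \<ge> 0 \<Longrightarrow> integral {0..R} (\<lambda>r. (1 + r\<^sup>2) powr (2/3) * norm (heat_kernel r n) ^ 5) \<le> C"
proof -
  define K where "K = 4 * (7 * pi * exp 4 :: real) ^ 5"
  define C where "C = 2 powr (2/3) * (2 * pi * exp 4) ^ 5 + K * (6 + 4 * (4 * 3 powr (1/12)))"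
  have K: "K \<ge> 0" by (simp add: K_def)
  have "integral {0..R} (\<lambda>r. (1 + r\<^sup>2) powr (2/3) * norm (heat_kernel r n) ^ 5) \<le> C" if "R \<ge> 0" for n R
  proof -
    let ?f = "\<lambda>r. (1 + r\<^sup>2) powr (2/3) * norm (heat_kernel r n) ^ 5"
    define M where "M = max 1 \<bar>real_of_int n\<bar>"
    define \<beta> where "\<beta> = (M / 3) powr (1/3)"
    have M: "M \<ge> 1" by (simp add: M_def)
    have \<beta>: "\<beta> > 0" using M by (simp add: \<beta>_def)
    define R' where "R' = max R 1"
    have R': "R' \<ge> 1" "R \<le> R'" by (auto simp: R'_def)
    have cont: "continuous_on S ?f" for S
    proof -
      have "1 + r\<^sup>2 \<noteq> 0" for r :: real by (smt (verit) zero_le_power2)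
      then show ?thesis by (intro continuous_intros continuous_on_heat_kernel) auto
    qed
    have int: "?f integrable_on {a..b}" for a b by (intro integrable_continuous_real cont)
    have h76: "((\<lambda>r. r powr (-7/6)) has_integral (- 6 * R' powr (-1/6)) - (- 6 * 1 powr (-1/6))) {1..R'}"
    proof (rule fundamental_theorem_of_calculus[OF R'(1)])
      fix r assume "r \<in> {1..R'}"
      then have "((\<lambda>r. - 6 * r powr (-1/6)) has_real_derivative - 6 * ((-1/6) * r powr (-1/6 - 1))) (at r within {1..R'})"
        by (auto intro!: derivative_eq_intros)
      then show "((\<lambda>r. - 6 * r powr (-1/6)) has_vector_derivative r powr (-7/6)) (at r within {1..R'})"
        by (simp add: has_real_derivative_iff_has_vector_derivative)
    qed
    let ?g = "\<lambda>r. K * (r powr (-7/6) + 4 * (M powr (1/12) * (\<beta> + \<bar>2 * r - M\<bar>) powr (-5/4)))"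
    note pk = integral_peak_le[OF \<beta>, where M = M and R = R']
    have gint: "?g integrable_on {1..R'}"
      using h76 pk(1) by (intro integrable_on_mult_right integrable_add) auto
    have "integral {0..R} ?f \<le> integral {0..R'} ?f"
      by (rule integral_subset_le) (use R' int in auto)
    also have "\<dots> = integral {0..1} ?f + integral {1..R'} ?f"
      using R' by (intro Henstock_Kurzweil_Integration.integral_combine[symmetric] int) auto
    also have "integral {0..1} ?f \<le> integral {0..1} (\<lambda>r::real. 2 powr (2/3) * (2 * pi * exp 4) ^ 5)"
    proof (rule integral_le[OF int integrable_const_ivl])
      fix r :: real assume "r \<in> {0..1}"
      then have "r\<^sup>2 \<le> 1" by (simp add: power_le_one)
      then show "?f r \<le> 2 powr (2/3) * (2 * pi * exp 4) ^ 5"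
        by (intro mult_mono powr_mono2 power_mono norm_heat_kernel_le) auto
    qed
    also have "\<dots> = 2 powr (2/3) * (2 * pi * exp 4) ^ 5" by simp
    also have "integral {1..R'} ?f \<le> integral {1..R'} ?g"
      unfolding K_def M_def \<beta>_def by (intro integral_le int gint[unfolded K_def M_def \<beta>_def] heat_kernel_weighted_le) auto
    also have "integral {1..R'} ?g = K * (integral {1..R'} (\<lambda>r. r powr (-7/6)) + 
       4 * (M powr (1/12) * integral {1..R'} (\<lambda>r. (\<beta> + \<bar>2 * r - M\<bar>) powr (-5/4))))"
    proof -
      have "(\<lambda>r. 4 * (M powr (1/12) * (\<beta> + \<bar>2 * r - M\<bar>) powr (-5/4))) integrable_on {1..R'}"
        using pk(1) by (intro integrable_on_mult_right)
      from integral_add[OF has_integral_integrable[OF h76] this] show ?thesis by simp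
    qed
    also have "\<dots> \<le> K * (6 + 4 * (4 * 3 powr (1/12)))"
    proof (intro mult_left_mono add_mono K)
      show "integral {1..R'} (\<lambda>r. r powr (-7/6)) \<le> 6"
        using integral_unique[OF h76] powr_ge_zero[of R' "-1/6"] by simp
      \<comment> \<open>The powers of M cancel exactly, since \<beta>^(-1/4) is M^(-1/12) up to a
        constant. This makes the bound uniform in n and is the place where 11/6 is
        determined.\<close>
      have "M powr (1/12) * integral {1..R'} (\<lambda>r. (\<beta> + \<bar>2 * r - M\<bar>) powr (-5/4)) \<le> M powr (1/12) * (4 * \<beta> powr (-1/4))"
        by (intro mult_left_mono pk(2)) simp
      also have "\<beta> powr (-1/4) = M powr (-1/12) / 3 powr (-1/12)"
        unfolding \<beta>_def powr_powr using M by (simp add: powr_divide)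
      also have "M powr (1/12) * (4 * (M powr (-1/12) / 3 powr (-1/12))) = 4 * (3 powr (1/12))"
      proof -
        have "M powr (1/12) * M powr (-1/12) = 1" using M by (simp add: powr_add[symmetric])
        moreover have "(3::real) powr (-1/12) = 1 / 3 powr (1/12)"
          using powr_minus_divide[of "3::real" "1/12"] by simp
        ultimately show ?thesis by simp
      qed
      finally show "M powr (1/12) * integral {1..R'} (\<lambda>r. (\<beta> + \<bar>2 * r - M\<bar>) powr (-5/4)) \<le> 4 * 3 powr (1/12)" .
    qed simp
    finally show ?thesis by (simp add: C_def)
  qed
  moreover have "C \<ge> 0" unfolding C_def using K by (intro add_nonneg_nonneg mult_nonneg_nonneg) auto
  ultimately show ?thesis using that by blast
qed

section \<open>A subordination formula for the wave multiplier\<close>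

text \<open>Classically (sqrt pi / 2) erfi: the entire primitive of exp (w^2) that vanishes at
  0.\<close>

definition gauss_prim :: "complex \<Rightarrow> complex" where
  "gauss_prim = (SOME P. (\<forall>w. (P has_field_derivative exp (w\<^sup>2)) (at w)) \<and> P 0 = 0)"

lemma gauss_prim: "(gauss_prim has_field_derivative exp (w\<^sup>2)) (at w)" "gauss_prim 0 = 0"
proof -
  have "(\<lambda>w::complex. exp (w\<^sup>2)) holomorphic_on UNIV" by (intro holomorphic_intros)
  then have "\<exists>g. \<forall>w::complex. (g has_field_derivative exp (w\<^sup>2)) (at w)"
    by (rule holomorphic_convex_primitive'[OF convex_UNIV open_UNIV]) auto
  then obtain g where g: "\<And>w::complex. (g has_field_derivative exp (w\<^sup>2)) (at w)" by blast
  have "((\<lambda>w. g w - g 0) has_field_derivative exp (w\<^sup>2)) (at w)" for w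
    using DERIV_diff[OF g DERIV_const[of "g 0"]] by simp
  then have "\<exists>P. (\<forall>w. (P has_field_derivative exp (w\<^sup>2)) (at w)) \<and> P 0 = (0::complex)"
    by (intro exI[of _ "\<lambda>w. g w - g 0"]) auto
  from someI_ex[OF this] show "(gauss_prim has_field_derivative exp (w\<^sup>2)) (at w)" "gauss_prim 0 = 0"
    unfolding gauss_prim_def by auto
qed

lemma continuous_on_gauss_prim: "continuous_on S gauss_prim"
  using gauss_prim(1) DERIV_isCont by (intro continuous_at_imp_continuous_on) blast

lemma gauss_prim_minus: "gauss_prim (- w) = - gauss_prim w"
proof -
  have d: "((\<lambda>w. gauss_prim w + gauss_prim (- w)) has_field_derivative 0) (at w)" for w
  proof -
    have "((\<lambda>w. gauss_prim (- w)) has_field_derivative exp ((- w)\<^sup>2) * (- 1)) (at w)"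
      by (rule DERIV_chain2[OF gauss_prim(1)]) (auto intro!: derivative_eq_intros)
    from DERIV_add[OF gauss_prim(1) this] show ?thesis by simp
  qed
  then obtain c where "\<And>w. w \<in> UNIV \<Longrightarrow> gauss_prim w + gauss_prim (- w) = c"
    using has_field_derivative_zero_constant[of UNIV "\<lambda>w. gauss_prim w + gauss_prim (- w)"]
    by (auto intro: has_field_derivative_at_within)
  from this[of w] this[of 0] have "gauss_prim w + gauss_prim (- w) = 0" by (simp add: gauss_prim)
  then show ?thesis by (metis add.commute minus_unique)
qed

lemma gauss_prim_imag_deriv:
  "((\<lambda>y. gauss_prim (\<i> * of_real y)) has_vector_derivative \<i> * of_real (exp (- y\<^sup>2))) (at y within S)"
proof (rule has_vector_derivative_real_field)
  have "((\<lambda>z. gauss_prim (\<i> * z)) has_field_derivative exp ((\<i> * of_real y)\<^sup>2) * \<i>) (at (of_real y))"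
    by (rule DERIV_chain2[OF gauss_prim(1)]) (auto intro!: derivative_eq_intros)
  moreover have "exp ((\<i> * of_real y)\<^sup>2) = of_real (exp (- y\<^sup>2))"
    by (simp add: power_mult_distrib exp_of_real[symmetric])
  ultimately show "((\<lambda>z. gauss_prim (\<i> * z)) has_field_derivative \<i> * of_real (exp (- y\<^sup>2))) (at (of_real y))"
    by (simp add: mult.commute)
qed

text \<open>On the imaginary axis the value is i times the integral of exp (- s^2) from 0 to y,
  which increases to a finite limit. Classically c = sqrt pi / 2.\<close>

lemma gauss_prim_imag:
  obtains c where "c > 0" "((\<lambda>y. gauss_prim (\<i> * of_real y)) \<longlongrightarrow> \<i> * of_real c) at_top"
    "\<And>y. y \<ge> 0 \<Longrightarrow> norm (gauss_prim (\<i> * of_real y)) \<le> c"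
proof -
  define E where "E = (\<lambda>y. Im (gauss_prim (\<i> * of_real y)))"
  have dE: "(E has_real_derivative exp (- y\<^sup>2)) (at y within S)" for y S
    using bounded_linear.has_vector_derivative[OF bounded_linear_Im gauss_prim_imag_deriv[of y S]]
    by (simp add: E_def has_real_derivative_iff_has_vector_derivative)
  have dR: "((\<lambda>y. Re (gauss_prim (\<i> * of_real y))) has_real_derivative 0) (at y within S)" for y S
    using bounded_linear.has_vector_derivative[OF bounded_linear_Re gauss_prim_imag_deriv[of y S]]
    by (simp add: has_real_derivative_iff_has_vector_derivative)
  have E0: "E 0 = 0" by (simp add: E_def gauss_prim)
  have R0: "Re (gauss_prim (\<i> * of_real y)) = 0" for y
  proof -
    have "(\<lambda>y. Re (gauss_prim (\<i> * of_real y))) y = (\<lambda>y. Re (gauss_prim (\<i> * of_real y))) 0"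
      using dR by (intro DERIV_isconst_all) blast
    then show ?thesis by (simp add: gauss_prim)
  qed
  have PE: "gauss_prim (\<i> * of_real y) = \<i> * of_real (E y)" for y
    by (simp add: complex_eq_iff R0 E_def)
  have mono: "E x < E y" if "x < y" for x y
    by (intro DERIV_pos_imp_increasing[OF that]) (use dE exp_gt_zero in blast)
  have bd: "E y \<le> exp 1" if "y \<ge> 0" for y
  proof -
    \<comment> \<open>The majorant exp (1 - 2 x) of exp (- x^2) comes from (x - 1)^2 >= 0; the added
      term is minus a primitive of it, so the sum is nonincreasing.\<close>
    have "E y + exp (1 - 2 * y) / 2 \<le> E 0 + exp (1 - 2 * 0) / 2"
    proof (rule DERIV_nonpos_imp_nonincreasing[OF that])
      fix x assume "0 \<le> x" "x \<le> y"
      have "((\<lambda>y. E y + exp (1 - 2 * y) / 2) has_real_derivative exp (- x\<^sup>2) + exp (1 - 2 * x) * (- 2) / 2) (at x)"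
        by (rule derivative_eq_intros dE refl | simp)+
      moreover have "exp (- x\<^sup>2) + exp (1 - 2 * x) * (- 2) / 2 \<le> 0"
      proof -
        have "- x\<^sup>2 \<le> 1 - 2 * x" using zero_le_power2[of "x - 1"] by (simp add: power2_diff)
        then show ?thesis by simp
      qed
      ultimately show "\<exists>d. ((\<lambda>y. E y + exp (1 - 2 * y) / 2) has_real_derivative d) (at x) \<and> d \<le> 0" by blast
    qed
    moreover have "exp (1 - 2 * y) \<ge> 0" "exp (1::real) \<ge> 0" by auto
    ultimately show ?thesis using E0 by (simp only: mult_zero_right diff_zero)
  qed
  define c where "c = (SUP y\<in>{0..}. E y)"
  have bdd: "bdd_above (E ` {0..})" using bd by (auto intro!: bdd_aboveI[of _ "exp 1"])
  have le: "E y \<le> c" if "y \<ge> 0" for y unfolding c_def using that bdd by (intro cSUP_upper) auto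
  have c: "c > 0" using le[of 1] mono[of 0 1] E0 by simp
  have "(E \<longlongrightarrow> c) at_top"
  proof (rule order_tendstoI)
    fix a assume "a < c"
    then obtain y0 where "y0 \<ge> 0" "E y0 > a"
      unfolding c_def using bdd by (subst (asm) less_cSUP_iff) auto
    then have "E y > a" if "y > y0" for y using mono[OF that] by linarith
    then show "\<forall>\<^sub>F y in at_top. a < E y" by (auto simp: eventually_at_top_dense)
  next
    fix a assume "c < a"
    then show "\<forall>\<^sub>F y in at_top. E y < a" using le by (intro eventually_mono[OF eventually_ge_at_top[of 0]]) (auto intro: le_less_trans)
  qed
  then have "((\<lambda>y. \<i> * of_real (E y)) \<longlongrightarrow> \<i> * of_real c) at_top" by (intro tendsto_intros)
  then have "((\<lambda>y. gauss_prim (\<i> * of_real y)) \<longlongrightarrow> \<i> * of_real c) at_top" unfolding PE .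
  moreover have "norm (gauss_prim (\<i> * of_real y)) \<le> c" if "y \<ge> 0" for y
  proof -
    have "E y \<ge> 0" using mono[of 0 y] E0 that by (cases "y = 0") auto
    then show ?thesis unfolding PE norm_mult using le[OF that] by simp
  qed
  ultimately show ?thesis using that c by blast
qed

text \<open>Integration by parts along the circular arc from \<open>w\<close> to \<open>\<i> \<bar>w\<bar>\<close>, on which \<open>Re w\<^sup>2\<close> decreases.\<close>

lemma gauss_prim_arc:
  assumes "\<rho> > 0" "\<phi>\<^sub>0 \<in> {0..pi}" "\<rho>\<^sup>2 * cos (2 * \<phi>\<^sub>0) \<le> U" "U \<ge> 0"
  shows "norm (gauss_prim (of_real \<rho> * cis \<phi>\<^sub>0) - gauss_prim (\<i> * of_real \<rho>)) \<le> 4 * exp U / \<rho>"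
proof -
  define w where "w = (\<lambda>\<zeta>. of_real \<rho> * exp (\<i> * \<zeta>))"
  \<comment> \<open>Once the boundary term of one integration by parts is subtracted, the derivative
    along the arc is i exp (w^2) / (2 w). This gains the factor 1 / (2 w^2) over the derivative of
    \<open>gauss_prim (w \<zeta>)\<close>.\<close>
  define f where "f = (\<lambda>\<zeta>. gauss_prim (w \<zeta>) - exp ((w \<zeta>)\<^sup>2) / (2 * w \<zeta>))"
  define S where "S = closed_segment (complex_of_real \<phi>\<^sub>0) (of_real (pi / 2))"
  have w0: "w \<zeta> \<noteq> 0" for \<zeta> using assms(1) by (simp add: w_def)
  have df: "(f has_field_derivative \<i> * exp ((w \<zeta>)\<^sup>2) / (2 * w \<zeta>)) (at \<zeta>)" for \<zeta>
  proof -
    have dw: "(w has_field_derivative \<i> * w \<zeta>) (at \<zeta>)"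
      unfolding w_def by (rule derivative_eq_intros refl | simp)+
    have d1: "((\<lambda>\<zeta>. gauss_prim (w \<zeta>)) has_field_derivative exp ((w \<zeta>)\<^sup>2) * (\<i> * w \<zeta>)) (at \<zeta>)"
      by (rule DERIV_chain2[OF gauss_prim(1) dw])
    have d2: "((\<lambda>v. exp (v\<^sup>2) / (2 * v)) has_field_derivative exp (v\<^sup>2) - exp (v\<^sup>2) / (2 * v\<^sup>2)) (at v)"
      if "v \<noteq> 0" for v :: complex
      using that by (auto intro!: derivative_eq_intros simp: field_simps power2_eq_square)
    have d3: "((\<lambda>\<zeta>. exp ((w \<zeta>)\<^sup>2) / (2 * w \<zeta>)) has_field_derivative 
        (exp ((w \<zeta>)\<^sup>2) - exp ((w \<zeta>)\<^sup>2) / (2 * (w \<zeta>)\<^sup>2)) * (\<i> * w \<zeta>)) (at \<zeta>)"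
      by (rule DERIV_chain2[OF d2[OF w0] dw])
    have "X * (\<i> * v) - (X - X / (2 * v\<^sup>2)) * (\<i> * v) = \<i> * X / (2 * v)" if "v \<noteq> 0" for X v :: complex
      using that by (simp add: field_simps power2_eq_square)
    from this[OF w0] DERIV_diff[OF d1 d3] show ?thesis unfolding f_def by simp
  qed
  have bound: "norm (exp ((w \<zeta>)\<^sup>2) / (2 * w \<zeta>)) \<le> exp U / (2 * \<rho>)" if "\<zeta> \<in> S" for \<zeta>
  proof -
    from that obtain \<phi> where \<phi>: "\<zeta> = of_real \<phi>" "\<phi> \<in> closed_segment \<phi>\<^sub>0 (pi / 2)"
      unfolding S_def closed_segment_of_real by auto
    have "(w \<zeta>)\<^sup>2 = of_real (\<rho>\<^sup>2) * cis (2 * \<phi>)"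
      unfolding w_def \<phi>(1) cis_conv_exp[symmetric] power_mult_distrib by (simp add: Complex.DeMoivre)
    then have re: "Re ((w \<zeta>)\<^sup>2) = \<rho>\<^sup>2 * cos (2 * \<phi>)" by simp
    have "cos (2 * \<phi>) \<le> cos (2 * \<phi>\<^sub>0)"
    proof (cases "\<phi>\<^sub>0 \<le> pi / 2")
      case True
      then have "\<phi>\<^sub>0 \<le> \<phi>" "\<phi> \<le> pi / 2" using \<phi>(2) by (auto simp: closed_segment_eq_real_ivl)
      then show ?thesis using assms(2) by (intro cos_monotone_0_pi_le) auto
    next
      case False
      then have "\<phi> \<le> \<phi>\<^sub>0" "pi / 2 \<le> \<phi>" using \<phi>(2) by (auto simp: closed_segment_eq_real_ivl)
      then have "cos (2 * pi - 2 * \<phi>) \<le> cos (2 * pi - 2 * \<phi>\<^sub>0)" using assms(2) by (intro cos_monotone_0_pi_le) auto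
      then show ?thesis by (simp add: cos_diff)
    qed
    then have "\<rho>\<^sup>2 * cos (2 * \<phi>) \<le> \<rho>\<^sup>2 * cos (2 * \<phi>\<^sub>0)" by (intro mult_left_mono) auto
    then have "Re ((w \<zeta>)\<^sup>2) \<le> U" using re assms(3) by linarith
    moreover have "norm (w \<zeta>) = \<rho>" using assms(1) by (simp add: w_def \<phi>(1) norm_mult)
    ultimately show ?thesis using assms(1) by (simp add: norm_divide norm_mult divide_right_mono)
  qed
  have "norm (f (of_real \<phi>\<^sub>0) - f (of_real (pi / 2))) \<le> exp U / (2 * \<rho>) * norm (of_real \<phi>\<^sub>0 - of_real (pi / 2) :: complex)"
  proof (rule field_differentiable_bound[of S f "\<lambda>\<zeta>. \<i> * exp ((w \<zeta>)\<^sup>2) / (2 * w \<zeta>)"])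
    show "(f has_field_derivative \<i> * exp ((w \<zeta>)\<^sup>2) / (2 * w \<zeta>)) (at \<zeta> within S)" for \<zeta>
      using df by (rule has_field_derivative_at_within)
    show "norm (\<i> * exp ((w \<zeta>)\<^sup>2) / (2 * w \<zeta>)) \<le> exp U / (2 * \<rho>)" if "\<zeta> \<in> S" for \<zeta>
      using bound[OF that] by (simp add: norm_mult norm_divide)
  qed (auto simp: S_def)
  also have "\<dots> \<le> exp U / (2 * \<rho>) * 2"
  proof (intro mult_left_mono)
    have "norm (of_real \<phi>\<^sub>0 - of_real (pi / 2) :: complex) = \<bar>\<phi>\<^sub>0 - pi / 2\<bar>"
      by (metis norm_of_real of_real_diff)
    also have "\<dots> \<le> pi / 2" using assms(2) unfolding atLeastAtMost_iff by linarith
    also have "\<dots> \<le> 2" using pi_less_4 by simp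
    finally show "norm (of_real \<phi>\<^sub>0 - of_real (pi / 2) :: complex) \<le> 2" .
  qed (use assms in auto)
  finally have f: "norm (f (of_real \<phi>\<^sub>0) - f (of_real (pi / 2))) \<le> exp U / \<rho>" by simp
  have w1: "w (of_real \<phi>\<^sub>0) = of_real \<rho> * cis \<phi>\<^sub>0" by (simp add: w_def cis_conv_exp)
  have w2: "w (of_real (pi / 2)) = \<i> * of_real \<rho>"
    unfolding w_def cis_conv_exp[symmetric] by (simp add: mult.commute)
  have e: "norm (exp ((w (of_real \<phi>\<^sub>0))\<^sup>2) / (2 * w (of_real \<phi>\<^sub>0))) \<le> exp U / (2 * \<rho>)"
    "norm (exp ((w (of_real (pi / 2)))\<^sup>2) / (2 * w (of_real (pi / 2)))) \<le> exp U / (2 * \<rho>)"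
    by (rule bound, simp add: S_def)+
  have "gauss_prim (of_real \<rho> * cis \<phi>\<^sub>0) - gauss_prim (\<i> * of_real \<rho>) =
     (f (of_real \<phi>\<^sub>0) - f (of_real (pi / 2))) + exp ((w (of_real \<phi>\<^sub>0))\<^sup>2) / (2 * w (of_real \<phi>\<^sub>0)) - 
     exp ((w (of_real (pi / 2)))\<^sup>2) / (2 * w (of_real (pi / 2)))"
    unfolding f_def w1 w2 by simp
  also have "norm \<dots> \<le> exp U / \<rho> + exp U / (2 * \<rho>) + exp U / (2 * \<rho>)"
    by (intro norm_triangle_le_diff norm_triangle_le add_mono f e)
  also have "\<dots> \<le> 4 * exp U / \<rho>" using assms by (simp add: field_simps)
  finally show ?thesis .
qed

lemma gauss_prim_upper:
  assumes "w \<noteq> 0" "Im w \<ge> 0" "Re (w\<^sup>2) \<le> U" "U \<ge> 0"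
  shows "norm (gauss_prim w - gauss_prim (\<i> * of_real (norm w))) \<le> 4 * exp U / norm w"
proof -
  have w: "w = of_real (norm w) * cis (Arg w)" using rcis_cmod_Arg[of w] by (simp add: rcis_def)
  have "w\<^sup>2 = of_real ((norm w)\<^sup>2) * cis (2 * Arg w)"
    by (subst w) (simp add: power_mult_distrib Complex.DeMoivre)
  then have "(norm w)\<^sup>2 * cos (2 * Arg w) \<le> U" using assms(3) by simp
  moreover have "Arg w \<in> {0..pi}"
    using assms(2) Arg_bounded[of w] by (simp add: Arg_neg_iff not_less[symmetric])
  ultimately show ?thesis using gauss_prim_arc[of "norm w" "Arg w" U] assms w by simp
qed

text \<open>Compactness handles the unit disc, the arc comparison with the imaginary axis handles
  the rest of the upper half plane, and oddness handles the lower one.\<close>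

lemma gauss_prim_bounded:
  assumes "U \<ge> 0"
  obtains B where "B > 0" "\<And>w. Re (w\<^sup>2) \<le> U \<Longrightarrow> norm (gauss_prim w) \<le> B"
proof -
  obtain c where c: "c > 0" "\<And>y. y \<ge> 0 \<Longrightarrow> norm (gauss_prim (\<i> * of_real y)) \<le> c"
    using gauss_prim_imag by metis
  have "bounded (gauss_prim ` cball 0 1)"
    by (intro compact_imp_bounded compact_continuous_image continuous_on_gauss_prim) simp
  then obtain b where b: "b > 0" "\<And>w. norm w \<le> 1 \<Longrightarrow> norm (gauss_prim w) \<le> b"
    unfolding bounded_pos by auto
  define B where "B = b + c + 4 * exp U"
  have up: "norm (gauss_prim w) \<le> B" if w: "Re (w\<^sup>2) \<le> U" "Im w \<ge> 0" for w
  proof (cases "norm w \<le> 1")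
    case True
    then show ?thesis using b c by (simp add: B_def add_increasing2)
  next
    case False
    then have "norm (gauss_prim w - gauss_prim (\<i> * of_real (norm w))) \<le> 4 * exp U / norm w"
      using w assms by (intro gauss_prim_upper) auto
    also have "\<dots> \<le> 4 * exp U / 1" using False by (intro divide_left_mono) auto
    finally have "norm (gauss_prim w) \<le> norm (gauss_prim (\<i> * of_real (norm w))) + 4 * exp U"
      by (simp add: norm_diff_ineq norm_triangle_sub order.trans)
         (smt (verit) norm_triangle_sub)
    then show ?thesis using c(2)[of "norm w"] b(1) by (simp add: B_def)
  qed
  have "norm (gauss_prim w) \<le> B" if w: "Re (w\<^sup>2) \<le> U" for w
  proof (cases "Im w \<ge> 0")
    case False
    then show ?thesis using up[of "- w"] w by (simp add: gauss_prim_minus)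
  qed (use up w in auto)
  moreover have "B > 0" using b c by (simp add: B_def add_pos_pos)
  ultimately show ?thesis using that by blast
qed

text \<open>In the part Re w^2 <= U of the upper half plane, the arc estimate of order 1 / |w|
  forces the limit at infinity to be the one along the imaginary axis.\<close>

lemma gauss_prim_tendsto:
  assumes c: "((\<lambda>y. gauss_prim (\<i> * of_real y)) \<longlongrightarrow> l) at_top"
    and "eventually (\<lambda>x. Im (w x) \<ge> 0 \<and> Re ((w x)\<^sup>2) \<le> U) F" "filterlim (\<lambda>x. norm (w x)) at_top F" "U \<ge> 0"
  shows "((\<lambda>x. gauss_prim (w x)) \<longlongrightarrow> l) F"
proof -
  have 1: "((\<lambda>x. gauss_prim (\<i> * of_real (norm (w x)))) \<longlongrightarrow> l) F"
    using filterlim_compose[OF c assms(3)] .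
  have "eventually (\<lambda>x. norm (w x) > 0) F" using assms(3) unfolding filterlim_at_top_dense by blast
  then have "eventually (\<lambda>x. norm (gauss_prim (w x) - gauss_prim (\<i> * of_real (norm (w x)))) \<le> 4 * exp U / norm (w x)) F"
    using assms(2) by eventually_elim (intro gauss_prim_upper assms, auto)
  moreover have "((\<lambda>x. 4 * exp U / norm (w x)) \<longlongrightarrow> 0) F"
    by (rule tendsto_divide_0[OF tendsto_const filterlim_at_top_imp_at_infinity[OF assms(3)]])
  ultimately have "((\<lambda>x. gauss_prim (w x) - gauss_prim (\<i> * of_real (norm (w x)))) \<longlongrightarrow> 0) F"
    by (rule Lim_null_comparison)
  from tendsto_add[OF this 1] show ?thesis by simp
qed

section \<open>The subordination integral: antiderivative and endpoint values\<close>

text \<open>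
  Completing the square, \<open>q\<^sup>2 z - t\<^sup>2 / (4 z) = (q \<surd>z \<plusminus> \<i> t / (2 \<surd>z))\<^sup>2 \<mp> \<i> t q\<close>, gives an explicit
  antiderivative of \<open>z\<^bsup>-1/2\<^esup> exp (q\<^sup>2 z - t\<^sup>2 / (4 z))\<close> in terms of \<open>gauss_prim\<close>.
\<close>

definition wave_arg :: "real \<Rightarrow> real \<Rightarrow> complex \<Rightarrow> complex" where
  "wave_arg q t z = of_real q * csqrt z + \<i> * of_real t / (2 * csqrt z)"

definition wave_prim :: "real \<Rightarrow> real \<Rightarrow> complex \<Rightarrow> complex" where
  "wave_prim q t z = (exp (- (\<i> * of_real (t * q))) * gauss_prim (wave_arg q t z) +
     exp (\<i> * of_real (t * q)) * gauss_prim (wave_arg q (- t) z)) / of_real q"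

definition wave_dens :: "real \<Rightarrow> real \<Rightarrow> complex \<Rightarrow> complex" where
  "wave_dens q t z = exp (of_real (q\<^sup>2) * z - of_real (t\<^sup>2) / (4 * z)) / csqrt z"

lemma wave_arg_square:
  assumes "z \<noteq> 0"
  shows "(wave_arg q t z)\<^sup>2 = of_real (q\<^sup>2) * z - of_real (t\<^sup>2) / (4 * z) + \<i> * of_real (t * q)"
proof -
  define s where "s = csqrt z"
  have s: "s \<noteq> 0" "z = s\<^sup>2" using assms by (auto simp: s_def)
  have "(a * s + \<i> * b / (2 * s))\<^sup>2 = a\<^sup>2 * s\<^sup>2 - b\<^sup>2 / (4 * s\<^sup>2) + \<i> * (b * a)" for a b
    using s(1) by (simp add: power2_sum power_divide power_mult_distrib)
  from this[of "of_real q" "of_real t"] show ?thesis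
    unfolding wave_arg_def s_def[symmetric] by (simp add: s(2))
qed

text \<open>The exponential prefactors turn both derivatives of \<open>gauss_prim\<close> into the
  same exponential X. The inner derivatives q / (2 s) and - i t / (4 s^3), with s = sqrt z, then add
  up over the two signs of t: the second parts cancel and the first give q / s.\<close>

lemma wave_prim_deriv:
  assumes "q > 0" "z \<notin> \<real>\<^sub>\<le>\<^sub>0"
  shows "(wave_prim q t has_field_derivative wave_dens q t z) (at z)"
proof -
  define s where "s = csqrt z"
  have z: "z \<noteq> 0" using assms(2) by auto
  have s: "s \<noteq> 0" using z by (simp add: s_def)
  have darg: "(wave_arg q u has_field_derivative (of_real q / (2 * s) - \<i> * of_real u / (4 * s ^ 3))) (at z)" for u
  proof -
    have ds: "(csqrt has_field_derivative inverse (2 * s)) (at z)"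
      unfolding s_def by (rule has_field_derivative_csqrt[OF assms(2)])
    have di: "((\<lambda>z. \<i> * of_real u / (2 * csqrt z)) has_field_derivative 
      (0 * (2 * csqrt z) - \<i> * of_real u * (2 * inverse (2 * s))) / ((2 * csqrt z) * (2 * csqrt z))) (at z)"
      using s by (intro DERIV_divide DERIV_cmult ds) (auto simp: s_def)
    have "(wave_arg q u has_field_derivative of_real q * inverse (2 * s) + 
      (0 * (2 * csqrt z) - \<i> * of_real u * (2 * inverse (2 * s))) / ((2 * csqrt z) * (2 * csqrt z))) (at z)"
      unfolding wave_arg_def by (intro DERIV_add DERIV_cmult ds di)
    moreover have "of_real q * inverse (2 * s) + 
      (0 * (2 * csqrt z) - \<i> * of_real u * (2 * inverse (2 * s))) / ((2 * csqrt z) * (2 * csqrt z)) = 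
      of_real q / (2 * s) - \<i> * of_real u / (4 * s ^ 3)"
      unfolding s_def[symmetric] using s by (simp add: field_simps power3_eq_cube)
    ultimately show ?thesis by simp
  qed
  define X where "X = exp (of_real (q\<^sup>2) * z - of_real (t\<^sup>2) / (4 * z))"
  have dg: "((\<lambda>z. gauss_prim (wave_arg q u z)) has_field_derivative 
     exp ((wave_arg q u z)\<^sup>2) * (of_real q / (2 * s) - \<i> * of_real u / (4 * s ^ 3))) (at z)" for u
    by (rule DERIV_chain2[OF gauss_prim(1) darg])
  have "(wave_prim q t has_field_derivative
     (exp (- (\<i> * of_real (t * q))) * (exp ((wave_arg q t z)\<^sup>2) * (of_real q / (2 * s) - \<i> * of_real t / (4 * s ^ 3))) +
      exp (\<i> * of_real (t * q)) * (exp ((wave_arg q (- t) z)\<^sup>2) * (of_real q / (2 * s) - \<i> * of_real (- t) / (4 * s ^ 3)))) / of_real q) (at z)"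
    unfolding wave_prim_def by (intro DERIV_cdivide DERIV_add DERIV_cmult dg)
  moreover have "exp (- (\<i> * of_real (t * q))) * exp ((wave_arg q t z)\<^sup>2) = X"
    unfolding wave_arg_square[OF z] X_def exp_add[symmetric] by simp
  moreover have "exp (\<i> * of_real (t * q)) * exp ((wave_arg q (- t) z)\<^sup>2) = X"
    unfolding wave_arg_square[OF z] X_def exp_add[symmetric] by simp
  ultimately have "(wave_prim q t has_field_derivative (X * (of_real q / (2 * s) - \<i> * of_real t / (4 * s ^ 3)) + 
      X * (of_real q / (2 * s) - \<i> * of_real (- t) / (4 * s ^ 3))) / of_real q) (at z)"
    by (simp only: mult.assoc[symmetric])
  moreover have "(X * (of_real q / (2 * s) - \<i> * of_real t / (4 * s ^ 3)) + 
      X * (of_real q / (2 * s) - \<i> * of_real (- t) / (4 * s ^ 3))) / of_real q = X / s"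
  proof -
    have "(X * (a - b) + X * (a + b)) = X * (2 * a)" for a b :: complex by (simp add: algebra_simps)
    from this[of "of_real q / (2 * s)" "\<i> * of_real t / (4 * s ^ 3)"] show ?thesis
      using assms(1) by simp
  qed
  ultimately show ?thesis unfolding wave_dens_def X_def s_def by simp
qed

lemma Re_inverse_nonneg: "Re z > 0 \<Longrightarrow> Re (of_real (t\<^sup>2) / (4 * z)) \<ge> 0"
  by (simp add: Re_divide zero_le_mult_iff)

text \<open>Since t^2 / (4 z) has nonnegative real part for Re z > 0, all arguments on the path stay
  in the region where \<open>gauss_prim\<close> is controlled.\<close>

lemma wave_arg_square_Re:
  assumes "Re z > 0" "Re z \<le> 1"
  shows "Re ((wave_arg q t z)\<^sup>2) \<le> q\<^sup>2"
proof -
  have "z \<noteq> 0" using assms(1) by auto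
  from wave_arg_square[OF this, of q t]
  have "Re ((wave_arg q t z)\<^sup>2) = q\<^sup>2 * Re z - Re (of_real (t\<^sup>2) / (4 * z))" by simp
  also have "\<dots> \<le> q\<^sup>2 * 1 - 0" using assms by (intro diff_mono mult_left_mono Re_inverse_nonneg) auto
  finally show ?thesis by simp
qed

text \<open>The number 20 = 5 * 4 bounds \<omega>^2 in dimension five. The growth 1 / q is
  integrable over the cube, which prepares dominated convergence as R grows.\<close>

lemma wave_prim_bound:
  obtains B where "B > 0"
    "\<And>q t R. q > 0 \<Longrightarrow> q\<^sup>2 \<le> 20 \<Longrightarrow> norm (wave_prim q t (Complex 1 R)) \<le> B / q"
proof -
  obtain B where B: "B > 0" "\<And>w. Re (w\<^sup>2) \<le> 20 \<Longrightarrow> norm (gauss_prim w) \<le> B"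
    using gauss_prim_bounded[of 20] by auto
  have "norm (wave_prim q t (Complex 1 R)) \<le> 2 * B / q" if q: "q > 0" "q\<^sup>2 \<le> 20" for q t R
  proof -
    have g: "norm (gauss_prim (wave_arg q u (Complex 1 R))) \<le> B" for u
      using wave_arg_square_Re[of "Complex 1 R" q u] q(2) by (intro B(2)) auto
    have "norm (wave_prim q t (Complex 1 R)) \<le> (norm (gauss_prim (wave_arg q t (Complex 1 R))) + norm (gauss_prim (wave_arg q (-t) (Complex 1 R)))) / q"
      unfolding wave_prim_def norm_divide using q(1)
      by (intro frac_le norm_triangle_le) (auto simp: norm_mult)
    also have "\<dots> \<le> (B + B) / q" using q(1) by (intro divide_right_mono add_mono g) auto
    finally show ?thesis by simp
  qed
  then show ?thesis using that[of "2 * B"] B by auto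
qed

text \<open>Both arguments run to infinity in the upper half plane, so both values of
  \<open>gauss_prim\<close> tend to i c and the sum to 2 i c cos (t q) / q. This limit is imaginary,
  which is the reason for working with real parts.\<close>

lemma wave_prim_at_top:
  assumes "q > 0" "q\<^sup>2 \<le> 20"
    and c: "((\<lambda>y. gauss_prim (\<i> * of_real y)) \<longlongrightarrow> \<i> * of_real c) at_top"
  shows "((\<lambda>R. Re (wave_prim q t (Complex 1 R))) \<longlongrightarrow> 0) at_top"
proof -
  have g: "((\<lambda>R. gauss_prim (wave_arg q u (Complex 1 R))) \<longlongrightarrow> \<i> * of_real c) at_top" for u
  proof (rule gauss_prim_tendsto[OF c])
    \<comment> \<open>For z = 1 + i R, the imaginary part of q sqrt z grows like sqrt R, whereas the
      term with u / sqrt z tends to 0.\<close>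
    have lim: "filterlim (\<lambda>R. q * sqrt ((R - 1) / 2) - \<bar>u\<bar> / (2 * sqrt R)) at_top at_top"
      using assms(1) by real_asymp
    then have ev: "eventually (\<lambda>R. q * sqrt ((R - 1) / 2) - \<bar>u\<bar> / (2 * sqrt R) > 0) at_top"
      unfolding filterlim_at_top_dense by blast
    have bnd: "q * sqrt ((R - 1) / 2) - \<bar>u\<bar> / (2 * sqrt R) \<le> Im (wave_arg q u (Complex 1 R))" if R: "R \<ge> 1" for R
    proof -
      let ?z = "Complex 1 R"
      have nz: "R \<le> norm ?z" using abs_Im_le_cmod[of ?z] R by simp
      have "Im (csqrt ?z) = sqrt ((norm ?z - 1) / 2)" using R by simp
      also have "\<dots> \<ge> sqrt ((R - 1) / 2)" using nz by simp
      finally have 1: "q * sqrt ((R - 1) / 2) \<le> q * Im (csqrt ?z)" using assms(1) by simp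
      have "norm (\<i> * of_real u / (2 * csqrt ?z)) = \<bar>u\<bar> / (2 * sqrt (norm ?z))"
        by (simp add: norm_divide norm_mult norm_csqrt)
      also have "\<dots> \<le> \<bar>u\<bar> / (2 * sqrt R)" using nz R by (intro divide_left_mono mult_pos_pos) (auto intro: less_le_trans[of 0 R])
      finally have 2: "\<bar>Im (\<i> * of_real u / (2 * csqrt ?z))\<bar> \<le> \<bar>u\<bar> / (2 * sqrt R)"
        using abs_Im_le_cmod[of "\<i> * of_real u / (2 * csqrt ?z)"] by linarith
      have "Im (wave_arg q u ?z) = q * Im (csqrt ?z) + Im (\<i> * of_real u / (2 * csqrt ?z))"
        by (simp add: wave_arg_def)
      then show ?thesis using 1 2 by linarith
    qed
    show "eventually (\<lambda>R. Im (wave_arg q u (Complex 1 R)) \<ge> 0 \<and> Re ((wave_arg q u (Complex 1 R))\<^sup>2) \<le> 20) at_top"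
      using ev eventually_ge_at_top[of 1]
    proof eventually_elim
      case (elim R)
      then show ?case using bnd[of R] wave_arg_square_Re[of "Complex 1 R" q u] assms(2) by auto
    qed
    show "filterlim (\<lambda>R. norm (wave_arg q u (Complex 1 R))) at_top at_top"
    proof (rule filterlim_at_top_mono[OF lim])
      show "eventually (\<lambda>R. q * sqrt ((R - 1) / 2) - \<bar>u\<bar> / (2 * sqrt R) \<le> norm (wave_arg q u (Complex 1 R))) at_top"
        using eventually_ge_at_top[of 1]
      proof eventually_elim
        case (elim R)
        then show ?case using bnd[of R] abs_Im_le_cmod[of "wave_arg q u (Complex 1 R)"] by linarith
      qed
    qed
  qed auto
  have "((\<lambda>R. Re (wave_prim q t (Complex 1 R))) \<longlongrightarrow> 
    Re ((exp (- (\<i> * of_real (t * q))) * (\<i> * of_real c) + exp (\<i> * of_real (t * q)) * (\<i> * of_real c)) / of_real q)) at_top"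
    unfolding wave_prim_def using assms(1) by (intro tendsto_intros g) auto
  moreover have "Re ((exp (- (\<i> * of_real (t * q))) * (\<i> * of_real c) + exp (\<i> * of_real (t * q)) * (\<i> * of_real c)) / of_real q) = 0"
    by (simp add: Re_divide_of_real Re_exp Im_exp)
  ultimately show ?thesis by (simp only:)
qed

text \<open>Near z = 0 the arguments are q sqrt \<delta> plus or minus i t / (2 sqrt \<delta>),
  which run to opposite ends of the imaginary axis. The limits i c and - i c combine with the
  exponentials exp (- i t q) and exp (i t q) into the sine.\<close>

lemma wave_prim_at_zero:
  assumes "q > 0" "t > 0"
    and c: "((\<lambda>y. gauss_prim (\<i> * of_real y)) \<longlongrightarrow> \<i> * of_real c) at_top"
  shows "((\<lambda>\<delta>. wave_prim q t (of_real \<delta>)) \<longlongrightarrow> of_real (2 * c * sin (t * q) / q)) (at_right 0)"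
proof -
  have ev: "eventually (\<lambda>\<delta>::real. 0 < \<delta> \<and> \<delta> \<le> 1) (at_right 0)"
    using eventually_at_right_less[of 0] eventually_at_right_real[of 0 1] by (auto elim: eventually_elim2)
  have Im: "Im (wave_arg q u (of_real \<delta>)) = u / (2 * sqrt \<delta>)" if "\<delta> > 0" for u \<delta>
  proof -
    have "csqrt (of_real \<delta>) = of_real (sqrt \<delta>)" using that by simp
    then have "wave_arg q u (of_real \<delta>) = of_real (q * sqrt \<delta>) + \<i> * of_real (u / (2 * sqrt \<delta>))"
      by (simp add: wave_arg_def)
    then show ?thesis by (simp only: Im_complex_of_real plus_complex.sel Im_i_times Re_complex_of_real)
  qed
  have lim: "filterlim (\<lambda>\<delta>. t / (2 * sqrt \<delta>)) at_top (at_right 0)" using assms(2) by real_asymp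
  have nrm: "filterlim (\<lambda>\<delta>. norm (wave_arg q u (of_real \<delta>))) at_top (at_right 0)" if "\<bar>u\<bar> = t" for u
  proof (rule filterlim_at_top_mono[OF lim])
    show "eventually (\<lambda>\<delta>. t / (2 * sqrt \<delta>) \<le> norm (wave_arg q u (of_real \<delta>))) (at_right 0)"
      using ev
    proof eventually_elim
      case (elim \<delta>)
      then have "\<bar>Im (wave_arg q u (of_real \<delta>))\<bar> = t / (2 * sqrt \<delta>)" using that by (simp add: Im)
      then show ?case using abs_Im_le_cmod[of "wave_arg q u (of_real \<delta>)"] by linarith
    qed
  qed
  have Re: "Re ((wave_arg q u (of_real \<delta>))\<^sup>2) \<le> q\<^sup>2" if "0 < \<delta> \<and> \<delta> \<le> 1" for u \<delta>
    using that by (intro wave_arg_square_Re) auto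
  have g1: "((\<lambda>\<delta>. gauss_prim (wave_arg q t (of_real \<delta>))) \<longlongrightarrow> \<i> * of_real c) (at_right 0)"
    by (rule gauss_prim_tendsto[OF c _ nrm, where U = "q\<^sup>2"], use ev in eventually_elim)
       (use Re assms(2) in \<open>auto simp: Im\<close>)
  \<comment> \<open>This argument goes downwards; oddness reflects it into the upper half plane at
    the price of a sign.\<close>
  have "((\<lambda>\<delta>. gauss_prim (- wave_arg q (- t) (of_real \<delta>))) \<longlongrightarrow> \<i> * of_real c) (at_right 0)"
    by (rule gauss_prim_tendsto[OF c, where U = "q\<^sup>2"], use ev in eventually_elim)
       (use Re assms(2) nrm[of "- t"] in \<open>auto simp: Im\<close>)
  then have g2: "((\<lambda>\<delta>. gauss_prim (wave_arg q (- t) (of_real \<delta>))) \<longlongrightarrow> - (\<i> * of_real c)) (at_right 0)"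
    using tendsto_minus gauss_prim_minus by fastforce
  have "((\<lambda>\<delta>. wave_prim q t (of_real \<delta>)) \<longlongrightarrow> 
     (exp (- (\<i> * of_real (t * q))) * (\<i> * of_real c) + exp (\<i> * of_real (t * q)) * (- (\<i> * of_real c))) / of_real q) (at_right 0)"
    unfolding wave_prim_def using assms(1) by (intro tendsto_intros g1 g2) auto
  moreover have "(exp (- (\<i> * of_real (t * q))) * (\<i> * of_real c) + exp (\<i> * of_real (t * q)) * (- (\<i> * of_real c))) / of_real q
     = of_real (2 * c * sin (t * q) / q)"
    by (simp add: complex_eq_iff Re_divide_of_real Im_divide_of_real Re_exp Im_exp)
  ultimately show ?thesis by (simp only:)
qed

lemma exp_minus_le_powr:
  fixes y :: real
  assumes "y > 0"
  shows "exp (- y) \<le> y powr (-11/12)"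
proof -
  have "y powr (11/12) \<le> exp y"
  proof (cases "y \<le> 1")
    case True
    then have "y powr (11/12) \<le> 1" using assms by (intro powr_le1) auto
    also have "1 \<le> exp y" using assms by simp
    finally show ?thesis .
  next
    case False
    then have "y powr (11/12) \<le> y powr 1" by (intro powr_mono) auto
    also have "y powr 1 \<le> exp y"
    proof -
      have "y \<le> exp y" using exp_ge_add_one_self[of y] by linarith
      then show ?thesis using assms by simp
    qed
    finally show ?thesis .
  qed
  then have "1 / exp y \<le> 1 / y powr (11/12)" using assms by (intro divide_left_mono) auto
  then show ?thesis using powr_minus_divide[of y "11/12"] by (simp add: exp_minus inverse_eq_divide)
qed

text \<open>Trades the Gaussian factor for t^(-11/6). It is applied with s = x on the segment from 0
  to 1, and with s = 1 + r^2 on the half line.\<close>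

lemma exp_minus_square_le_powr:
  fixes s t :: real
  assumes "t > 0" "s > 0"
  shows "exp (- (t\<^sup>2 / (4 * s))) \<le> 4 * s powr (11/12) * t powr (-11/6)"
proof -
  have "exp (- (t\<^sup>2 / (4 * s))) \<le> (t\<^sup>2 / (4 * s)) powr (-11/12)" using assms by (intro exp_minus_le_powr) auto
  also have "\<dots> = (t\<^sup>2) powr (-11/12) / (4 * s) powr (-11/12)" by (rule powr_divide)
  also have "(t\<^sup>2) powr (-11/12) = t powr (-11/6)" using assms by (simp add: powr_powr flip: powr_numeral)
  also have "t powr (-11/6) / (4 * s) powr (-11/12) = t powr (-11/6) * (4 * s) powr (11/12)"
    using powr_minus_divide[of "4 * s" "11/12"] by simp
  also have "(4 * s) powr (11/12) = 4 powr (11/12) * s powr (11/12)" by (rule powr_mult)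
  also have "t powr (-11/6) * (4 powr (11/12) * s powr (11/12)) \<le> t powr (-11/6) * (4 * s powr (11/12))"
  proof (intro mult_left_mono mult_right_mono)
    have "(4::real) powr (11/12) \<le> 4 powr 1" by (intro powr_mono) auto
    then show "(4::real) powr (11/12) \<le> 4" by simp
  qed auto
  finally show ?thesis by (simp add: mult_ac)
qed

text \<open>The difference is the integral of the density over the segment from 0 to 1. After
  t^(-11/6) is extracted, x^(11/12) / sqrt x = x^(5/12) is still bounded, and exp (q^2 x) <=
  e^20.\<close>

lemma wave_prim_one:
  assumes "q > 0" "q\<^sup>2 \<le> 20" "t > 0"
    and c: "((\<lambda>y. gauss_prim (\<i> * of_real y)) \<longlongrightarrow> \<i> * of_real c) at_top"
  shows "norm (wave_prim q t 1 - of_real (2 * c * sin (t * q) / q)) \<le> 4 * exp 20 * t powr (-11/6)"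
proof -
  let ?K = "4 * exp 20 * t powr (-11/6)"
  have H: "norm (wave_dens q t z) \<le> ?K" if z: "z = of_real x" "0 < x" "x \<le> 1" for z x
  proof -
    have "wave_dens q t z = of_real (exp (q\<^sup>2 * x - t\<^sup>2 / (4 * x)) / sqrt x)"
    proof -
      have "of_real (q\<^sup>2) * of_real x - of_real (t\<^sup>2) / (4 * of_real x) = complex_of_real (q\<^sup>2 * x - t\<^sup>2 / (4 * x))"
        by simp
      then show ?thesis unfolding wave_dens_def z(1) using z(2) by (simp only: exp_of_real) simp
    qed
    then have "norm (wave_dens q t z) = exp (q\<^sup>2 * x) * exp (- (t\<^sup>2 / (4 * x))) / sqrt x"
    proof -
      have "exp (q\<^sup>2 * x - t\<^sup>2 / (4 * x)) = exp (q\<^sup>2 * x) * exp (- (t\<^sup>2 / (4 * x)))"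
        by (simp only: exp_add[symmetric] diff_conv_add_uminus)
      moreover have "norm (complex_of_real (A * B / sqrt x)) = A * B / sqrt x" if "A > 0" "B > 0" for A B
        using that z(2) by (simp only: norm_of_real) simp
      ultimately show ?thesis using \<open>wave_dens q t z = _\<close> by (simp only: exp_gt_zero)
    qed
    also have "\<dots> \<le> exp 20 * (4 * x powr (11/12) * t powr (-11/6)) / sqrt x"
    proof (intro divide_right_mono mult_mono)
      have "q\<^sup>2 * x \<le> 20 * 1" using assms(2) z by (intro mult_mono) auto
      then show "exp (q\<^sup>2 * x) \<le> exp 20" by simp
      show "exp (- (t\<^sup>2 / (4 * x))) \<le> 4 * x powr (11/12) * t powr (-11/6)"
        by (rule exp_minus_square_le_powr[OF assms(3) z(2)])
    qed (use z in auto)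
    also have "\<dots> = ?K * (x powr (11/12) / x powr (1/2))" using z(2) by (simp add: powr_half_sqrt mult_ac)
    also have "x powr (11/12) / x powr (1/2) = x powr (5/12)" by (simp add: powr_diff[symmetric])
    also have "?K * x powr (5/12) \<le> ?K * 1" using z by (intro mult_left_mono powr_le1) auto
    finally show ?thesis by simp
  qed
  have diff: "norm (wave_prim q t 1 - wave_prim q t (of_real \<delta>)) \<le> ?K" if d: "0 < \<delta>" "\<delta> \<le> 1" for \<delta>
  proof -
    define S where "S = closed_segment (complex_of_real \<delta>) (of_real 1)"
    have S: "\<exists>x. z = of_real x \<and> 0 < x \<and> x \<le> 1 \<and> \<delta> \<le> x" if "z \<in> S" for z
      using that d unfolding S_def closed_segment_of_real by (auto simp: closed_segment_eq_real_ivl)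
    have "norm (wave_prim q t 1 - wave_prim q t (of_real \<delta>)) \<le> ?K * norm (1 - of_real \<delta> :: complex)"
    proof (rule field_differentiable_bound[of S "wave_prim q t" "wave_dens q t"])
      fix z assume "z \<in> S"
      then obtain x where x: "z = of_real x" "0 < x" "x \<le> 1" using S by blast
      then have "z \<notin> \<real>\<^sub>\<le>\<^sub>0" by (simp add: complex_nonpos_Reals_iff)
      then show "(wave_prim q t has_field_derivative wave_dens q t z) (at z within S)"
        by (rule has_field_derivative_at_within[OF wave_prim_deriv[OF assms(1)]])
      show "norm (wave_dens q t z) \<le> ?K" using H[OF x] .
    qed (auto simp: S_def)
    also have "?K * norm (1 - of_real \<delta> :: complex) \<le> ?K * 1"
    proof (intro mult_left_mono)
      have "norm (1 - of_real \<delta> :: complex) = \<bar>1 - \<delta>\<bar>" by (metis norm_of_real of_real_1 of_real_diff)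
      then show "norm (1 - of_real \<delta> :: complex) \<le> 1" using d by simp
    qed auto
    finally show ?thesis by simp
  qed
  show ?thesis
  proof (rule tendsto_upperbound)
    show "((\<lambda>\<delta>. norm (wave_prim q t 1 - wave_prim q t (of_real \<delta>))) \<longlongrightarrow> 
      norm (wave_prim q t 1 - of_real (2 * c * sin (t * q) / q))) (at_right 0)"
      by (intro tendsto_intros wave_prim_at_zero assms)
    show "eventually (\<lambda>\<delta>. norm (wave_prim q t 1 - wave_prim q t (of_real \<delta>)) \<le> ?K) (at_right 0)"
      by (rule eventually_mono[OF eventually_at_right_real[of 0 1]], simp, rule diff) auto
  qed simp
qed

lemma wave_prim_integral:
  assumes "q > 0" "R \<ge> 0"
  shows "((\<lambda>r. \<i> * wave_dens q t (Complex 1 r)) has_integral (wave_prim q t (Complex 1 R) - wave_prim q t 1)) {0..R}"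
proof -
  have "((\<lambda>r. wave_prim q t (1 + \<i> * of_real r)) has_vector_derivative \<i> * wave_dens q t (1 + \<i> * of_real r)) (at r within {0..R})" for r
  proof (rule has_vector_derivative_real_field)
    have "1 + \<i> * of_real r \<notin> \<real>\<^sub>\<le>\<^sub>0" by (simp add: complex_nonpos_Reals_iff)
    then have "((\<lambda>z. wave_prim q t (1 + \<i> * z)) has_field_derivative wave_dens q t (1 + \<i> * of_real r) * \<i>) (at (of_real r))"
      using assms(1) by (intro DERIV_chain2[where g = "\<lambda>z. 1 + \<i> * z"] wave_prim_deriv) (auto intro!: derivative_eq_intros)
    then show "((\<lambda>z. wave_prim q t (1 + \<i> * z)) has_field_derivative \<i> * wave_dens q t (1 + \<i> * of_real r)) (at (of_real r))"
      by (simp add: mult.commute)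
  qed
  from fundamental_theorem_of_calculus[OF assms(2) this]
  have "((\<lambda>r. \<i> * wave_dens q t (1 + \<i> * of_real r)) has_integral wave_prim q t (1 + \<i> * of_real R) - wave_prim q t (1 + \<i> * of_real 0)) {0..R}" .
  then show ?thesis by (simp add: Complex_eq)
qed

section \<open>Integration over the cube\<close>

abbreviation cube :: "(real ^ 5) set" where
  "cube \<equiv> cbox (\<chi> j. - pi) (\<chi> j. pi)"

definition character :: "lattice5 \<Rightarrow> real ^ 5 \<Rightarrow> complex" where
  "character x \<xi> = exp (\<i> * of_real (\<Sum>j\<in>UNIV. of_int (x $ j) * \<xi> $ j))"

lemma mem_cube: "\<xi> \<in> cube \<longleftrightarrow> (\<forall>j. \<xi> $ j \<in> {-pi..pi})"
  by (simp add: mem_box_cart)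

text \<open>Lebesgue measure is the image of a product measure indexed by basis vectors; reindexing
  along \<open>axis j 1\<close> turns the product over the basis into one over coordinates.\<close>

lemma lborel_vec_prod:
  fixes g :: "'n::finite \<Rightarrow> real \<Rightarrow> 'b::{real_normed_field,banach,second_countable_topology}"
  assumes "\<And>j. integrable lborel (g j)"
  shows "integrable lborel (\<lambda>\<xi>::real^'n. \<Prod>j\<in>UNIV. g j (\<xi> $ j))"
    and "(\<integral>\<xi>. (\<Prod>j\<in>UNIV. g j (\<xi> $ j)) \<partial>(lborel :: (real^'n) measure)) = (\<Prod>j\<in>UNIV. \<integral>\<theta>. g j \<theta> \<partial>lborel)"
proof -
  let ?ax = "\<lambda>j::'n. axis j (1::real)"
  let ?B = "Basis :: (real^'n) set"
  have B: "?B = range ?ax" unfolding Basis_vec_def by auto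
  have inj: "inj ?ax" by (auto simp: inj_on_def axis_eq_axis)
  define f where "f = (\<lambda>b. g (inv ?ax b))"
  interpret product_sigma_finite "\<lambda>b::real^'n. (lborel :: real measure)" ..
  have f: "integrable lborel (f b)" for b using assms by (simp add: f_def)
  have fax: "f (?ax j) = g j" for j using inv_f_f[OF inj, of j] by (simp add: f_def)
  have m: "f b \<in> borel_measurable borel" for b using borel_measurable_integrable[OF f[of b]] by simp
  have meas: "(\<lambda>\<xi>::real^'n. \<Prod>j\<in>UNIV. g j (\<xi> $ j)) \<in> borel_measurable borel"
  proof -
    have "(\<lambda>\<xi>::real^'n. g j (\<xi> $ j)) \<in> borel_measurable borel" for j
    proof -
      have "(\<lambda>\<xi>::real^'n. \<xi> $ j) \<in> borel_measurable borel"
        by (intro borel_measurable_continuous_onI continuous_intros)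
      from measurable_compose[OF this] show ?thesis using m[of "?ax j"] unfolding fax .
    qed
    then show ?thesis by measurable
  qed
  let ?T = "\<lambda>h::real^'n \<Rightarrow> real. \<Sum>b\<in>?B. h b *\<^sub>R b"
  have comp: "(?T h) $ j = h (?ax j)" for h j
  proof -
    have "(?T h) $ j = (?T h) \<bullet> ?ax j" by (simp add: inner_axis)
    also have "\<dots> = h (?ax j)" by (subst inner_sum_left_Basis) (auto simp: B)
    finally show ?thesis .
  qed
  have T: "(\<Prod>j\<in>UNIV. g j ((?T h) $ j)) = (\<Prod>b\<in>?B. f b (h b))" for h
  proof -
    have "(\<Prod>b\<in>?B. f b (h b)) = (\<Prod>j\<in>UNIV. g j (h (?ax j)))"
      unfolding B by (simp add: prod.reindex[OF inj] fax)
    then show ?thesis by (simp only: comp)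
  qed
  have mT: "?T \<in> measurable (\<Pi>\<^sub>M b\<in>?B. lborel) borel" by measurable
  have I: "integrable (\<Pi>\<^sub>M b\<in>?B. lborel) (\<lambda>h. \<Prod>b\<in>?B. f b (h b))"
    by (intro product_integrable_prod f) auto
  show "integrable lborel (\<lambda>\<xi>::real^'n. \<Prod>j\<in>UNIV. g j (\<xi> $ j))"
    unfolding lborel_eq[where 'a = "real^'n"]
    by (subst integrable_distr_eq[OF mT meas]) (use I T in simp)
  have "(\<integral>\<xi>. (\<Prod>j\<in>UNIV. g j (\<xi> $ j)) \<partial>(lborel :: (real^'n) measure)) =
     (\<integral>h. (\<Prod>b\<in>?B. f b (h b)) \<partial>(\<Pi>\<^sub>M b\<in>?B. lborel))"
    unfolding lborel_eq[where 'a = "real^'n"] by (subst integral_distr[OF mT meas]) (simp only: T)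
  also have "\<dots> = (\<Prod>b\<in>?B. integral\<^sup>L lborel (f b))"
    by (intro product_integral_prod f) auto
  also have "\<dots> = (\<Prod>j\<in>UNIV. \<integral>\<theta>. g j \<theta> \<partial>lborel)"
    unfolding B using inj by (simp add: prod.reindex fax)
  finally show "(\<integral>\<xi>. (\<Prod>j\<in>UNIV. g j (\<xi> $ j)) \<partial>(lborel :: (real^'n) measure)) = (\<Prod>j\<in>UNIV. \<integral>\<theta>. g j \<theta> \<partial>lborel)" .
qed

lemma indicator_cube: "indicator cube \<xi> = (\<Prod>j\<in>UNIV. indicator {-pi..pi} (\<xi> $ j) :: real)"
proof (cases "\<xi> \<in> cube")
  case True
  then show ?thesis by (simp add: mem_cube)
next
  case False
  then obtain j where "\<xi> $ j \<notin> {-pi..pi}" unfolding mem_cube by blast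
  then have "indicator {-pi..pi} (\<xi> $ j) = (0::real)" by (rule indicator_simps(2))
  then have "(\<Prod>j\<in>UNIV. indicator {-pi..pi} (\<xi> $ j) :: real) = 0" by (intro prod_zero) auto
  then show ?thesis using False by simp
qed

lemma cube_prod:
  fixes g :: "5 \<Rightarrow> real \<Rightarrow> 'b::{real_normed_field,banach,second_countable_topology}"
  assumes "\<And>j. set_integrable lborel {-pi..pi} (g j)"
  shows "set_integrable lborel cube (\<lambda>\<xi>. \<Prod>j\<in>UNIV. g j (\<xi> $ j))"
    and "(LINT \<xi>:cube|lborel. (\<Prod>j\<in>UNIV. g j (\<xi> $ j))) = (\<Prod>j\<in>UNIV. LINT \<theta>:{-pi..pi}|lborel. g j \<theta>)"
proof -
  have eq: "indicator cube \<xi> *\<^sub>R (\<Prod>j\<in>UNIV. g j (\<xi> $ j)) = (\<Prod>j\<in>UNIV. indicator {-pi..pi} (\<xi> $ j) *\<^sub>R g j (\<xi> $ j))" for \<xi>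
    unfolding indicator_cube scaleR_conv_of_real of_real_prod prod.distrib ..
  note p = lborel_vec_prod[of "\<lambda>j \<theta>. indicator {-pi..pi} \<theta> *\<^sub>R g j \<theta>", OF assms[unfolded set_integrable_def]]
  show "set_integrable lborel cube (\<lambda>\<xi>. \<Prod>j\<in>UNIV. g j (\<xi> $ j))"
    unfolding set_integrable_def eq by (rule p(1))
  show "(LINT \<xi>:cube|lborel. (\<Prod>j\<in>UNIV. g j (\<xi> $ j))) = (\<Prod>j\<in>UNIV. LINT \<theta>:{-pi..pi}|lborel. g j \<theta>)"
    unfolding set_lebesgue_integral_def eq by (rule p(2))
qed

lemma character_prod: "character x \<xi> = (\<Prod>j\<in>UNIV. exp (\<i> * of_real (of_int (x $ j) * \<xi> $ j)))"
  by (simp add: character_def sum_distrib_left exp_sum)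

lemma continuous_on_character [continuous_intros]: "continuous_on S (character x)"
  unfolding character_def by (intro continuous_intros)

lemma norm_character [simp]: "norm (character x \<xi>) = 1"
  by (simp add: character_def)

lemma character_add: "character (x + y) \<xi> = character x \<xi> * character y \<xi>"
proof -
  have "(\<Sum>j\<in>UNIV. of_int ((x + y) $ j) * \<xi> $ j) =
      (\<Sum>j\<in>UNIV. of_int (x $ j) * \<xi> $ j) + (\<Sum>j\<in>UNIV. of_int (y $ j) * \<xi> $ j)"
    by (simp add: distrib_right sum.distrib)
  then show ?thesis unfolding character_def by (simp only: of_real_add distrib_left exp_add)
qed

lemma character_uminus: "character (- x) \<xi> = cnj (character x \<xi>)"
  by (simp add: character_def exp_cnj sum_negf)

lemma character_0 [simp]: "character 0 \<xi> = 1"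
  by (simp add: character_def)

lemma set_integrable_cube:
  fixes f :: "real ^ 5 \<Rightarrow> 'b::{banach, second_countable_topology}"
  assumes "f \<in> borel_measurable borel" "\<And>\<xi>. \<xi> \<in> cube \<Longrightarrow> norm (f \<xi>) \<le> B"
  shows "set_integrable lborel cube f"
  unfolding set_integrable_def
proof (rule Bochner_Integration.integrable_bound)
  show "integrable lborel (\<lambda>\<xi>::real^5. indicator cube \<xi> *\<^sub>R B)"
    by (intro integrable_scaleR_left integrable_real_indicator emeasure_lborel_cbox_finite) auto
  show "(\<lambda>x. indicator cube x *\<^sub>R f x) \<in> borel_measurable lborel" using assms(1) by simp
  show "AE x in lborel. norm (indicator cube x *\<^sub>R f x) \<le> norm (indicator cube x *\<^sub>R B)"
    using assms(2) by (auto simp: indicator_def intro!: AE_I2) (smt (verit))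
qed

lemma character_integral: "(LINT \<xi>:cube|lborel. character x \<xi>) = (if x = 0 then (2 * of_real pi) ^ 5 else 0)"
proof -
  have one: "(LINT \<theta>:{-pi..pi}|lborel. exp (\<i> * of_real (of_int n * \<theta>))) = (if n = 0 then 2 * of_real pi else 0)" for n :: int
  proof -
    have "(LINT \<theta>:{-pi..pi}|lborel. exp (\<i> * of_real (of_int n * \<theta>))) = integral {-pi..pi} (\<lambda>\<theta>. exp (\<i> * of_real (of_int n * \<theta>)))"
      by (intro set_borel_integral_eq_integral borel_integrable_atLeastAtMost' continuous_intros)
    also have "\<dots> = (if n = 0 then 2 * of_real pi else 0)"
    proof (cases "n = 0")
      case False
      have "((\<lambda>\<theta>. exp (\<i> * of_real (of_int n * \<theta>))) has_integral
         exp (\<i> * of_int n * of_real pi) / (\<i> * of_int n) - exp (\<i> * of_int n * of_real (- pi)) / (\<i> * of_int n)) {-pi..pi}"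
      proof (rule fundamental_theorem_of_calculus)
        fix \<theta> :: real
        have "((\<lambda>z. exp (\<i> * of_int n * z) / (\<i> * of_int n)) has_field_derivative exp (\<i> * of_int n * of_real \<theta>)) (at (of_real \<theta>))"
          using False by (auto intro!: derivative_eq_intros)
        from has_vector_derivative_real_field[OF this]
        show "((\<lambda>\<theta>. exp (\<i> * of_int n * of_real \<theta>) / (\<i> * of_int n)) has_vector_derivative exp (\<i> * of_real (of_int n * \<theta>))) (at \<theta> within {-pi..pi})"
          by (simp add: mult.assoc)
      qed simp
      moreover have "exp (\<i> * of_int n * of_real pi) = exp (\<i> * of_int n * of_real (- pi))"
        unfolding exp_eq by (rule exI[of _ n]) (simp add: algebra_simps)
      ultimately show ?thesis using False by (simp add: integral_unique)
    qed (simp add: scaleR_conv_of_real)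
    finally show ?thesis .
  qed
  have "(LINT \<xi>:cube|lborel. character x \<xi>) =
     (\<Prod>j\<in>UNIV. LINT \<theta>:{-pi..pi}|lborel. exp (\<i> * of_real (of_int (x $ j) * \<theta>)))"
    unfolding character_prod
    by (rule cube_prod(2)) (intro borel_integrable_atLeastAtMost' continuous_intros)
  also have "\<dots> = (\<Prod>j\<in>UNIV. if x $ j = 0 then 2 * of_real pi else 0)" unfolding one ..
  also have "\<dots> = (if x = 0 then (2 * of_real pi) ^ 5 else 0)"
  proof (cases "x = 0")
    case False
    then obtain j where "x $ j \<noteq> 0" by (auto simp: vec_eq_iff)
    then have "(\<Prod>j\<in>UNIV. if x $ j = 0 then 2 * of_real pi else 0 :: complex) = 0" by (intro prod_zero) auto
    then show ?thesis using False by simp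
  qed simp
  finally show ?thesis .
qed

lemma measure_cube: "(LINT \<xi>:cube|lborel. (1::real)) = (2 * pi) ^ 5"
proof -
  have "(LINT \<theta>:{-pi..pi}|lborel. (1::real)) = 2 * pi"
    by (simp add: set_lebesgue_integral_def)
  then show ?thesis
    using cube_prod(2)[of "\<lambda>j \<theta>. 1::real"] borel_integrable_atLeastAtMost'[of "-pi" pi "\<lambda>\<theta>. 1::real"] by simp
qed

section \<open>The symbol near the origin and integrability of its inverse powers\<close>

text \<open>Here 2 - 2 cos \<theta> = 4 sin^2 (\<theta> / 2), and sin x >= x / 2 on [0, pi / 2]: up
  to pi / 3 because the derivative cos x is at least 1/2, beyond it because sin x >= 4/5 >= x /
  2.\<close>

lemma one_minus_cos_ge:
  assumes "\<bar>\<theta>\<bar> \<le> pi"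
  shows "\<theta>\<^sup>2 / 4 \<le> 2 - 2 * cos \<theta>"
proof -
  have s: "x / 2 \<le> sin x" if "0 \<le> x" "x \<le> pi / 2" for x
  proof (cases "x \<le> pi / 3")
    case True
    have "sin 0 - 0 / 2 \<le> sin x - x / 2"
    proof (rule DERIV_nonneg_imp_nondecreasing[OF that(1)])
      fix y assume y: "0 \<le> y" "y \<le> x"
      have "((\<lambda>x. sin x - x / 2) has_real_derivative cos y - 1 / 2) (at y)"
        by (auto intro!: derivative_eq_intros)
      moreover have "cos (pi / 3) \<le> cos y" using y True by (intro cos_monotone_0_pi_le) auto
      then have "cos y - 1 / 2 \<ge> 0" by (simp add: cos_60)
      ultimately show "\<exists>d. ((\<lambda>x. sin x - x / 2) has_real_derivative d) (at y) \<and> 0 \<le> d" by blast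
    qed
    then show ?thesis by simp
  next
    case False
    have "sin (pi / 3) \<le> sin x" using that False by (intro sin_monotone_2pi_le) auto
    moreover have "sin (pi / 3) \<ge> 4/5" 
    proof -
      have "(8/5::real) \<le> sqrt 3" by (rule real_le_rsqrt) (simp add: power2_eq_square)
      then show ?thesis by (simp add: sin_60)
    qed
    moreover have "x / 2 \<le> 4/5" using that pi_approx by simp
    ultimately show ?thesis by linarith
  qed
  have "\<bar>\<theta>\<bar> / 4 \<le> sin (\<bar>\<theta>\<bar> / 2)" using s[of "\<bar>\<theta>\<bar> / 2"] assms by simp
  then have "(\<bar>\<theta>\<bar> / 4)\<^sup>2 \<le> (sin (\<bar>\<theta>\<bar> / 2))\<^sup>2" by (intro power_mono) auto
  moreover have "cos \<theta> = 1 - 2 * (sin (\<bar>\<theta>\<bar> / 2))\<^sup>2"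
    using cos_double_sin[of "\<bar>\<theta>\<bar> / 2"] by simp
  ultimately show ?thesis by (simp add: power_divide)
qed

lemma omega_square: "(omega \<xi>)\<^sup>2 = (\<Sum>j\<in>UNIV. 2 - 2 * cos (\<xi> $ j))"
  unfolding omega_def by (intro real_sqrt_pow2 sum_nonneg) simp

lemma omega_nonneg [simp]: "omega \<xi> \<ge> 0"
  unfolding omega_def by (intro real_sqrt_ge_zero sum_nonneg) simp

lemma omega_square_le: "(omega \<xi>)\<^sup>2 \<le> 20"
proof -
  have "2 - 2 * cos (\<xi> $ j) \<le> 4" for j using cos_ge_minus_one[of "\<xi> $ j"] by linarith
  then have "(\<Sum>j\<in>(UNIV :: 5 set). 2 - 2 * cos (\<xi> $ j)) \<le> (\<Sum>j\<in>(UNIV :: 5 set). 4)" by (intro sum_mono)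
  then show ?thesis by (simp add: omega_square)
qed

lemma continuous_on_omega [continuous_intros]: "continuous_on S omega"
  unfolding omega_def by (intro continuous_intros)

lemma measurable_omega [measurable]: "omega \<in> borel_measurable borel"
  by (intro borel_measurable_continuous_onI continuous_on_omega)

lemma measurable_character [measurable]: "character x \<in> borel_measurable borel"
  by (intro borel_measurable_continuous_onI continuous_on_character)

lemma coord_square_le_omega: "\<xi> \<in> cube \<Longrightarrow> (\<xi> $ j)\<^sup>2 / 4 \<le> (omega \<xi>)\<^sup>2"
proof -
  assume "\<xi> \<in> cube"
  then have "\<xi> $ j \<in> {-pi..pi}" unfolding mem_cube by blast
  then have "\<bar>\<xi> $ j\<bar> \<le> pi" by auto
  then have "(\<xi> $ j)\<^sup>2 / 4 \<le> 2 - 2 * cos (\<xi> $ j)" by (rule one_minus_cos_ge)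
  also have "\<dots> \<le> (\<Sum>j\<in>UNIV. 2 - 2 * cos (\<xi> $ j))" by (intro member_le_sum) auto
  finally show ?thesis by (simp add: omega_square)
qed

lemma AE_coords_nonzero: "AE \<xi>::real^5 in lborel. \<forall>j. \<xi> $ j \<noteq> 0"
proof -
  have "AE \<xi>::real^5 in lborel. \<xi> $ j \<noteq> 0" for j
  proof -
    have "negligible {\<xi>::real^5. \<xi> $ j = 0}" by (rule negligible_standard_hyperplane_cart)
    then have "{\<xi>::real^5. \<xi> $ j = 0} \<in> null_sets lebesgue" by (simp add: negligible_iff_null_sets)
    moreover have "{\<xi>::real^5. \<xi> $ j = 0} \<in> sets borel"
      by (intro borel_closed closed_Collect_eq continuous_intros)
    ultimately have "{\<xi>::real^5. \<xi> $ j = 0} \<in> null_sets lborel" by (simp add: null_sets_completion_iff)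
    from AE_not_in[OF this] show ?thesis by simp
  qed
  then show ?thesis by (simp add: AE_all_countable)
qed

lemma omega_pos: "\<xi> \<in> cube \<Longrightarrow> \<forall>j. \<xi> $ j \<noteq> 0 \<Longrightarrow> omega \<xi> > 0"
proof -
  assume "\<xi> \<in> cube" "\<forall>j. \<xi> $ j \<noteq> 0"
  then have "(omega \<xi>)\<^sup>2 > 0" using coord_square_le_omega[of \<xi> 0] by (smt (verit) divide_pos_pos zero_less_power2)
  then show ?thesis by (simp add: less_le)
qed

lemma exists_max_coord:
  fixes a :: "'n::finite \<Rightarrow> real"
  shows "\<exists>m. \<forall>j. a j \<le> a m"
proof -
  have "Max (range a) \<in> range a" by (intro Max_in) auto
  then obtain m where "Max (range a) = a m" by (rule imageE)
  moreover have "a j \<le> Max (range a)" for j by simp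
  ultimately show ?thesis by metis
qed

text \<open>Decouples the coordinates: both sides are compared with the fifth power of the largest
  entry, so a one-variable bound on fifth powers suffices for the product of the five
  kernels.\<close>

lemma prod_le_sum_power:
  fixes a :: "5 \<Rightarrow> real"
  assumes "\<And>j. a j \<ge> 0"
  shows "(\<Prod>j\<in>UNIV. a j) \<le> (\<Sum>j\<in>UNIV. a j ^ 5)"
proof -
  obtain m where m: "\<And>j. a j \<le> a m"
    using exists_max_coord[of a] by blast
  have "(\<Prod>j\<in>UNIV. a j) \<le> (\<Prod>j\<in>(UNIV :: 5 set). a m)" using assms m by (intro prod_mono) auto
  also have "\<dots> = a m ^ 5" by simp
  also have "\<dots> \<le> (\<Sum>j\<in>UNIV. a j ^ 5)" using assms by (intro member_le_sum) auto
  finally show ?thesis .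
qed

text \<open>
  Integrability of \<open>\<omega>\<^sup>-\<^sup>2\<close> near the origin: \<open>\<omega>\<^sup>-\<^sup>2\<close> is dominated by \<open>\<Prod>\<^sub>j \<bar>\<xi>\<^sub>j\<bar>\<^sup>-\<^sup>2\<^sup>/\<^sup>5\<close>,
  since the largest \<open>\<xi>\<^sub>j\<^sup>2\<close> is at least the geometric mean.
\<close>

lemma inverse_omega_square_integrable: "set_integrable lborel cube (\<lambda>\<xi>. 1 / (omega \<xi>)\<^sup>2)"
proof -
  \<comment> \<open>Five factors with exponent 2/5 make up one square, and each factor is integrable
    in its own variable.\<close>
  define g :: "real \<Rightarrow> real" where "g = (\<lambda>\<theta>. \<bar>\<theta>\<bar> powr (-2/5))"
  have g: "set_integrable lborel {-pi..pi} g"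
  proof -
    have h: "((\<lambda>x. x powr (-2/5)) has_integral (pi powr (-2/5+1) / (-2/5+1))) {0..pi}"
      by (rule has_integral_powr_from_0) auto
    have r: "(g has_integral (pi powr (-2/5+1) / (-2/5+1))) {0..pi}"
      by (rule has_integral_eq[OF _ h]) (auto simp: g_def)
    then have "((\<lambda>x. g (- x)) has_integral (pi powr (-2/5+1) / (-2/5+1))) {0..pi}" by (simp add: g_def)
    then have l: "(g has_integral (pi powr (-2/5+1) / (-2/5+1))) {-pi..-0}"
      using has_integral_reflect_real[of "\<lambda>x. g (- x)" _ pi 0] by simp
    from has_integral_combine[OF _ _ l[simplified] r] have "g integrable_on {-pi..pi}"
      by (auto simp: integrable_on_def)
    then have "g absolutely_integrable_on {-pi..pi}" by (rule nonnegative_absolutely_integrable_1) (simp add: g_def)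
    then show ?thesis unfolding set_integrable_def
      by (subst (asm) integrable_completion) (auto simp: g_def)
  qed
  from cube_prod(1)[of "\<lambda>_. g", OF g]
  have G: "integrable lborel (\<lambda>\<xi>. indicator cube \<xi> *\<^sub>R (4 * (\<Prod>j\<in>UNIV. g (\<xi> $ j))))"
    unfolding set_integrable_def by (simp add: mult.left_commute)
  show ?thesis unfolding set_integrable_def
  proof (rule Bochner_Integration.integrable_bound[OF G])
    show "(\<lambda>\<xi>. indicator cube \<xi> *\<^sub>R (1 / (omega \<xi>)\<^sup>2)) \<in> borel_measurable lborel" by measurable
    show "AE \<xi> in lborel. norm (indicator cube \<xi> *\<^sub>R (1 / (omega \<xi>)\<^sup>2)) \<le> norm (indicator cube \<xi> *\<^sub>R (4 * (\<Prod>j\<in>UNIV. g (\<xi> $ j))))"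
      using AE_coords_nonzero
    proof eventually_elim
      case (elim \<xi>)
      show ?case
      proof (cases "\<xi> \<in> cube")
        case True
        define a where "a = (\<lambda>j. \<bar>\<xi> $ j\<bar> powr (2/5))"
        have a: "a j > 0" for j using elim by (simp add: a_def)
        obtain m where m: "\<And>j. a j \<le> a m"
          using exists_max_coord[of a] by blast
        have "(\<Prod>j\<in>UNIV. a j) \<le> (\<Prod>j\<in>(UNIV :: 5 set). a m)" using less_imp_le[OF a] m by (intro prod_mono) auto
        also have "\<dots> = (\<xi> $ m)\<^sup>2" using elim by (simp add: a_def powr_power)
        also have "\<dots> \<le> 4 * (omega \<xi>)\<^sup>2" using coord_square_le_omega[OF True, of m] by simp
        finally have "(\<Prod>j\<in>UNIV. a j) \<le> 4 * (omega \<xi>)\<^sup>2" .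
        moreover have "(\<Prod>j\<in>UNIV. a j) > 0" using a by (intro prod_pos) auto
        ultimately have "1 / (omega \<xi>)\<^sup>2 \<le> 4 / (\<Prod>j\<in>UNIV. a j)"
          using omega_pos[OF True elim] by (simp add: field_simps)
        also have "\<dots> = 4 * (\<Prod>j\<in>UNIV. g (\<xi> $ j))"
        proof -
          have "g (\<xi> $ j) = inverse (a j)" for j
            unfolding g_def a_def using powr_minus[of "\<bar>\<xi> $ j\<bar>" "2/5"] by simp
          then show ?thesis using prod_inversef[of a UNIV] by (simp add: comp_def divide_inverse)
        qed
        finally show ?thesis using True by (simp add: g_def prod_nonneg)
      qed simp
    qed
  qed
qed

lemma inverse_omega_integrable: "set_integrable lborel cube (\<lambda>\<xi>. 1 / omega \<xi>)"
  unfolding set_integrable_def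
proof (rule Bochner_Integration.integrable_bound)
  have "set_integrable lborel cube (\<lambda>\<xi>. 1 :: real)" by (rule set_integrable_cube[of _ 1]) auto
  from set_integral_add(1)[OF this inverse_omega_square_integrable]
  show "integrable lborel (\<lambda>\<xi>. indicator cube \<xi> *\<^sub>R (1 + 1 / (omega \<xi>)\<^sup>2))" by (simp add: set_integrable_def)
  have "1 / w \<le> 1 + 1 / w\<^sup>2" if "w \<ge> 0" for w :: real
  proof (cases "w \<ge> 1")
    case True then have "1 / w \<le> 1" by simp
    then show ?thesis by (simp add: add_increasing2)
  next
    case False
    then have "w\<^sup>2 \<le> w" using that by (simp add: power2_eq_square mult_left_le)
    then have "1 / w \<le> 1 / w\<^sup>2" using that by (cases "w = 0") (auto intro!: divide_left_mono)
    then show ?thesis by simp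
  qed
  then show "AE \<xi> in lborel. norm (indicator cube \<xi> *\<^sub>R (1 / omega \<xi>)) \<le> norm (indicator cube \<xi> *\<^sub>R (1 + 1 / (omega \<xi>)\<^sup>2))"
    by (intro AE_I2) (auto simp: indicator_def)
qed measurable

section \<open>Pointwise decay of the propagator\<close>

lemma set_integrable_cube_continuous:
  fixes f :: "real ^ 5 \<Rightarrow> 'b::{banach, second_countable_topology}"
  assumes "continuous_on cube f"
  shows "set_integrable lborel cube f"
  unfolding set_integrable_def by (rule borel_integrable_compact[OF compact_cbox assms])

lemma Complex_1_eq: "Complex 1 r = 1 + \<i> * of_real r"
  by (simp add: complex_eq_iff)

lemma continuous_on_wave_dens:
  assumes "continuous_on S q" "continuous_on S r"
  shows "continuous_on S (\<lambda>p. wave_dens (q p) t (Complex 1 (r p)))"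
proof -
  have nz: "Complex 1 u \<noteq> 0" for u by (simp add: complex_eq_iff)
  have c: "continuous_on S (\<lambda>p. Complex 1 (r p))" unfolding Complex_1_eq by (intro continuous_intros assms)
  have "continuous_on S (\<lambda>p. csqrt (Complex 1 (r p)))"
    by (rule continuous_on_compose2[OF _ c, where t = "{z. Re z > 0}"])
       (auto intro!: continuous_at_imp_continuous_on continuous_at_csqrt simp: complex_nonpos_Reals_iff)
  then show ?thesis unfolding wave_dens_def using nz
    by (intro continuous_intros c assms) auto
qed

lemma character_heat_integral:
  "(LINT \<xi>:cube|lborel. character x \<xi> * exp (of_real ((omega \<xi>)\<^sup>2) * Complex 1 r)) = (\<Prod>j\<in>UNIV. heat_kernel r (x $ j))"
proof -
  have "character x \<xi> * exp (of_real ((omega \<xi>)\<^sup>2) * Complex 1 r) =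
    (\<Prod>j\<in>UNIV. exp (\<i> * of_real (of_int (x $ j) * \<xi> $ j)) * exp (Complex 1 r * of_real (2 - 2 * cos (\<xi> $ j))))" for \<xi>
    unfolding character_prod omega_square of_real_sum sum_distrib_right prod.distrib
    by (simp add: exp_sum mult.commute)
  then have "(LINT \<xi>:cube|lborel. character x \<xi> * exp (of_real ((omega \<xi>)\<^sup>2) * Complex 1 r)) =
    (LINT \<xi>:cube|lborel. (\<Prod>j\<in>UNIV. exp (\<i> * of_real (of_int (x $ j) * \<xi> $ j)) * exp (Complex 1 r * of_real (2 - 2 * cos (\<xi> $ j)))))"
    by (simp only:)
  also have "\<dots> = (\<Prod>j\<in>UNIV. LINT \<theta>:{-pi..pi}|lborel. exp (\<i> * of_real (of_int (x $ j) * \<theta>)) * exp (Complex 1 r * of_real (2 - 2 * cos \<theta>)))"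
    by (rule cube_prod(2)) (intro borel_integrable_atLeastAtMost' continuous_intros)
  also have "\<dots> = (\<Prod>j\<in>UNIV. heat_kernel r (x $ j))"
    unfolding heat_kernel_def
    by (intro prod.cong refl set_borel_integral_eq_integral borel_integrable_atLeastAtMost' continuous_intros)
  finally show ?thesis .
qed

text \<open>For z = 1 + i r one has Re (1 / z) = 1 / |z|^2 and |z|^2 = 1 + r^2. The exponent is
  11/12 - 1/4 = 2/3, the 1/4 coming from 1 / sqrt z.\<close>

lemma norm_gaussian_factor:
  assumes "t > 0"
  shows "norm (exp (- (of_real (t\<^sup>2) / (4 * Complex 1 r))) / csqrt (Complex 1 r)) \<le> 4 * t powr (-11/6) * (1 + r\<^sup>2) powr (2/3)"
proof -
  have p: "1 + r\<^sup>2 > 0" by (smt (verit) zero_le_power2)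
  have n: "norm (Complex 1 r) = (1 + r\<^sup>2) powr (1/2)" using p by (simp add: cmod_def powr_half_sqrt)
  have "Re (of_real (t\<^sup>2) / (4 * Complex 1 r)) = t\<^sup>2 / (4 * (1 + r\<^sup>2))"
    using p by (simp add: Re_divide power2_eq_square field_simps)
  then have "norm (exp (- (of_real (t\<^sup>2) / (4 * Complex 1 r)))) = exp (- (t\<^sup>2 / (4 * (1 + r\<^sup>2))))"
    by simp
  also have "\<dots> \<le> 4 * (1 + r\<^sup>2) powr (11/12) * t powr (-11/6)"
    by (rule exp_minus_square_le_powr[OF assms p])
  finally have 1: "norm (exp (- (of_real (t\<^sup>2) / (4 * Complex 1 r)))) \<le> 4 * (1 + r\<^sup>2) powr (11/12) * t powr (-11/6)" .
  have 2: "norm (csqrt (Complex 1 r)) = (1 + r\<^sup>2) powr (1/4)"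
    unfolding norm_csqrt n using p by (simp add: powr_half_sqrt[symmetric] powr_powr)
  have "norm (exp (- (of_real (t\<^sup>2) / (4 * Complex 1 r))) / csqrt (Complex 1 r)) \<le> 
     4 * (1 + r\<^sup>2) powr (11/12) * t powr (-11/6) / (1 + r\<^sup>2) powr (1/4)"
    unfolding norm_divide 2 by (intro divide_right_mono 1) simp
  also have "\<dots> = 4 * t powr (-11/6) * ((1 + r\<^sup>2) powr (11/12) / (1 + r\<^sup>2) powr (1/4))" by simp
  also have "(1 + r\<^sup>2) powr (11/12) / (1 + r\<^sup>2) powr (1/4) = (1 + r\<^sup>2) powr (2/3)" by (simp add: powr_diff[symmetric])
  finally show ?thesis .
qed

text \<open>Defined as an integral and not as a difference of values of \<open>wave_prim\<close>,
  which divides by q; in this form it is continuous in \<xi> even where \<omega> vanishes.\<close>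

definition wave_integral :: "real \<Rightarrow> real \<Rightarrow> real ^ 5 \<Rightarrow> complex" where
  "wave_integral t R \<xi> = integral {0..R} (\<lambda>r. \<i> * wave_dens (omega \<xi>) t (Complex 1 r))"

lemma continuous_on_wave_integral: "continuous_on S (wave_integral t R)"
proof -
  have "continuous_on (UNIV \<times> cbox 0 R) (\<lambda>(\<xi>, r). \<i> * wave_dens (omega \<xi>) t (Complex 1 r))"
    unfolding case_prod_unfold
    by (intro continuous_intros continuous_on_wave_dens continuous_on_compose2[OF continuous_on_omega[of UNIV]]) auto
  from integral_continuous_on_param[OF this]
  have "continuous_on UNIV (wave_integral t R)" unfolding wave_integral_def by simp
  then show ?thesis by (rule continuous_on_subset) simp
qed

text \<open>For finite R the integrand is continuous on a compact box and the order of integration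
  can be exchanged. The Gaussian factor is free of \<xi>, and the rest splits over the
  coordinates.\<close>

lemma wave_integral_transform:
  assumes "R \<ge> 0"
  shows "(LINT \<xi>:cube|lborel. character x \<xi> * wave_integral t R \<xi>) = 
    integral {0..R} (\<lambda>r. \<i> * (exp (- (of_real (t\<^sup>2) / (4 * Complex 1 r))) / csqrt (Complex 1 r)) * (\<Prod>j\<in>UNIV. heat_kernel r (x $ j)))"
proof -
  define F where "F = (\<lambda>\<xi> r. character x \<xi> * (\<i> * wave_dens (omega \<xi>) t (Complex 1 r)))"
  have cont: "continuous_on S (\<lambda>(\<xi>, r). F \<xi> r)" for S
    unfolding F_def case_prod_unfold
    by (intro continuous_intros continuous_on_wave_dens continuous_on_compose2[OF continuous_on_omega[of UNIV]]
       continuous_on_compose2[OF continuous_on_character[of UNIV]]) auto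
  have "(LINT \<xi>:cube|lborel. character x \<xi> * wave_integral t R \<xi>) = integral cube (\<lambda>\<xi>. character x \<xi> * wave_integral t R \<xi>)"
    by (intro set_borel_integral_eq_integral set_integrable_cube_continuous continuous_intros continuous_on_wave_integral)
  also have "\<dots> = integral cube (\<lambda>\<xi>. integral (cbox 0 R) (F \<xi>))"
    by (simp add: wave_integral_def F_def)
  also have "\<dots> = integral (cbox 0 R) (\<lambda>r. integral cube (\<lambda>\<xi>. F \<xi> r))"
    by (rule integral_swap_continuous[OF cont])
  also have "\<dots> = integral (cbox 0 R) (\<lambda>r. \<i> * (exp (- (of_real (t\<^sup>2) / (4 * Complex 1 r))) / csqrt (Complex 1 r)) * (\<Prod>j\<in>UNIV. heat_kernel r (x $ j)))"
  proof (rule integral_cong)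
    fix r
    let ?g = "\<i> * (exp (- (of_real (t\<^sup>2) / (4 * Complex 1 r))) / csqrt (Complex 1 r))"
    have F: "F \<xi> r = ?g * (character x \<xi> * exp (of_real ((omega \<xi>)\<^sup>2) * Complex 1 r))" for \<xi>
    proof -
      have "exp (of_real ((omega \<xi>)\<^sup>2) * Complex 1 r - of_real (t\<^sup>2) / (4 * Complex 1 r)) =
         exp (of_real ((omega \<xi>)\<^sup>2) * Complex 1 r) * exp (- (of_real (t\<^sup>2) / (4 * Complex 1 r)))"
        by (simp only: exp_add[symmetric] diff_conv_add_uminus)
      then show ?thesis unfolding F_def wave_dens_def by (simp only:) simp
    qed
    have "integral cube (\<lambda>\<xi>. F \<xi> r) = ?g * integral cube (\<lambda>\<xi>. character x \<xi> * exp (of_real ((omega \<xi>)\<^sup>2) * Complex 1 r))"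
      unfolding F by (rule integral_mult_right)
    also have "integral cube (\<lambda>\<xi>. character x \<xi> * exp (of_real ((omega \<xi>)\<^sup>2) * Complex 1 r)) = 
       (LINT \<xi>:cube|lborel. character x \<xi> * exp (of_real ((omega \<xi>)\<^sup>2) * Complex 1 r))"
      by (intro set_borel_integral_eq_integral(2)[symmetric] set_integrable_cube_continuous continuous_intros)
    also have "\<dots> = (\<Prod>j\<in>UNIV. heat_kernel r (x $ j))" by (rule character_heat_integral)
    finally show "integral cube (\<lambda>\<xi>. F \<xi> r) = ?g * (\<Prod>j\<in>UNIV. heat_kernel r (x $ j))" .
  qed
  finally show ?thesis by simp
qed

text \<open>The uniformity in R and x is inherited from \<open>heat_kernel_L5\<close>; the constant
  20 = 4 * 5 collects the Gaussian factor and the number of coordinates.\<close>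

lemma wave_integral_bound:
  obtains C where "C \<ge> 0" "\<And>t R x. t > 0 \<Longrightarrow> R \<ge> 0 \<Longrightarrow>
     norm (LINT \<xi>:cube|lborel. character x \<xi> * wave_integral t R \<xi>) \<le> C * t powr (-11/6)"
proof -
  obtain C where C: "C \<ge> 0" "\<And>n R. R \<ge> 0 \<Longrightarrow> integral {0..R} (\<lambda>r. (1 + r\<^sup>2) powr (2/3) * norm (heat_kernel r n) ^ 5) \<le> C"
    using heat_kernel_L5 by blast
  have "norm (LINT \<xi>:cube|lborel. character x \<xi> * wave_integral t R \<xi>) \<le> 20 * C * t powr (-11/6)"
    if t: "t > 0" and R: "R \<ge> 0" for t R x
  proof -
    let ?w = "\<lambda>r::real. (1 + r\<^sup>2) powr (2/3)"
    let ?f = "\<lambda>r. \<i> * (exp (- (of_real (t\<^sup>2) / (4 * Complex 1 r))) / csqrt (Complex 1 r)) * (\<Prod>j\<in>UNIV. heat_kernel r (x $ j))"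
    let ?k = "\<lambda>n r. ?w r * norm (heat_kernel r n) ^ 5"
    have p: "1 + r\<^sup>2 \<noteq> 0" for r :: real by (smt (verit) zero_le_power2)
    have int: "?k n integrable_on {0..R}" for n
      using p by (intro integrable_continuous_real continuous_intros continuous_on_heat_kernel) auto
    have fint: "?f integrable_on {0..R}"
    proof (intro integrable_continuous_real)
      have "continuous_on {0..R} (\<lambda>r. wave_dens 0 t (Complex 1 r))"
        by (intro continuous_on_wave_dens continuous_intros)
      then have "continuous_on {0..R} (\<lambda>r. exp (- (of_real (t\<^sup>2) / (4 * Complex 1 r))) / csqrt (Complex 1 r))"
        by (simp add: wave_dens_def)
      then show "continuous_on {0..R} ?f" by (intro continuous_on_mult continuous_on_prod continuous_on_heat_kernel continuous_on_const)
    qed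
    have "norm (LINT \<xi>:cube|lborel. character x \<xi> * wave_integral t R \<xi>) = norm (integral {0..R} ?f)"
      unfolding wave_integral_transform[OF R] ..
    also have "\<dots> \<le> integral {0..R} (\<lambda>r. 4 * t powr (-11/6) * (\<Sum>j\<in>UNIV. ?k (x $ j) r))"
    proof (rule integral_norm_bound_integral[OF fint])
      show "(\<lambda>r. 4 * t powr (-11/6) * (\<Sum>j\<in>UNIV. ?k (x $ j) r)) integrable_on {0..R}"
        by (intro integrable_on_mult_right integrable_sum int) simp
      fix r
      have "norm (?f r) = norm (exp (- (of_real (t\<^sup>2) / (4 * Complex 1 r))) / csqrt (Complex 1 r)) * (\<Prod>j\<in>UNIV. norm (heat_kernel r (x $ j)))"
        by (simp only: norm_mult norm_ii mult_1 prod_norm)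
      also have "\<dots> \<le> (4 * t powr (-11/6) * ?w r) * (\<Sum>j\<in>UNIV. norm (heat_kernel r (x $ j)) ^ 5)"
        by (intro mult_mono norm_gaussian_factor[OF t] prod_le_sum_power prod_nonneg) auto
      also have "\<dots> = 4 * t powr (-11/6) * (\<Sum>j\<in>UNIV. ?k (x $ j) r)" by (simp only: sum_distrib_left mult.assoc)
      finally show "norm (?f r) \<le> 4 * t powr (-11/6) * (\<Sum>j\<in>UNIV. ?k (x $ j) r)" .
    qed
    also have "\<dots> = 4 * t powr (-11/6) * (\<Sum>j\<in>UNIV. integral {0..R} (?k (x $ j)))"
      using int by (simp only: integral_mult_right) (subst integral_sum, auto)
    also have "\<dots> \<le> 4 * t powr (-11/6) * (\<Sum>j\<in>(UNIV :: 5 set). C)"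
      by (intro mult_left_mono sum_mono C R) auto
    finally show ?thesis by (simp add: mult_ac)
  qed
  then show ?thesis using that[of "20 * C"] C(1) by auto
qed

lemma measurable_gauss_prim [measurable]: "gauss_prim \<in> borel_measurable borel"
  by (intro borel_measurable_continuous_onI continuous_on_gauss_prim)

text \<open>Dominated convergence with majorant B / \<omega>: the pointwise limit of the real part
  does not come with a rate uniform in \<omega>, but its mean over the cube still vanishes.\<close>

lemma wave_prim_boundary_small:
  assumes c: "((\<lambda>y. gauss_prim (\<i> * of_real y)) \<longlongrightarrow> \<i> * of_real c) at_top"
  shows "(\<lambda>n. LINT \<xi>:cube|lborel. \<bar>Re (wave_prim (omega \<xi>) t (Complex 1 (real n)))\<bar>) \<longlonglongrightarrow> 0"
    and "set_integrable lborel cube (\<lambda>\<xi>. \<bar>Re (wave_prim (omega \<xi>) t (Complex 1 R))\<bar>)"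
proof -
  obtain B where B: "B > 0" "\<And>q t R. q > 0 \<Longrightarrow> q\<^sup>2 \<le> 20 \<Longrightarrow> norm (wave_prim q t (Complex 1 R)) \<le> B / q"
    using wave_prim_bound by blast
  let ?g = "\<lambda>R \<xi>. \<bar>Re (wave_prim (omega \<xi>) t (Complex 1 R))\<bar>"
  let ?i = "\<lambda>\<xi>::real^5. indicator cube \<xi> :: real"
  have meas: "(\<lambda>\<xi>. ?i \<xi> *\<^sub>R ?g R \<xi>) \<in> borel_measurable lborel" for R
    unfolding wave_prim_def wave_arg_def by measurable
  have dom: "integrable lborel (\<lambda>\<xi>. ?i \<xi> *\<^sub>R (B * (1 / omega \<xi>)))"
    using inverse_omega_integrable set_integrable_mult_right[of B lborel cube "\<lambda>\<xi>. 1 / omega \<xi>"]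
    unfolding set_integrable_def by simp
  have le: "AE \<xi> in lborel. norm (?i \<xi> *\<^sub>R ?g R \<xi>) \<le> ?i \<xi> *\<^sub>R (B * (1 / omega \<xi>))" for R
    using AE_coords_nonzero
  proof eventually_elim
    case (elim \<xi>)
    show ?case
    proof (cases "\<xi> \<in> cube")
      case True
      have "?g R \<xi> \<le> B / omega \<xi>"
        using B(2)[OF omega_pos[OF True elim] omega_square_le, of t R] abs_Re_le_cmod order_trans by blast
      then show ?thesis using True by simp
    qed simp
  qed
  have lim: "AE \<xi> in lborel. (\<lambda>n. ?i \<xi> *\<^sub>R ?g (real n) \<xi>) \<longlonglongrightarrow> 0"
    using AE_coords_nonzero
  proof eventually_elim
    case (elim \<xi>)
    show ?case
    proof (cases "\<xi> \<in> cube")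
      case True
      have "(\<lambda>n. Re (wave_prim (omega \<xi>) t (Complex 1 (real n)))) \<longlonglongrightarrow> 0"
        by (rule filterlim_compose[OF wave_prim_at_top[OF omega_pos[OF True elim] omega_square_le c] filterlim_real_sequentially])
      then show ?thesis using True by (simp add: tendsto_rabs_zero)
    qed simp
  qed
  have "(\<lambda>n. \<integral>\<xi>. ?i \<xi> *\<^sub>R ?g (real n) \<xi> \<partial>lborel) \<longlonglongrightarrow> (\<integral>\<xi>. 0 \<partial>(lborel :: (real^5) measure))"
    by (rule integral_dominated_convergence[OF _ meas dom lim le]) simp
  then show "(\<lambda>n. LINT \<xi>:cube|lborel. ?g (real n) \<xi>) \<longlonglongrightarrow> 0" by (simp add: set_lebesgue_integral_def)
  show "set_integrable lborel cube (?g R)" unfolding set_integrable_def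
    by (rule Bochner_Integration.integrable_bound[OF dom meas]) (rule eventually_mono[OF le[of R]], erule order_trans, simp only: real_norm_def abs_ge_self)
qed

definition multiplier :: "real \<Rightarrow> real ^ 5 \<Rightarrow> complex" where
  "multiplier t \<xi> = of_real (sin (t * omega \<xi>) / omega \<xi>)"

lemma propagator_eq: "propagator t x = 1 / (2 * pi) ^ 5 * (LINT \<xi>:cube|lborel. character x \<xi> * multiplier t \<xi>)"
  by (simp add: propagator_def character_def multiplier_def)

lemma norm_propagator:
  "norm (propagator t x) = norm (LINT \<xi>:cube|lborel. character x \<xi> * multiplier t \<xi>) / (2 * pi) ^ 5"
  by (simp add: propagator_eq norm_mult norm_divide norm_power power_mult_distrib)

lemma measurable_multiplier [measurable]: "multiplier t \<in> borel_measurable borel"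
  unfolding multiplier_def by measurable

lemma norm_multiplier_le: "norm (multiplier t \<xi>) \<le> \<bar>t\<bar>"
proof (cases "omega \<xi> = 0")
  case False
  then have "omega \<xi> > 0" by (simp add: less_le)
  moreover have "\<bar>sin (t * omega \<xi>)\<bar> \<le> \<bar>t * omega \<xi>\<bar>" by (rule abs_sin_x_le_abs_x)
  ultimately show ?thesis unfolding multiplier_def norm_of_real
    by (simp add: abs_divide abs_mult pos_divide_le_eq)
qed (simp add: multiplier_def)

lemma norm_propagator_le: "norm (propagator t x) \<le> \<bar>t\<bar>"
proof -
  have i: "set_integrable lborel cube (\<lambda>\<xi>. character x \<xi> * multiplier t \<xi>)"
    by (rule set_integrable_cube[of _ "\<bar>t\<bar>"]) (auto simp: norm_mult norm_multiplier_le)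
  have "norm (LINT \<xi>:cube|lborel. character x \<xi> * multiplier t \<xi>) \<le> (LINT \<xi>:cube|lborel. norm (character x \<xi> * multiplier t \<xi>))"
    by (rule set_integral_norm_bound[OF i])
  also have "\<dots> \<le> (LINT \<xi>:cube|lborel. \<bar>t\<bar> * 1)"
    by (rule set_integral_mono[OF set_integrable_norm[OF i] set_integrable_cube[of _ "\<bar>t\<bar>"]])
       (auto simp: norm_mult norm_multiplier_le)
  also have "\<dots> = \<bar>t\<bar> * (2 * pi) ^ 5" by (subst set_integral_mult_right) (simp only: measure_cube)
  finally show ?thesis unfolding norm_propagator by (subst pos_divide_le_eq) auto
qed

lemma propagator_uminus: "propagator (- t) x = - propagator t x"
proof -
  have "multiplier (- t) \<xi> = - multiplier t \<xi>" for \<xi> by (simp add: multiplier_def)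
  then show ?thesis unfolding propagator_eq by (simp add: set_lebesgue_integral_def)
qed

text \<open>At each frequency, 2 c sin (t \<omega>) / \<omega> plus the real part of the truncated
  subordination integral is an error of size t^(-11/6) plus an endpoint term at 1 + i R. Integrating
  against the character and letting R grow removes the endpoint term.\<close>

lemma propagator_decay_pos:
  obtains C where "C \<ge> 0" "\<And>t x. t > 0 \<Longrightarrow> norm (propagator t x) \<le> C * t powr (-11/6)"
proof -
  obtain c where c: "c > 0" "((\<lambda>y. gauss_prim (\<i> * of_real y)) \<longlongrightarrow> \<i> * of_real c) at_top"
    using gauss_prim_imag by metis
  obtain C where C: "C \<ge> 0" "\<And>t R x. t > 0 \<Longrightarrow> R \<ge> 0 \<Longrightarrow>
     norm (LINT \<xi>:cube|lborel. character x \<xi> * wave_integral t R \<xi>) \<le> C * t powr (-11/6)"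
    using wave_integral_bound by blast
  define K where "K = (2 * pi) ^ 5 * (4 * exp 20) + C"
  have main: "2 * c * norm (LINT \<xi>:cube|lborel. character x \<xi> * multiplier t \<xi>) \<le> K * t powr (-11/6)" if t: "t > 0" for t x
  proof -
    let ?I = "LINT \<xi>:cube|lborel. character x \<xi> * multiplier t \<xi>"
    let ?e = "4 * exp 20 * t powr (-11/6)"
    let ?b = "\<lambda>R. LINT \<xi>:cube|lborel. \<bar>Re (wave_prim (omega \<xi>) t (Complex 1 R))\<bar>"
    let ?W = "\<lambda>R \<xi>. of_real (Re (wave_integral t R \<xi>)) :: complex"
    note bint = wave_prim_boundary_small(2)[OF c(2), of t]
    have step: "2 * c * norm ?I \<le> K * t powr (-11/6) + ?b R" if R: "R \<ge> 0" for R
    proof -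
      have i1: "set_integrable lborel cube (\<lambda>\<xi>. of_real (2 * c) * (character x \<xi> * multiplier t \<xi>))"
        by (intro set_integrable_mult_right impI set_integrable_cube[of _ "\<bar>t\<bar>"]) (auto simp: norm_mult norm_multiplier_le)
      have wint: "set_integrable lborel cube (\<lambda>\<xi>. character y \<xi> * wave_integral t R \<xi>)" for y
        by (intro set_integrable_cube_continuous continuous_intros continuous_on_wave_integral)
      have i2: "set_integrable lborel cube (\<lambda>\<xi>. character x \<xi> * ?W R \<xi>)"
        by (intro set_integrable_cube_continuous continuous_intros continuous_on_wave_integral)
      have "norm (LINT \<xi>:cube|lborel. of_real (2 * c) * (character x \<xi> * multiplier t \<xi>) + character x \<xi> * ?W R \<xi>) \<le>
         (LINT \<xi>:cube|lborel. ?e * 1 + \<bar>Re (wave_prim (omega \<xi>) t (Complex 1 R))\<bar>)"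
      proof -
        have ei: "set_integrable lborel cube (\<lambda>\<xi>. ?e * 1 + \<bar>Re (wave_prim (omega \<xi>) t (Complex 1 R))\<bar>)"
          by (intro set_integral_add bint set_integrable_cube[of _ ?e]) auto
        have ae: "AE \<xi> in lborel. \<xi> \<in> cube \<longrightarrow> norm (of_real (2 * c) * (character x \<xi> * multiplier t \<xi>) + character x \<xi> * ?W R \<xi>) \<le>
           ?e * 1 + \<bar>Re (wave_prim (omega \<xi>) t (Complex 1 R))\<bar>"
          using AE_coords_nonzero
        proof eventually_elim
          case (elim \<xi>)
          show ?case
          proof
            assume \<xi>: "\<xi> \<in> cube"
            define q where "q = omega \<xi>"
            have q: "q > 0" "q\<^sup>2 \<le> 20" using omega_pos[OF \<xi> elim] omega_square_le by (auto simp: q_def)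
            have W: "wave_integral t R \<xi> = wave_prim q t (Complex 1 R) - wave_prim q t 1"
              unfolding wave_integral_def q_def[symmetric] by (rule integral_unique[OF wave_prim_integral[OF q(1) R]])
            define s where "s = 2 * c * sin (t * q) / q"
            have e: "norm (wave_prim q t 1 - of_real s) \<le> ?e"
              unfolding s_def by (rule wave_prim_one[OF q t c(2)])
            have "norm (of_real (2 * c) * (character x \<xi> * multiplier t \<xi>) + character x \<xi> * ?W R \<xi>) = 
              norm (character x \<xi> * of_real (s + Re (wave_integral t R \<xi>)))"
              by (simp add: multiplier_def s_def q_def algebra_simps)
            also have "\<dots> = \<bar>s + Re (wave_integral t R \<xi>)\<bar>" by (simp only: norm_mult norm_character mult_1 norm_of_real)
            also have "s + Re (wave_integral t R \<xi>) = - Re (wave_prim q t 1 - of_real s) + Re (wave_prim q t (Complex 1 R))"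
              unfolding W by simp
            also have "\<bar>\<dots>\<bar> \<le> ?e + \<bar>Re (wave_prim q t (Complex 1 R))\<bar>"
              using e abs_Re_le_cmod[of "wave_prim q t 1 - of_real s"] by linarith
            finally show "norm (of_real (2 * c) * (character x \<xi> * multiplier t \<xi>) + character x \<xi> * ?W R \<xi>) \<le>
               ?e * 1 + \<bar>Re (wave_prim (omega \<xi>) t (Complex 1 R))\<bar>" by (simp add: q_def)
          qed
        qed
        show ?thesis
          using set_integral_norm_bound[OF set_integral_add(1)[OF i1 i2]]
            set_integral_mono_AE[OF set_integrable_norm[OF set_integral_add(1)[OF i1 i2]] ei ae] by linarith
      qed
      also have "\<dots> = ?e * (2 * pi) ^ 5 + ?b R"
      proof -
        have "set_integrable lborel cube (\<lambda>\<xi>::real^5. ?e * 1)" by (rule set_integrable_cube[of _ ?e]) simp_all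
        moreover have "(LINT \<xi>:cube|lborel. ?e * 1) = ?e * (2 * pi) ^ 5"
          by (simp only: set_integral_mult_right measure_cube)
        ultimately show ?thesis by (simp only: set_integral_add(2)[OF _ bint])
      qed
      finally have 1: "norm (of_real (2 * c) * ?I + (LINT \<xi>:cube|lborel. character x \<xi> * ?W R \<xi>)) \<le> ?e * (2 * pi) ^ 5 + ?b R"
        unfolding set_integral_add(2)[OF i1 i2] set_integral_mult_right .
      have 2: "norm (LINT \<xi>:cube|lborel. character x \<xi> * ?W R \<xi>) \<le> C * t powr (-11/6)"
      proof -
        \<comment> \<open>The known bound concerns the transform of the complex integral. Its real
          part is reached by averaging with the conjugate of the transform at - x, which obeys the
          same bound.\<close>
        have W2: "character x \<xi> * ?W R \<xi> = (character x \<xi> * wave_integral t R \<xi> + cnj (character (- x) \<xi> * wave_integral t R \<xi>)) / 2" for \<xi>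
        proof -
          have "?W R \<xi> = (wave_integral t R \<xi> + cnj (wave_integral t R \<xi>)) / 2" by (simp add: complex_add_cnj)
          then show ?thesis by (simp add: character_uminus distrib_left add_divide_distrib)
        qed
        have cn: "set_integrable lborel cube (\<lambda>\<xi>. cnj (character (- x) \<xi> * wave_integral t R \<xi>))"
          by (intro set_integrable_cube_continuous continuous_intros continuous_on_wave_integral)
        have "(LINT \<xi>:cube|lborel. cnj (character (- x) \<xi> * wave_integral t R \<xi>)) = cnj (LINT \<xi>:cube|lborel. character (- x) \<xi> * wave_integral t R \<xi>)"
        proof -
          have "(LINT \<xi>:cube|lborel. cnj (character (- x) \<xi> * wave_integral t R \<xi>)) =
             (\<integral>\<xi>. cnj (indicator cube \<xi> *\<^sub>R (character (- x) \<xi> * wave_integral t R \<xi>)) \<partial>lborel)"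
            unfolding set_lebesgue_integral_def
            by (intro Bochner_Integration.integral_cong) (simp_all add: scaleR_conv_of_real)
          then show ?thesis unfolding set_lebesgue_integral_def by (rule trans) (rule Bochner_Integration.integral_cnj)
        qed
        then have "(LINT \<xi>:cube|lborel. character x \<xi> * ?W R \<xi>) = 
          ((LINT \<xi>:cube|lborel. character x \<xi> * wave_integral t R \<xi>) + cnj (LINT \<xi>:cube|lborel. character (- x) \<xi> * wave_integral t R \<xi>)) / 2"
          unfolding W2 set_integral_divide_zero set_integral_add(2)[OF wint cn] by simp
        also have "norm \<dots> \<le> (C * t powr (-11/6) + C * t powr (-11/6)) / 2"
        proof -
          have "norm ((a + cnj b) / 2) \<le> (B + B) / 2" if "norm a \<le> B" "norm b \<le> B" for a b :: complex and B
            using norm_triangle_ineq[of a "cnj b"] that by (simp add: norm_divide)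
          from this[OF C(2)[OF t R] C(2)[OF t R]] show ?thesis .
        qed
        finally show ?thesis by simp
      qed
      have "2 * c * norm ?I = norm (of_real (2 * c) * ?I)" using c(1) by (simp add: norm_mult)
      also have "\<dots> \<le> norm (of_real (2 * c) * ?I + (LINT \<xi>:cube|lborel. character x \<xi> * ?W R \<xi>)) + norm (LINT \<xi>:cube|lborel. character x \<xi> * ?W R \<xi>)"
      proof -
        have "norm a \<le> norm (a + b) + norm b" for a b :: complex using norm_triangle_ineq4[of "a + b" b] by simp
        then show ?thesis .
      qed
      also have "\<dots> \<le> ?e * (2 * pi) ^ 5 + ?b R + C * t powr (-11/6)" by (intro add_mono 1 2)
      also have "\<dots> = K * t powr (-11/6) + ?b R" by (simp add: K_def algebra_simps)
      finally show ?thesis .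
    qed
    show ?thesis
    proof (rule tendsto_lowerbound)
      show "(\<lambda>n. K * t powr (-11/6) + ?b (real n)) \<longlonglongrightarrow> K * t powr (-11/6)"
        using tendsto_add[OF tendsto_const wave_prim_boundary_small(1)[OF c(2), of t]] by simp
      show "\<forall>\<^sub>F n in sequentially. 2 * c * norm ?I \<le> K * t powr (-11/6) + ?b (real n)" using step by simp
    qed simp
  qed
  define C' where "C' = K / (2 * c) / (2 * pi) ^ 5"
  have "C' \<ge> 0" using C c by (simp add: C'_def K_def)
  moreover have "norm (propagator t x) \<le> C' * t powr (-11/6)" if t: "t > 0" for t x
  proof -
    have "norm (propagator t x) = norm (LINT \<xi>:cube|lborel. character x \<xi> * multiplier t \<xi>) / (2 * pi) ^ 5"
      by (rule norm_propagator)
    also have "\<dots> \<le> (K * t powr (-11/6) / (2 * c)) / (2 * pi) ^ 5"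
      using main[OF t, of x] c(1) by (intro divide_right_mono) (auto simp: pos_le_divide_eq mult_ac)
    finally show ?thesis by (simp add: C'_def)
  qed
  ultimately show ?thesis using that by blast
qed

definition decay :: "real \<Rightarrow> real" where
  "decay t = (1 + \<bar>t\<bar>) powr (-11/6)"

lemma propagator_decay:
  obtains C where "C > 0" "\<And>t x. norm (propagator t x) \<le> C * decay t"
proof -
  obtain C where C: "C \<ge> 0" "\<And>t x. t > 0 \<Longrightarrow> norm (propagator t x) \<le> C * t powr (-11/6)"
    using propagator_decay_pos by blast
  have pos: "norm (propagator t x) \<le> (C + 1) * 4 * decay t" if t: "t \<ge> 0" for t x
  proof -
    \<comment> \<open>For t < 1 the trivial bound |t| replaces the decay estimate, and max t 1 >= (1
      + t) / 2 merges the two ranges.\<close>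
    define m where "m = (if t \<ge> 1 then t else 1)"
    have m: "m > 0" "(1 + t) / 2 \<le> m" using t by (auto simp: m_def)
    have "norm (propagator t x) \<le> (C + 1) * m powr (-11/6)"
    proof (cases "t \<ge> 1")
      case True
      have "norm (propagator t x) \<le> C * t powr (-11/6)" using C(2) True by simp
      also have "\<dots> \<le> (C + 1) * t powr (-11/6)" by (intro mult_right_mono) auto
      finally show ?thesis using True by (simp add: m_def)
    next
      case False
      then have "norm (propagator t x) \<le> 1" using norm_propagator_le[of t x] t by simp
      then show ?thesis using False C(1) by (simp add: m_def)
    qed
    also have "\<dots> \<le> (C + 1) * ((1 + t) / 2) powr (-11/6)"
      using C(1) m t by (intro mult_left_mono powr_mono2') auto
    also have "((1 + t) / 2) powr (-11/6) = (1 + t) powr (-11/6) / 2 powr (-11/6)" by (rule powr_divide)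
    also have "\<dots> = 2 powr (11/6) * (1 + t) powr (-11/6)"
      using powr_minus_divide[of "2::real" "11/6"] by simp
    also have "(C + 1) * (2 powr (11/6) * (1 + t) powr (-11/6)) \<le> (C + 1) * (4 * (1 + t) powr (-11/6))"
    proof (intro mult_left_mono mult_right_mono)
      have "(2::real) powr (11/6) \<le> 2 powr 2" by (intro powr_mono) auto
      then show "(2::real) powr (11/6) \<le> 4" by simp
    qed (use C in auto)
    finally show ?thesis unfolding decay_def abs_of_nonneg[OF t] by (simp only: mult.assoc)
  qed
  have "norm (propagator t x) \<le> (C + 1) * 4 * decay t" for t x
  proof (cases "t \<ge> 0")
    case False
    then have "norm (propagator t x) = norm (propagator (- t) x)" by (simp add: propagator_uminus)
    also have "\<dots> \<le> (C + 1) * 4 * decay (- t)" using False by (intro pos) simp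
    finally show ?thesis by (simp add: decay_def)
  qed (rule pos)
  then show ?thesis using that[of "(C + 1) * 4"] C(1) by simp
qed

section \<open>Summability of the propagator\<close>

lemma set_integrable_character:
  assumes "f \<in> borel_measurable borel" "\<And>\<xi>. norm (f \<xi>) \<le> B"
  shows "set_integrable lborel cube (\<lambda>\<xi>. character x \<xi> * f \<xi>)"
  using assms by (intro set_integrable_cube[of _ B]) (auto simp: norm_mult)

lemma set_integral_sum:
  fixes f :: "'i \<Rightarrow> 'a \<Rightarrow> 'b::{banach, second_countable_topology}"
  assumes "finite F" "\<And>i. set_integrable M A (f i)"
  shows "set_integrable M A (\<lambda>x. \<Sum>i\<in>F. f i x)"
    and "(LINT x:A|M. \<Sum>i\<in>F. f i x) = (\<Sum>i\<in>F. LINT x:A|M. f i x)"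
  using assms(2) unfolding set_integrable_def set_lebesgue_integral_def scaleR_sum_right
  by (rule Bochner_Integration.integrable_sum, rule Bochner_Integration.integral_sum)

section \<open>Uniform l2 bound for the propagator\<close>

lemma trig_poly_square_integral:
  fixes c :: "lattice5 \<Rightarrow> complex"
  assumes "finite F"
  shows "set_integrable lborel cube (\<lambda>\<xi>. (norm (\<Sum>x\<in>F. c x * character x \<xi>))\<^sup>2)"
    and "(LINT \<xi>:cube|lborel. (norm (\<Sum>x\<in>F. c x * character x \<xi>))\<^sup>2) = (2 * pi) ^ 5 * (\<Sum>x\<in>F. (norm (c x))\<^sup>2)"
proof -
  let ?f = "\<lambda>\<xi>. (norm (\<Sum>x\<in>F. c x * character x \<xi>))\<^sup>2"
  show i: "set_integrable lborel cube ?f"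
    by (intro set_integrable_cube_continuous continuous_intros)
  have e: "of_real (?f \<xi>) = (\<Sum>x\<in>F. \<Sum>y\<in>F. c x * cnj (c y) * character (x - y) \<xi>)" for \<xi>
  proof -
    have "of_real (?f \<xi>) = (\<Sum>x\<in>F. c x * character x \<xi>) * cnj (\<Sum>x\<in>F. c x * character x \<xi>)"
      by (rule complex_norm_square)
    also have "\<dots> = (\<Sum>x\<in>F. \<Sum>y\<in>F. c x * character x \<xi> * (cnj (c y) * character (- y) \<xi>))"
      by (simp add: sum_product character_uminus)
    also have "\<dots> = (\<Sum>x\<in>F. \<Sum>y\<in>F. c x * cnj (c y) * character (x - y) \<xi>)"
      using character_add[of _ "- _" \<xi>] by (intro sum.cong refl) (simp add: mult_ac)
    finally show ?thesis .
  qed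
  have ci: "set_integrable lborel cube (\<lambda>\<xi>. a * character x \<xi>)" for a x
    by (intro set_integrable_cube_continuous continuous_intros)
  have si: "set_integrable lborel cube (\<lambda>\<xi>. \<Sum>y\<in>F. c x * cnj (c y) * character (x - y) \<xi>)" for x
    by (intro set_integrable_cube_continuous continuous_intros)
  have "of_real (LINT \<xi>:cube|lborel. ?f \<xi>) = (LINT \<xi>:cube|lborel. complex_of_real (?f \<xi>))"
    by (rule set_integral_complex_of_real[symmetric])
  also have "\<dots> = (\<Sum>x\<in>F. \<Sum>y\<in>F. c x * cnj (c y) * (LINT \<xi>:cube|lborel. character (x - y) \<xi>))"
    unfolding e by (simp only: set_integral_sum(2)[OF assms si] set_integral_sum(2)[OF assms ci] set_integral_mult_right)
  also have "\<dots> = (\<Sum>x\<in>F. c x * cnj (c x) * (2 * of_real pi) ^ 5)"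
  proof (rule sum.cong[OF refl])
    fix x assume "x \<in> F"
    then show "(\<Sum>y\<in>F. c x * cnj (c y) * (LINT \<xi>:cube|lborel. character (x - y) \<xi>)) = c x * cnj (c x) * (2 * of_real pi) ^ 5"
      unfolding character_integral using assms by (subst sum.remove[of F x]) (auto intro!: sum.neutral split: if_splits)
  qed
  also have "\<dots> = of_real ((2 * pi) ^ 5 * (\<Sum>x\<in>F. (norm (c x))\<^sup>2))"
    unfolding of_real_mult of_real_sum complex_norm_square of_real_power[of "2 * pi" 5] sum_distrib_left
    by (simp add: mult_ac)
  finally show "(LINT \<xi>:cube|lborel. ?f \<xi>) = (2 * pi) ^ 5 * (\<Sum>x\<in>F. (norm (c x))\<^sup>2)"
    by (simp only: of_real_eq_iff)
qed

text \<open>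
  The \<open>\<ell>\<^sup>2\<close> norm is bounded in the dual form, which is linear and so passes through
  the sum and the integral of Duhamel's formula.
\<close>

lemma propagator_l2:
  obtains C where "C > 0" "\<And>t F c. finite F \<Longrightarrow>
    norm (\<Sum>x\<in>F. c x * propagator t x) \<le> C * sqrt (\<Sum>x\<in>F. (norm (c x))\<^sup>2)"
proof -
  define W where "W = (LINT \<xi>:cube|lborel. 1 / (omega \<xi>)\<^sup>2)"
  have W: "W \<ge> 0" unfolding W_def set_lebesgue_integral_def by (intro Bochner_Integration.integral_nonneg) auto
  define P where "P = (2 * pi) ^ 5"
  have P: "P > 0" by (simp add: P_def)
  define C where "C = (P + W) / (2 * P)"
  have "norm (\<Sum>x\<in>F. c x * propagator t x) \<le> C * sqrt (\<Sum>x\<in>F. (norm (c x))\<^sup>2)" if F: "finite F" for t F c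
  proof (cases "\<forall>x\<in>F. c x = 0")
    case False
    define N where "N = (\<Sum>x\<in>F. (norm (c x))\<^sup>2)"
    have N: "N > 0" using False F unfolding N_def by (auto intro!: sum_pos2)
    define S where "S = (\<lambda>\<xi>. \<Sum>x\<in>F. c x * character x \<xi>)"
    have m_int: "set_integrable lborel cube (\<lambda>\<xi>. c x * (character x \<xi> * multiplier t \<xi>))" for x
      by (intro set_integrable_mult_right impI set_integrable_character[of _ "\<bar>t\<bar>"] norm_multiplier_le) simp
    have Sm: "S \<xi> * multiplier t \<xi> = (\<Sum>x\<in>F. c x * (character x \<xi> * multiplier t \<xi>))" for \<xi>
      by (simp add: S_def sum_distrib_right mult.assoc)
    have Sint: "set_integrable lborel cube (\<lambda>\<xi>. S \<xi> * multiplier t \<xi>)"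
      unfolding Sm by (intro set_integral_sum F m_int)
    have "(\<Sum>x\<in>F. c x * propagator t x) = 1 / of_real P * (LINT \<xi>:cube|lborel. S \<xi> * multiplier t \<xi>)"
      unfolding Sm set_integral_sum(2)[OF F m_int] propagator_eq P_def
      by (simp add: sum_distrib_left mult_ac)
    then have 1: "norm (\<Sum>x\<in>F. c x * propagator t x) = norm (LINT \<xi>:cube|lborel. S \<xi> * multiplier t \<xi>) / P"
      using P by (simp add: norm_mult norm_divide)
    have ri: "set_integrable lborel cube (\<lambda>\<xi>. 1 / (2 * sqrt N) * (norm (S \<xi>))\<^sup>2 + sqrt N / 2 * (1 / (omega \<xi>)\<^sup>2))"
      unfolding S_def by (intro set_integral_add set_integrable_mult_right impI inverse_omega_square_integrable trig_poly_square_integral F)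
    have "norm (LINT \<xi>:cube|lborel. S \<xi> * multiplier t \<xi>) \<le> (LINT \<xi>:cube|lborel. norm (S \<xi> * multiplier t \<xi>))"
      by (rule set_integral_norm_bound[OF Sint])
    also have "\<dots> \<le> (LINT \<xi>:cube|lborel. 1 / (2 * sqrt N) * (norm (S \<xi>))\<^sup>2 + sqrt N / 2 * (1 / (omega \<xi>)\<^sup>2))"
    proof (rule set_integral_mono[OF set_integrable_norm[OF Sint] ri])
      fix \<xi> :: "real ^ 5"
      \<comment> \<open>A weighted arithmetic-geometric inequality in place of Cauchy-Schwarz. The
        weight s = sqrt N makes both resulting integrals proportional to sqrt N; \<open>C\<close> is
        then (P + W) / (2 P).\<close>
      have amgm: "a * b \<le> 1 / (2 * s) * a\<^sup>2 + s / 2 * b\<^sup>2" if "s > 0" for a b s :: real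
      proof -
        have "1 / (2 * s) * a\<^sup>2 + s / 2 * b\<^sup>2 - a * b = (a - s * b)\<^sup>2 / (2 * s)"
          using that by (simp add: field_simps power2_eq_square)
        moreover have "(a - s * b)\<^sup>2 / (2 * s) \<ge> 0" using that by simp
        ultimately show ?thesis by linarith
      qed
      have "norm (multiplier t \<xi>) \<le> 1 / omega \<xi>"
        unfolding multiplier_def norm_of_real by (simp add: abs_divide divide_right_mono)
      then have "norm (S \<xi> * multiplier t \<xi>) \<le> norm (S \<xi>) * (1 / omega \<xi>)"
        unfolding norm_mult by (rule mult_left_mono) simp
      also have "\<dots> \<le> 1 / (2 * sqrt N) * (norm (S \<xi>))\<^sup>2 + sqrt N / 2 * (1 / omega \<xi>)\<^sup>2"
        using N by (intro amgm) simp
      finally show "norm (S \<xi> * multiplier t \<xi>) \<le> 1 / (2 * sqrt N) * (norm (S \<xi>))\<^sup>2 + sqrt N / 2 * (1 / (omega \<xi>)\<^sup>2)"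
        by (simp only: power_one_over)
    qed
    also have "\<dots> = 1 / (2 * sqrt N) * (P * N) + sqrt N / 2 * W"
    proof -
      have i1: "set_integrable lborel cube (\<lambda>\<xi>. 1 / (2 * sqrt N) * (norm (S \<xi>))\<^sup>2)"
        unfolding S_def by (intro set_integrable_mult_right impI trig_poly_square_integral F)
      have i2: "set_integrable lborel cube (\<lambda>\<xi>. sqrt N / 2 * (1 / (omega \<xi>)\<^sup>2))"
        by (intro set_integrable_mult_right impI inverse_omega_square_integrable)
      show ?thesis unfolding set_integral_add(2)[OF i1 i2] set_integral_mult_right W_def
        unfolding S_def trig_poly_square_integral(2)[OF F] N_def P_def ..
    qed
    also have "\<dots> = (P + W) / 2 * sqrt N"
    proof -
      have "N / sqrt N = sqrt N" using N by (simp add: real_div_sqrt)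
      then have "1 / (2 * sqrt N) * (P * N) = P / 2 * sqrt N" by (metis divide_divide_eq_left mult.commute times_divide_eq_left times_divide_eq_right mult_1)
      then show ?thesis by (simp add: algebra_simps add_divide_distrib)
    qed
    finally have "norm (\<Sum>x\<in>F. c x * propagator t x) \<le> ((P + W) / 2 * sqrt N) / P"
      unfolding 1 using P by (intro divide_right_mono) auto
    then show ?thesis by (simp add: C_def N_def)
  qed (use P W in \<open>simp add: C_def\<close>)
  moreover have "C > 0" using P W by (simp add: C_def add_pos_nonneg)
  ultimately show ?thesis using that by blast
qed

section \<open>Power series in time and the l1 bound for the propagator\<close>

text \<open>Up to the factor (2 pi)^5, the convolution kernel of the n-th power of minus the
  discrete Laplacian, whose symbol is \<omega>^2.\<close>

definition omega_coeff :: "nat \<Rightarrow> lattice5 \<Rightarrow> complex" where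
  "omega_coeff n x = (LINT \<xi>:cube|lborel. character x \<xi> * of_real ((omega \<xi>)\<^sup>2 ^ n))"

lemma set_integrable_omega_power: "set_integrable lborel cube (\<lambda>\<xi>. character x \<xi> * of_real ((omega \<xi>)\<^sup>2 ^ n))"
  by (intro set_integrable_cube_continuous continuous_intros)

lemma omega_coeff_Suc:
  "omega_coeff (Suc n) x = (\<Sum>j\<in>UNIV. 2 * omega_coeff n x - omega_coeff n (x + axis j 1) - omega_coeff n (x + - axis j 1))"
proof -
  have ax: "character (axis j 1) \<xi> = exp (\<i> * of_real (\<xi> $ j))" for j \<xi>
  proof -
    have "(\<Sum>i\<in>UNIV. of_int ((axis j 1 :: lattice5) $ i) * \<xi> $ i) = (\<Sum>i\<in>UNIV. if i = j then \<xi> $ i else 0)"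
      by (intro sum.cong) (auto simp: axis_def)
    also have "\<dots> = \<xi> $ j" by simp
    finally show ?thesis unfolding character_def by simp
  qed
  have l: "character x \<xi> * of_real (2 - 2 * cos (\<xi> $ j)) = 2 * character x \<xi> - character (x + axis j 1) \<xi> - character (x + - axis j 1) \<xi>" for j \<xi>
  proof -
    have "of_real (2 * cos (\<xi> $ j)) = exp (\<i> * of_real (\<xi> $ j)) + cnj (exp (\<i> * of_real (\<xi> $ j)))"
      by (simp add: complex_add_cnj Re_exp)
    then show ?thesis unfolding character_add character_uminus ax by (simp add: algebra_simps)
  qed
  have eq: "character x \<xi> * of_real ((omega \<xi>)\<^sup>2 ^ Suc n) = (\<Sum>j\<in>UNIV. 2 * (character x \<xi> * of_real ((omega \<xi>)\<^sup>2 ^ n)) -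
     character (x + axis j 1) \<xi> * of_real ((omega \<xi>)\<^sup>2 ^ n) - character (x + - axis j 1) \<xi> * of_real ((omega \<xi>)\<^sup>2 ^ n))" for \<xi>
  proof -
    have "character x \<xi> * of_real ((omega \<xi>)\<^sup>2 ^ Suc n) = (\<Sum>j\<in>UNIV. character x \<xi> * of_real (2 - 2 * cos (\<xi> $ j))) * of_real ((omega \<xi>)\<^sup>2 ^ n)"
    proof -
      have "character x \<xi> * of_real ((omega \<xi>)\<^sup>2) = (\<Sum>j\<in>UNIV. character x \<xi> * of_real (2 - 2 * cos (\<xi> $ j)))"
        by (simp only: omega_square of_real_sum sum_distrib_left)
      then show ?thesis by (simp only: power_Suc of_real_mult mult.assoc[symmetric])
    qed
    then show ?thesis unfolding l by (simp only: sum_distrib_right left_diff_distrib mult.assoc)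
  qed
  have i: "set_integrable lborel cube (\<lambda>\<xi>. 2 * (character x \<xi> * of_real ((omega \<xi>)\<^sup>2 ^ n)))"
    by (intro set_integrable_mult_right impI set_integrable_omega_power)
  have i3: "set_integrable lborel cube (\<lambda>\<xi>. 2 * (character x \<xi> * of_real ((omega \<xi>)\<^sup>2 ^ n)) -
     character (x + axis j 1) \<xi> * of_real ((omega \<xi>)\<^sup>2 ^ n) - character (x + - axis j 1) \<xi> * of_real ((omega \<xi>)\<^sup>2 ^ n))" for j
    by (intro set_integral_diff i set_integrable_omega_power)
  show ?thesis unfolding omega_coeff_def eq
    by (simp only: set_integral_sum(2)[OF finite i3] set_integral_diff(2)[OF set_integral_diff(1)[OF i set_integrable_omega_power] set_integrable_omega_power]
        set_integral_diff(2)[OF i set_integrable_omega_power] set_integral_mult_right)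
qed

text \<open>Each application of minus the Laplacian multiplies the l1 norm by at most 5 * (2 + 1 +
  1) = 20, by translation invariance.\<close>

lemma omega_coeff_l1:
  "finite F \<Longrightarrow> (\<Sum>x\<in>F. norm (omega_coeff n x)) \<le> (2 * pi) ^ 5 * 20 ^ n"
proof (induction n arbitrary: F)
  case 0
  have "(\<Sum>x\<in>F. norm (omega_coeff 0 x)) = (\<Sum>x\<in>F. if x = 0 then (2 * pi) ^ 5 else 0)"
    unfolding omega_coeff_def by (intro sum.cong) (simp_all add: character_integral norm_power norm_mult)
  also have "\<dots> \<le> (2 * pi) ^ 5" using 0 by simp
  finally show ?case by simp
next
  case (Suc n)
  let ?B = "(2 * pi) ^ 5 * 20 ^ n :: real"
  have shift: "(\<Sum>x\<in>F. norm (omega_coeff n (x + y))) \<le> ?B" for y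
  proof -
    have "(\<Sum>x\<in>F. norm (omega_coeff n (x + y))) = (\<Sum>x\<in>(\<lambda>x. x + y) ` F. norm (omega_coeff n x))"
      by (subst sum.reindex) (auto simp: inj_on_def)
    also have "\<dots> \<le> ?B" using Suc.prems by (intro Suc.IH) simp
    finally show ?thesis .
  qed
  have "(\<Sum>x\<in>F. norm (omega_coeff (Suc n) x)) \<le> (\<Sum>x\<in>F. \<Sum>j\<in>(UNIV :: 5 set). 2 * norm (omega_coeff n (x + 0)) +
      norm (omega_coeff n (x + axis j 1)) + norm (omega_coeff n (x + - axis j 1)))"
    unfolding omega_coeff_Suc
  proof (intro sum_mono order_trans[OF norm_sum])
    fix x j
    have "norm (2 * omega_coeff n x) = 2 * norm (omega_coeff n x)" by (simp add: norm_mult)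
    then show "norm (2 * omega_coeff n x - omega_coeff n (x + axis j 1) - omega_coeff n (x + - axis j 1)) \<le>
       2 * norm (omega_coeff n (x + 0)) + norm (omega_coeff n (x + axis j 1)) + norm (omega_coeff n (x + - axis j 1))"
      using norm_triangle_ineq4[of "2 * omega_coeff n x - omega_coeff n (x + axis j 1)" "omega_coeff n (x + - axis j 1)"]
        norm_triangle_ineq4[of "2 * omega_coeff n x" "omega_coeff n (x + axis j 1)"] by simp
  qed
  also have "\<dots> = (\<Sum>j\<in>(UNIV :: 5 set). 2 * (\<Sum>x\<in>F. norm (omega_coeff n (x + 0))) +
      (\<Sum>x\<in>F. norm (omega_coeff n (x + axis j 1))) + (\<Sum>x\<in>F. norm (omega_coeff n (x + - axis j 1))))"
    by (subst sum.swap) (simp only: sum.distrib sum_distrib_left)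
  also have "\<dots> \<le> (\<Sum>j\<in>(UNIV :: 5 set). 2 * ?B + ?B + ?B)"
    by (intro sum_mono add_mono mult_left_mono shift) simp
  finally show ?case by simp
qed

text \<open>Termwise integration of the power series of sin (t \<omega>) / \<omega> in \<omega>^2,
  with (2 n + 1)! weakened to n! so that the sum is an exponential. The growth in t is harmless, as
  the bound serves on bounded time intervals.\<close>

lemma propagator_l1:
  assumes "finite F"
  shows "(\<Sum>x\<in>F. norm (propagator t x)) \<le> \<bar>t\<bar> * exp (20 * t\<^sup>2)"
proof -
  define c where "c = (\<lambda>n. (- 1) ^ n / fact (2 * n + 1) * t ^ (2 * n + 1))"
  define d where "d = (\<lambda>n. \<bar>t\<bar> * (inverse (fact n) * (20 * t\<^sup>2) ^ n))"
  have P: "(2 * pi) ^ 5 > 0" by simp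
  have d: "d sums (\<bar>t\<bar> * exp (20 * t\<^sup>2))"
    using sums_mult[OF exp_converges[of "20 * t\<^sup>2"], of "\<bar>t\<bar>"] by (simp add: d_def)
  have cd: "\<bar>c n\<bar> * 20 ^ n \<le> d n" for n
  proof -
    have "\<bar>c n\<bar> * 20 ^ n = (\<bar>t\<bar> * (20 * t\<^sup>2) ^ n) * (1 / fact (2 * n + 1))"
      by (simp add: c_def abs_mult power_abs power_mult power_mult_distrib power_even_abs)
    also have "\<dots> \<le> (\<bar>t\<bar> * (20 * t\<^sup>2) ^ n) * (1 / fact n)"
      by (intro mult_left_mono divide_left_mono fact_mono) auto
    finally show ?thesis by (simp add: d_def divide_inverse mult_ac)
  qed
  let ?f = "\<lambda>x n \<xi>. indicator cube \<xi> *\<^sub>R (of_real (c n) * (character x \<xi> * of_real ((omega \<xi>)\<^sup>2 ^ n)))"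
  have f_int: "integrable lborel (?f x n)" for x n
    using set_integrable_mult_right[OF set_integrable_omega_power] unfolding set_integrable_def by blast
  have om: "(omega \<xi>)\<^sup>2 ^ n \<le> 20 ^ n" for \<xi> n by (intro power_mono omega_square_le) simp
  have f_norm: "norm (?f x n \<xi>) \<le> indicator cube \<xi> *\<^sub>R d n" for x n \<xi>
  proof -
    have "\<bar>c n\<bar> * (omega \<xi>)\<^sup>2 ^ n \<le> \<bar>c n\<bar> * 20 ^ n" using om by (intro mult_left_mono) auto
    then have "\<bar>c n\<bar> * (omega \<xi>)\<^sup>2 ^ n \<le> d n" using cd[of n] by linarith
    then show ?thesis by (simp add: norm_mult norm_power indicator_def)
  qed
  have f_summable: "summable (\<lambda>n. norm (?f x n \<xi>))" for x \<xi>
    by (rule summable_comparison_test'[OF summable_scaleR_right[OF sums_summable[OF d]], of 0]) (use f_norm in simp)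
  have G: "propagator t x = 1 / (2 * of_real pi) ^ 5 * (\<Sum>n. of_real (c n) * omega_coeff n x)"
    and sm: "summable (\<lambda>n. norm (of_real (c n) * omega_coeff n x))" for x
  proof -
    have "(\<integral>\<xi>. norm (?f x n \<xi>) \<partial>lborel) \<le> (2 * pi) ^ 5 * d n" for n
    proof -
      have "(\<integral>\<xi>. norm (?f x n \<xi>) \<partial>lborel) \<le> (\<integral>\<xi>. indicator cube \<xi> *\<^sub>R (d n * 1) \<partial>lborel)"
        using set_integrable_cube[of "\<lambda>_. d n" "\<bar>d n\<bar>"] f_norm[where x = x and n = n]
        by (intro integral_mono integrable_norm f_int) (simp_all add: set_integrable_def)
      also have "\<dots> = d n * (2 * pi) ^ 5"
        unfolding set_lebesgue_integral_def[symmetric] set_integral_mult_right measure_cube ..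
      finally show ?thesis by (simp only: mult.commute)
    qed
    then have ns: "summable (\<lambda>n. \<integral>\<xi>. norm (?f x n \<xi>) \<partial>lborel)"
      by (intro summable_comparison_test'[OF summable_mult[OF sums_summable[OF d], of "(2 * pi) ^ 5"], of 0]) simp
    have fi: "(\<integral>\<xi>. ?f x n \<xi> \<partial>lborel) = of_real (c n) * omega_coeff n x" for n
      unfolding omega_coeff_def set_lebesgue_integral_def[symmetric] set_integral_mult_right ..
    show "summable (\<lambda>n. norm (of_real (c n) * omega_coeff n x))"
      unfolding fi[symmetric]
      by (rule summable_comparison_test'[OF ns, of 0], rule order_trans[OF eq_refl[OF abs_norm_cancel[folded real_norm_def]] integral_norm_bound])
    have "(LINT \<xi>:cube|lborel. character x \<xi> * multiplier t \<xi>) = (\<integral>\<xi>. (\<Sum>n. ?f x n \<xi>) \<partial>lborel)"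
      unfolding set_lebesgue_integral_def
    proof (rule integral_cong_AE)
      show "(\<lambda>\<xi>. \<Sum>n. ?f x n \<xi>) \<in> borel_measurable lborel" using f_int by measurable
      \<comment> \<open>At \<omega> = 0 the series has the value t but the quotient is 0 by the
        convention on division, so equality is claimed almost everywhere.\<close>
      show "AE \<xi> in lborel. indicator cube \<xi> *\<^sub>R (character x \<xi> * multiplier t \<xi>) = (\<Sum>n. ?f x n \<xi>)"
        using AE_coords_nonzero
      proof eventually_elim
        case (elim \<xi>)
        show ?case
        proof (cases "\<xi> \<in> cube")
          case True
          define w where "w = omega \<xi>"
          have w: "w > 0" using omega_pos[OF True elim] by (simp add: w_def)
          have "(\<lambda>n. (- 1) ^ n / fact (2 * n + 1) * (t * w) ^ (2 * n + 1)) sums sin (t * w)" by (rule sin_paired)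
          from sums_divide[OF this, of w] have "(\<lambda>n. c n * w\<^sup>2 ^ n) sums (sin (t * w) / w)"
            using w by (simp add: c_def power_mult_distrib power_mult[symmetric] mult_ac)
          then have "(\<lambda>n. of_real (c n * w\<^sup>2 ^ n) :: complex) sums of_real (sin (t * w) / w)" by (rule sums_of_real)
          from sums_mult[OF this, of "character x \<xi>"]
          have "(\<lambda>n. ?f x n \<xi>) sums (character x \<xi> * multiplier t \<xi>)"
            using True by (simp add: multiplier_def w_def mult_ac)
          then show ?thesis using True by (simp add: sums_unique)
        qed simp
      qed
    qed measurable
    also have "\<dots> = (\<Sum>n. \<integral>\<xi>. ?f x n \<xi> \<partial>lborel)"
      by (rule integral_suminf[OF f_int _ ns]) (use f_summable in simp)
    finally show "propagator t x = 1 / (2 * of_real pi) ^ 5 * (\<Sum>n. of_real (c n) * omega_coeff n x)"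
      unfolding propagator_eq fi by simp
  qed
  have "(\<Sum>x\<in>F. norm (propagator t x)) \<le> (\<Sum>x\<in>F. (\<Sum>n. norm (of_real (c n) * omega_coeff n x)) / (2 * pi) ^ 5)"
  proof (rule sum_mono)
    fix x
    have "norm (propagator t x) = norm (\<Sum>n. of_real (c n) * omega_coeff n x) / (2 * pi) ^ 5"
      unfolding G by (simp add: norm_mult norm_divide norm_power power_mult_distrib)
    also have "\<dots> \<le> (\<Sum>n. norm (of_real (c n) * omega_coeff n x)) / (2 * pi) ^ 5"
      by (intro divide_right_mono summable_norm sm) simp
    finally show "norm (propagator t x) \<le> (\<Sum>n. norm (of_real (c n) * omega_coeff n x)) / (2 * pi) ^ 5" .
  qed
  also have "\<dots> = (\<Sum>n. \<Sum>x\<in>F. norm (of_real (c n) * omega_coeff n x)) / (2 * pi) ^ 5"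
    unfolding sum_divide_distrib[symmetric] by (subst suminf_sum) (auto intro: sm)
  also have "\<dots> \<le> (\<Sum>n. (2 * pi) ^ 5 * d n) / (2 * pi) ^ 5"
  proof (intro divide_right_mono suminf_le)
    fix n
    have "(\<Sum>x\<in>F. norm (of_real (c n) * omega_coeff n x)) = \<bar>c n\<bar> * (\<Sum>x\<in>F. norm (omega_coeff n x))"
      by (simp add: norm_mult sum_distrib_left)
    also have "\<dots> \<le> \<bar>c n\<bar> * ((2 * pi) ^ 5 * 20 ^ n)" by (intro mult_left_mono omega_coeff_l1 assms) simp
    also have "\<dots> \<le> (2 * pi) ^ 5 * d n" using mult_left_mono[OF cd[of n], of "(2 * pi) ^ 5"] by (simp add: mult_ac)
    finally show "(\<Sum>x\<in>F. norm (of_real (c n) * omega_coeff n x)) \<le> (2 * pi) ^ 5 * d n" .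
  qed (auto intro!: summable_sum sm summable_mult sums_summable[OF d])
  also have "\<dots> = \<bar>t\<bar> * exp (20 * t\<^sup>2)"
    using P by (subst suminf_mult[OF sums_summable[OF d]]) (simp add: sums_unique[OF d, symmetric])
  finally show ?thesis .
qed

lemma measurable_propagator [measurable]: "(\<lambda>t. propagator t x) \<in> borel_measurable borel"
proof -
  have "(\<lambda>t. \<integral>\<xi>. indicator cube \<xi> *\<^sub>R (character x \<xi> * multiplier t \<xi>) \<partial>lborel) \<in> borel_measurable borel"
    unfolding multiplier_def by measurable
  then show ?thesis unfolding propagator_eq set_lebesgue_integral_def by measurable
qed

section \<open>Convolutions and the nonlinearity\<close>

text \<open>Bounding all finite partial sums carries summability along with the norm bound.\<close>

definition l1_le :: "real \<Rightarrow> ('i \<Rightarrow> complex) \<Rightarrow> bool" where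
  "l1_le B w \<longleftrightarrow> (\<forall>F. finite F \<longrightarrow> (\<Sum>x\<in>F. norm (w x)) \<le> B)"

text \<open>For B >= 0 this is the l2 bound by duality, tested on finitely supported c. As a family
  of conditions on finite linear combinations it passes to sums, integrals and pointwise
  limits.\<close>

definition l2_le :: "real \<Rightarrow> ('i \<Rightarrow> complex) \<Rightarrow> bool" where
  "l2_le B w \<longleftrightarrow> (\<forall>F c. finite F \<longrightarrow> norm (\<Sum>x\<in>F. c x * w x) \<le> B * sqrt (\<Sum>x\<in>F. (norm (c x))\<^sup>2))"

lemma l1_leD: "l1_le B w \<Longrightarrow> finite F \<Longrightarrow> (\<Sum>x\<in>F. norm (w x)) \<le> B"
  by (simp add: l1_le_def)

lemma l1_le_mult:
  assumes "l1_le B w" "\<And>x. norm (h x) \<le> A * norm (w x)" "A \<ge> 0"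
  shows "l1_le (A * B) h"
  unfolding l1_le_def
proof (intro allI impI)
  fix F :: "'a set" assume F: "finite F"
  have "(\<Sum>x\<in>F. norm (h x)) \<le> (\<Sum>x\<in>F. A * norm (w x))" by (intro sum_mono assms)
  also have "\<dots> = A * (\<Sum>x\<in>F. norm (w x))" by (simp add: sum_distrib_left)
  also have "\<dots> \<le> A * B" using l1_leD[OF assms(1) F] assms(3) by (rule mult_left_mono)
  finally show "(\<Sum>x\<in>F. norm (h x)) \<le> A * B" .
qed

lemma l1_le_infsum:
  assumes "l1_le B w"
  shows "w summable_on UNIV" "norm (infsum w UNIV) \<le> B" "(\<lambda>x. norm (w x)) summable_on UNIV"
proof -
  show a: "(\<lambda>x. norm (w x)) summable_on UNIV"
    using l1_leD[OF assms] by (intro nonneg_bdd_above_summable_on) (auto intro!: bdd_aboveI[of _ B])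
  then show "w summable_on UNIV" by (rule abs_summable_summable)
  have "norm (infsum w UNIV) \<le> infsum (\<lambda>x. norm (w x)) UNIV" by (rule norm_infsum_bound[OF a])
  also have "\<dots> \<le> B" using l1_leD[OF assms] by (intro infsum_le_finite_sums a) auto
  finally show "norm (infsum w UNIV) \<le> B" .
qed

lemma l2_leD: "l2_le B w \<Longrightarrow> finite F \<Longrightarrow> norm (\<Sum>x\<in>F. c x * w x) \<le> B * sqrt (\<Sum>x\<in>F. (norm (c x))\<^sup>2)"
  by (simp add: l2_le_def)

text \<open>Back from the dual form to the norm, by testing with c = conjugate of w and cancelling
  one factor sqrt S.\<close>

lemma l2_le_sum_squares:
  assumes "l2_le B w" "finite F" "B \<ge> 0"
  shows "(\<Sum>x\<in>F. (norm (w x))\<^sup>2) \<le> B\<^sup>2"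
proof -
  define S where "S = (\<Sum>x\<in>F. (norm (w x))\<^sup>2)"
  have S: "S \<ge> 0" by (simp add: S_def sum_nonneg)
  have "(\<Sum>x\<in>F. cnj (w x) * w x) = of_real S"
    unfolding S_def of_real_sum complex_norm_square by (simp add: mult.commute)
  from l2_leD[OF assms(1,2), of "\<lambda>x. cnj (w x)", unfolded this complex_mod_cnj]
  have "S \<le> B * sqrt S" using S unfolding S_def[symmetric] norm_of_real by simp
  then have "sqrt S * sqrt S \<le> B * sqrt S" using S by simp
  then have "sqrt S \<le> B"
    using assms(3) S mult_right_le_imp_le[of "sqrt S" "sqrt S" B] by (cases "S = 0") auto
  then show ?thesis using S unfolding S_def[symmetric] by (metis abs_of_nonneg real_sqrt_le_iff real_sqrt_abs assms(3))
qed

lemma has_sum_finite_sum: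
  fixes f :: "'i \<Rightarrow> 'a \<Rightarrow> 'b::topological_comm_monoid_add"
  assumes "finite F" "\<And>i. (f i has_sum S i) A"
  shows "((\<lambda>y. \<Sum>i\<in>F. f i y) has_sum (\<Sum>i\<in>F. S i)) A"
  using assms(1) by induction (auto intro!: has_sum_add assms(2))

lemma conv_bounded:
  assumes "\<And>x. norm (G x) \<le> A" "l1_le B w" "A \<ge> 0"
  shows "convolvable G w" "norm (conv G w x) \<le> A * B"
proof -
  have "l1_le (A * B) (\<lambda>y. G (x - y) * w y)" for x
    by (rule l1_le_mult[OF assms(2)]) (auto simp: norm_mult intro!: mult_right_mono assms)
  note s = l1_le_infsum[OF this]
  show "convolvable G w" unfolding convolvable_def using s by blast
  show "norm (conv G w x) \<le> A * B" unfolding conv_def by (rule s)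
qed

lemma conv_l1_bounded:
  assumes "l1_le A G" "\<And>y. norm (w y) \<le> B" "B \<ge> 0"
  shows "convolvable G w" "norm (conv G w x) \<le> A * B"
proof -
  have "l1_le (B * A) (\<lambda>y. G (x - y) * w y)" for x
  proof (rule l1_le_mult[of A "\<lambda>y. G (x - y)"])
    show "l1_le A (\<lambda>y. G (x - y))" unfolding l1_le_def
    proof (intro allI impI)
      fix F :: "lattice5 set" assume F: "finite F"
      have "(\<Sum>y\<in>F. norm (G (x - y))) = (\<Sum>z\<in>(\<lambda>y. x - y) ` F. norm (G z))"
        by (subst sum.reindex) (auto simp: inj_on_def)
      also have "\<dots> \<le> A" using F by (intro l1_leD[OF assms(1)]) simp
      finally show "(\<Sum>y\<in>F. norm (G (x - y))) \<le> A" .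
    qed
    show "norm (G (x - y) * w y) \<le> B * norm (G (x - y))" for y
      unfolding norm_mult mult.commute[of "norm (G _)"] by (intro mult_right_mono assms) simp
  qed (rule assms)
  note s = l1_le_infsum[OF this]
  show "convolvable G w" unfolding convolvable_def using s by blast
  show "norm (conv G w x) \<le> A * B" unfolding conv_def mult.commute[of A] by (rule s)
qed

text \<open>Young's inequality from l2 and l1 to l2: for fixed y the pairing with c is a pairing of
  G with a translate of c, which has the same l2 norm, and then |w y| is summed.\<close>

lemma conv_l2:
  assumes "l2_le A G" "l1_le B w" "A \<ge> 0"
  shows "l2_le (A * B) (conv G w)"
  unfolding l2_le_def
proof (intro allI impI)
  fix F :: "lattice5 set" and c :: "lattice5 \<Rightarrow> complex" assume F: "finite F"
  let ?n = "sqrt (\<Sum>x\<in>F. (norm (c x))\<^sup>2)"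
  have n: "?n \<ge> 0" by (simp add: sum_nonneg)
  have G: "norm (G x) \<le> A" for x using l2_leD[OF assms(1), of "{x}" "\<lambda>_. 1"] by simp
  have sm: "(\<lambda>y. G (x - y) * w y) summable_on UNIV" for x
    using conv_bounded(1)[of G A B w, OF G assms(2,3)] unfolding convolvable_def by blast
  have hs: "((\<lambda>y. \<Sum>x\<in>F. c x * (G (x - y) * w y)) has_sum (\<Sum>x\<in>F. c x * conv G w x)) UNIV"
    unfolding conv_def using F sm by (intro has_sum_finite_sum has_sum_cmult_right has_sum_infsum)
  have inner: "norm (\<Sum>x\<in>F. c x * (G (x - y) * w y)) \<le> (A * ?n) * norm (w y)" for y
  proof -
    have "(\<Sum>x\<in>F. c x * (G (x - y) * w y)) = (\<Sum>x\<in>F. c x * G (x - y)) * w y"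
      by (simp add: sum_distrib_right mult.assoc)
    also have "(\<Sum>x\<in>F. c x * G (x - y)) = (\<Sum>z\<in>(\<lambda>x. x - y) ` F. c (z + y) * G z)"
      by (subst sum.reindex) (auto simp: inj_on_def)
    also have "norm (\<dots> * w y) \<le> (A * sqrt (\<Sum>z\<in>(\<lambda>x. x - y) ` F. (norm (c (z + y)))\<^sup>2)) * norm (w y)"
      unfolding norm_mult using F by (intro mult_right_mono l2_leD[OF assms(1)]) auto
    also have "(\<Sum>z\<in>(\<lambda>x. x - y) ` F. (norm (c (z + y)))\<^sup>2) = (\<Sum>x\<in>F. (norm (c x))\<^sup>2)"
      by (subst sum.reindex) (auto simp: inj_on_def)
    finally show ?thesis .
  qed
  have "l1_le ((A * ?n) * B) (\<lambda>y. \<Sum>x\<in>F. c x * (G (x - y) * w y))"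
    using assms(3) n by (intro l1_le_mult[OF assms(2) inner]) auto
  from l1_le_infsum(2)[OF this] infsumI[OF hs]
  show "norm (\<Sum>x\<in>F. c x * conv G w x) \<le> A * B * ?n" by (simp add: mult_ac)
qed

lemma conv_diff:
  assumes "convolvable G v" "convolvable G w"
  shows "conv G v x - conv G w x = conv G (\<lambda>y. v y - w y) x"
proof -
  have v: "(\<lambda>y. G (x - y) * v y) summable_on UNIV" and w: "(\<lambda>y. - (G (x - y) * w y)) summable_on UNIV"
    using assms unfolding convolvable_def by (auto simp: summable_on_uminus)
  have "(\<Sum>\<^sub>\<infinity>y. G (x - y) * v y + - (G (x - y) * w y)) = conv G v x - conv G w x"
    unfolding conv_def infsum_add[OF v w] infsum_uminus by simp
  then show ?thesis by (simp add: conv_def right_diff_distrib)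
qed

section \<open>Estimates for the nonlinearity\<close>

lemma norm_nonlinearity: "k > 1 \<Longrightarrow> norm (nonlinearity k v x) = norm (v x) powr k"
  unfolding nonlinearity_def norm_mult norm_of_real
  by (cases "v x = 0") (auto simp: powr_diff)

text \<open>By the mean value theorem the difference is (a - b) (k - 1) z^(k-2) with b < z < a; the
  extra factor b raises z^(k-2) to at most a^(k-1).\<close>

lemma powr_diff_mult_le:
  fixes a b k :: real
  assumes "0 \<le> b" "b \<le> a" "k \<ge> 3"
  shows "(a powr (k - 1) - b powr (k - 1)) * b \<le> (k - 1) * a powr (k - 1) * (a - b)"
proof (cases "b = 0 \<or> a = b")
  case True
  then show ?thesis using assms by auto
next
  case False
  then have ab: "0 < b" "b < a" using assms by auto
  have "\<exists>z>b. z < a \<and> a powr (k - 1) - b powr (k - 1) = (a - b) * ((k - 1) * z powr (k - 1 - 1))"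
    by (rule MVT2[OF ab(2)]) (use ab in \<open>auto intro!: derivative_eq_intros\<close>)
  then obtain z where z: "b < z" "z < a" "a powr (k - 1) - b powr (k - 1) = (a - b) * ((k - 1) * z powr (k - 2))"
    by auto
  have "z powr (k - 2) * b \<le> a powr (k - 2) * a" using z ab assms by (intro mult_mono powr_mono2) auto
  also have "\<dots> = a powr (k - 1)" using ab powr_add[of a "k - 2" 1] by simp
  finally have "(a - b) * ((k - 1) * (z powr (k - 2) * b)) \<le> (a - b) * ((k - 1) * a powr (k - 1))"
    using ab assms by (intro mult_left_mono) auto
  then show ?thesis unfolding z(3) by (simp add: mult_ac)
qed

text \<open>Splits the difference for |b| <= |a| into |a|^(k-1) (a - b) plus (|a|^(k-1) - |b|^(k-1))
  b; the two parts contribute 1 and k - 1 to the constant.\<close>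

lemma nonlinearity_lipschitz:
  assumes "k \<ge> 3"
  shows "norm (nonlinearity k v x - nonlinearity k w x) \<le>
    k * max (norm (v x)) (norm (w x)) powr (k - 1) * norm (v x - w x)"
proof -
  have main: "norm (of_real (norm a powr (k - 1)) * a - of_real (norm b powr (k - 1)) * b) \<le> k * norm a powr (k - 1) * norm (a - b)"
    if ab: "norm b \<le> norm a" for a b :: complex
  proof -
    have "of_real (norm a powr (k - 1)) * a - of_real (norm b powr (k - 1)) * b =
      of_real (norm a powr (k - 1)) * (a - b) + of_real (norm a powr (k - 1) - norm b powr (k - 1)) * b"
      by (simp add: algebra_simps)
    also have "norm \<dots> \<le> norm a powr (k - 1) * norm (a - b) + (norm a powr (k - 1) - norm b powr (k - 1)) * norm b"
    proof -
      have "norm b powr (k - 1) \<le> norm a powr (k - 1)" using ab assms by (intro powr_mono2) auto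
      then have "norm (of_real (norm a powr (k - 1) - norm b powr (k - 1)) * b) = (norm a powr (k - 1) - norm b powr (k - 1)) * norm b"
        unfolding norm_mult norm_of_real by simp
      moreover have "norm (of_real (norm a powr (k - 1)) * (a - b)) = norm a powr (k - 1) * norm (a - b)"
        unfolding norm_mult norm_of_real by simp
      ultimately show ?thesis
        using norm_triangle_ineq[of "of_real (norm a powr (k - 1)) * (a - b)" "of_real (norm a powr (k - 1) - norm b powr (k - 1)) * b"]
        by linarith
    qed
    also have "(norm a powr (k - 1) - norm b powr (k - 1)) * norm b \<le> (k - 1) * norm a powr (k - 1) * (norm a - norm b)"
      using ab assms by (intro powr_diff_mult_le) auto
    also have "\<dots> \<le> (k - 1) * norm a powr (k - 1) * norm (a - b)"
      using assms by (intro mult_left_mono norm_triangle_ineq2) auto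
    finally show ?thesis by (simp add: algebra_simps)
  qed
  show ?thesis
  proof (cases "norm (w x) \<le> norm (v x)")
    case True
    then show ?thesis using main[OF True] by (simp add: nonlinearity_def max_absorb1)
  next
    case False
    then show ?thesis using main[of "v x" "w x"] by (simp add: nonlinearity_def max_absorb2 norm_minus_commute)
  qed
qed

text \<open>For |v| <= 1 and k >= 3, |v|^k <= |v| |v|^2: one factor is measured in the sup norm and
  so carries the time decay, the other two in l2.\<close>

lemma nonlinearity_l1:
  assumes k: "k \<ge> 3" and d: "\<And>x. norm (v x) \<le> D" "D \<le> 1" "D \<ge> 0" and l2: "l2_le M v" "M \<ge> 0"
  shows "l1_le (D * M\<^sup>2) (nonlinearity k v)"
proof -
  have "l1_le (M\<^sup>2) (\<lambda>x. of_real ((norm (v x))\<^sup>2))"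
    unfolding l1_le_def norm_of_real using l2_le_sum_squares[OF l2(1) _ l2(2)] by simp
  then show ?thesis
  proof (rule l1_le_mult)
    show "norm (nonlinearity k v x) \<le> D * norm (complex_of_real ((norm (v x))\<^sup>2))" for x
    proof -
      have "norm (nonlinearity k v x) = norm (v x) powr k" using k by (intro norm_nonlinearity) simp
      also have "\<dots> \<le> norm (v x) powr 3"
        using k d(1)[of x] d(2) by (intro powr_mono') auto
      also have "\<dots> = norm (v x) * (norm (v x))\<^sup>2" by (cases "v x = 0") (auto simp: power3_eq_cube power2_eq_square powr_numeral)
      also have "\<dots> \<le> D * (norm (v x))\<^sup>2" by (intro mult_right_mono d) simp
      finally show ?thesis unfolding norm_of_real by simp
    qed
  qed (rule d)
qed

text \<open>Two of the factors supply the summable weight |v|^2 + |w|^2, so the sup norm of the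
  difference is enough to control it in l1.\<close>

lemma nonlinearity_diff_l1:
  assumes k: "k \<ge> 3" and v: "\<And>x. norm (v x) \<le> 1" "l2_le M v" and w: "\<And>x. norm (w x) \<le> 1" "l2_le M w"
    and M: "M \<ge> 0" and \<delta>: "\<And>x. norm (v x - w x) \<le> \<delta>"
  shows "l1_le (2 * k * M\<^sup>2 * \<delta>) (\<lambda>x. nonlinearity k v x - nonlinearity k w x)"
proof -
  have \<delta>0: "\<delta> \<ge> 0" using \<delta>[of undefined] norm_ge_zero order_trans by blast
  have base: "l1_le (2 * M\<^sup>2) (\<lambda>x. of_real ((norm (v x))\<^sup>2 + (norm (w x))\<^sup>2))"
    unfolding l1_le_def
  proof (intro allI impI)
    fix F :: "lattice5 set" assume F: "finite F"
    have "(\<Sum>x\<in>F. norm (complex_of_real ((norm (v x))\<^sup>2 + (norm (w x))\<^sup>2))) = (\<Sum>x\<in>F. (norm (v x))\<^sup>2) + (\<Sum>x\<in>F. (norm (w x))\<^sup>2)"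
      unfolding norm_of_real by (simp add: sum.distrib)
    also have "\<dots> \<le> M\<^sup>2 + M\<^sup>2" by (intro add_mono l2_le_sum_squares v w M F)
    finally show "(\<Sum>x\<in>F. norm (complex_of_real ((norm (v x))\<^sup>2 + (norm (w x))\<^sup>2))) \<le> 2 * M\<^sup>2" by simp
  qed
  have "norm (nonlinearity k v x - nonlinearity k w x) \<le> (k * \<delta>) * norm (complex_of_real ((norm (v x))\<^sup>2 + (norm (w x))\<^sup>2))" for x
  proof -
    let ?m = "max (norm (v x)) (norm (w x))"
    have "?m powr (k - 1) \<le> ?m powr 2" using k v(1)[of x] w(1)[of x] by (intro powr_mono') (auto simp: le_max_iff_disj)
    also have "\<dots> = ?m\<^sup>2" by (simp add: le_max_iff_disj)
    also have "\<dots> \<le> (norm (v x))\<^sup>2 + (norm (w x))\<^sup>2" by (simp add: max_def)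
    finally have m: "?m powr (k - 1) \<le> (norm (v x))\<^sup>2 + (norm (w x))\<^sup>2" .
    have "norm (nonlinearity k v x - nonlinearity k w x) \<le> k * ?m powr (k - 1) * norm (v x - w x)"
      by (rule nonlinearity_lipschitz[OF k])
    also have "\<dots> \<le> k * ((norm (v x))\<^sup>2 + (norm (w x))\<^sup>2) * \<delta>"
      using k by (intro mult_mono mult_left_mono m \<delta>) auto
    finally show ?thesis unfolding norm_of_real by (simp add: mult_ac)
  qed
  from l1_le_mult[OF base this]
  have "l1_le ((k * \<delta>) * (2 * M\<^sup>2)) (\<lambda>x. nonlinearity k v x - nonlinearity k w x)"
    using k \<delta>0 by simp
  then show ?thesis by (simp add: mult_ac)
qed

text \<open>An unordered sum is the limit along finite sets; an enumeration of the index set gives a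
  sequence of finite sets cofinal in that filter, and sequential limits preserve
  measurability.\<close>

lemma borel_measurable_infsum:
  fixes h :: "'i::countable \<Rightarrow> 'a \<Rightarrow> complex"
  assumes "\<And>i. h i \<in> borel_measurable M" "\<And>\<omega>. \<omega> \<in> space M \<Longrightarrow> (\<lambda>i. h i \<omega>) summable_on UNIV"
  shows "(\<lambda>\<omega>. \<Sum>\<^sub>\<infinity>i. h i \<omega>) \<in> borel_measurable M"
proof -
  define F where "F = (\<lambda>n. {i::'i. to_nat i < n})"
  have fin: "finite (F n)" for n
    using finite_vimageI[OF finite_lessThan[of n] inj_to_nat] by (simp add: F_def vimage_def)
  have F: "filterlim F (finite_subsets_at_top UNIV) sequentially"
    unfolding filterlim_finite_subsets_at_top
  proof (intro allI impI)
    fix X :: "'i set" assume "finite X \<and> X \<subseteq> UNIV"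
    then have X: "finite X" by simp
    have "X \<subseteq> F n" if "n \<ge> Suc (Max (to_nat ` X))" for n
    proof
      fix i assume "i \<in> X"
      then have "to_nat i \<le> Max (to_nat ` X)" using X by simp
      then show "i \<in> F n" using that by (simp add: F_def)
    qed
    then show "\<forall>\<^sub>F n in sequentially. finite (F n) \<and> X \<subseteq> F n \<and> F n \<subseteq> UNIV"
      using fin by (auto simp: eventually_sequentially)
  qed
  show ?thesis
  proof (rule borel_measurable_LIMSEQ_metric)
    show "(\<lambda>\<omega>. \<Sum>i\<in>F n. h i \<omega>) \<in> borel_measurable M" for n using assms(1) by measurable
    show "(\<lambda>n. \<Sum>i\<in>F n. h i \<omega>) \<longlonglongrightarrow> (\<Sum>\<^sub>\<infinity>i. h i \<omega>)" if "\<omega> \<in> space M" for \<omega>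
      using filterlim_compose[OF _ F] has_sum_infsum[OF assms(2)[OF that]] unfolding has_sum_def by blast
  qed
qed

section \<open>The decay weight and oriented time integrals\<close>

lemma decay_pos: "decay t > 0" by (simp add: decay_def)
lemma decay_nonneg: "decay t \<ge> 0" by (simp add: decay_def)

lemma decay_le_1: "decay t \<le> 1"
  unfolding decay_def using powr_mono2'[of "-11/6" 1 "1 + \<bar>t\<bar>"] by simp

lemma measurable_decay [measurable]: "decay \<in> borel_measurable borel"
  unfolding decay_def by measurable

lemma decay_integrable: "integrable lborel decay"
proof -
  define h where "h = (\<lambda>s::real. decay s * indicator {0..} s)"
  have "((\<lambda>x::real. - (6/5) * (1 + x) powr (-5/6)) \<longlongrightarrow> 0) at_top" by real_asymp
  moreover have "DERIV (\<lambda>x. - (6/5) * (1 + x) powr (-5/6)) x :> decay x" if "0 \<le> x" for x :: real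
    using that by (auto intro!: derivative_eq_intros simp: decay_def)
  ultimately have "(\<integral>\<^sup>+x. ennreal (decay x) * indicator {0..} x \<partial>lborel) = ennreal (0 - (- (6/5) * (1 + 0) powr (-5/6)))"
    by (intro nn_integral_FTC_atLeast[where F = "\<lambda>x. - (6/5) * (1 + x) powr (-5/6)"]) (simp_all only: decay_nonneg measurable_decay)
  then have "(\<integral>\<^sup>+x. ennreal (h x) \<partial>lborel) < \<infinity>"
    unfolding h_def by (simp add: ennreal_mult'' ennreal_indicator)
  then have h: "integrable lborel h"
    by (intro integrableI_nonneg) (auto simp: h_def decay_nonneg)
  \<comment> \<open>The half-line integral is reflected to negative times; the double value at 0
    only enlarges the majorant.\<close>
  have h': "integrable lborel (\<lambda>s. h s + h (0 + (-1) * s))"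
    by (intro Bochner_Integration.integrable_add h lborel_integrable_real_affine) auto
  show ?thesis
    by (rule Bochner_Integration.integrable_bound[OF h'])
       (auto simp: h_def indicator_def decay_def intro!: AE_I2)
qed

definition decay_mass :: real where
  "decay_mass = (\<integral>s. decay s \<partial>lborel)"

lemma decay_mass_nonneg: "decay_mass \<ge> 0"
  unfolding decay_mass_def by (intro Bochner_Integration.integral_nonneg) (simp add: decay_nonneg)

lemma decay_reflect: "integrable lborel (\<lambda>s. decay (t - s))" "(\<integral>s. decay (t - s) \<partial>lborel) = decay_mass"
proof -
  show "integrable lborel (\<lambda>s. decay (t - s))"
    using lborel_integrable_real_affine[OF decay_integrable, of "-1" t] by simp
  show "(\<integral>s. decay (t - s) \<partial>lborel) = decay_mass"
    unfolding decay_mass_def using lborel_integral_real_affine[of "-1" decay t] by simp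
qed

text \<open>One of |s| and |t - s| is at least |t| / 2, so one weight is at most 4 times the weight
  at t, with 2^(11/6) rounded up to 4. The other weight remains integrable, so the convolution
  decays at the rate of t.\<close>

lemma decay_conv_le: "decay (t - s) * decay s \<le> 4 * decay t * (decay s + decay (t - s))"
proof -
  have half: "decay r \<le> 4 * decay t" if "\<bar>t\<bar> / 2 \<le> \<bar>r\<bar>" for r
  proof -
    have "decay r \<le> ((1 + \<bar>t\<bar>) / 2) powr (-11/6)"
      unfolding decay_def using that by (intro powr_mono2') auto
    also have "\<dots> = (1 + \<bar>t\<bar>) powr (-11/6) / 2 powr (-11/6)" by (rule powr_divide)
    also have "\<dots> = 2 powr (11/6) * decay t"
      using powr_minus_divide[of "2::real" "11/6"] by (simp add: decay_def)
    also have "\<dots> \<le> 2 powr 2 * decay t" by (intro mult_right_mono powr_mono) (auto simp: decay_nonneg)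
    finally show ?thesis by simp
  qed
  have "\<bar>t\<bar> / 2 \<le> \<bar>s\<bar> \<or> \<bar>t\<bar> / 2 \<le> \<bar>t - s\<bar>" by linarith
  then show ?thesis
  proof
    assume "\<bar>t\<bar> / 2 \<le> \<bar>s\<bar>"
    from mult_left_mono[OF half[OF this] decay_nonneg[of "t - s"]]
    have "decay (t - s) * decay s \<le> 4 * decay t * decay (t - s)" by (simp add: mult_ac)
    then show ?thesis using mult_nonneg_nonneg[OF decay_nonneg[of t] decay_nonneg[of s]] by (simp add: algebra_simps)
  next
    assume "\<bar>t\<bar> / 2 \<le> \<bar>t - s\<bar>"
    from mult_right_mono[OF half[OF this] decay_nonneg[of s]]
    have "decay (t - s) * decay s \<le> 4 * decay t * decay s" .
    then show ?thesis using mult_nonneg_nonneg[OF decay_nonneg[of t] decay_nonneg[of "t - s"]] by (simp add: algebra_simps)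
  qed
qed

lemma decay_conv_integral:
  "integrable lborel (\<lambda>s. decay (t - s) * decay s)"
  "(\<integral>s. decay (t - s) * decay s \<partial>lborel) \<le> 8 * decay_mass * decay t"
proof -
  have i: "integrable lborel (\<lambda>s. 4 * decay t * (decay s + decay (t - s)))"
    by (intro integrable_mult_right Bochner_Integration.integrable_add decay_integrable decay_reflect)
  show j: "integrable lborel (\<lambda>s. decay (t - s) * decay s)"
    by (rule Bochner_Integration.integrable_bound[OF i])
       (use decay_conv_le in \<open>auto intro!: AE_I2 simp: decay_nonneg order_trans[OF _ abs_ge_self]\<close>)
  have "(\<integral>s. decay (t - s) * decay s \<partial>lborel) \<le> (\<integral>s. 4 * decay t * (decay s + decay (t - s)) \<partial>lborel)"
    by (intro integral_mono i j decay_conv_le)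
  also have "\<dots> = 4 * decay t * (decay_mass + decay_mass)"
    using decay_integrable decay_reflect[of t] by (simp add: decay_mass_def)
  finally show "(\<integral>s. decay (t - s) * decay s \<partial>lborel) \<le> 8 * decay_mass * decay t" by (simp add: mult_ac)
qed

text \<open>The signed indicator of the interval between 0 and t. It turns the oriented integral
  into one over the whole line with an integrand jointly measurable in t and s, for both signs of
  t.\<close>

definition orient :: "real \<Rightarrow> real \<Rightarrow> real" where
  "orient t s = (if 0 < s \<and> s < t then 1 else if t < s \<and> s < 0 then - 1 else 0)"

lemma abs_orient_le: "\<bar>orient t s\<bar> \<le> 1"
  by (simp add: orient_def)

lemma orient_zero: "s \<notin> closed_segment 0 t \<Longrightarrow> orient t s = 0"
  by (auto simp: orient_def closed_segment_eq_real_ivl)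

lemma measurable_orient [measurable]: "(\<lambda>p. orient (fst p) (snd p)) \<in> borel_measurable (borel \<Otimes>\<^sub>M borel)"
  unfolding orient_def by measurable

lemma measurable_orient2 [measurable]: "orient t \<in> borel_measurable borel"
  unfolding orient_def by measurable

lemma interval_orient:
  fixes f :: "real \<Rightarrow> complex"
  shows "(LBINT s=ereal 0..ereal t. f s) = (\<integral>s. orient t s *\<^sub>R f s \<partial>lborel)"
    and "interval_lebesgue_integrable lborel (ereal 0) (ereal t) f \<longleftrightarrow> integrable lborel (\<lambda>s. orient t s *\<^sub>R f s)"
proof -
  have e: "einterval 0 (ereal t) = {0<..<t}" "einterval (ereal t) 0 = {t<..<0}"
    by (auto simp: einterval_def)
  show "(LBINT s=ereal 0..ereal t. f s) = (\<integral>s. orient t s *\<^sub>R f s \<partial>lborel)"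
  proof (cases "0 \<le> t")
    case True
    then have "orient t s = indicator {0<..<t} s" for s by (auto simp: orient_def indicator_def)
    then show ?thesis using True
      by (simp add: interval_lebesgue_integral_def set_lebesgue_integral_def e)
  next
    case False
    then have "orient t s = - indicator {t<..<0} s" for s by (auto simp: orient_def indicator_def)
    then show ?thesis using False
      by (simp add: interval_lebesgue_integral_def set_lebesgue_integral_def e)
  qed
  show "interval_lebesgue_integrable lborel (ereal 0) (ereal t) f \<longleftrightarrow> integrable lborel (\<lambda>s. orient t s *\<^sub>R f s)"
  proof (cases "0 \<le> t")
    case True
    then have "orient t s = indicator {0<..<t} s" for s by (auto simp: orient_def indicator_def)
    then show ?thesis using True
      by (simp add: interval_lebesgue_integrable_def set_integrable_def e)
  next
    case False
    then have "orient t s = - indicator {t<..<0} s" for s by (auto simp: orient_def indicator_def)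
    then show ?thesis using False
      by (simp add: interval_lebesgue_integrable_def set_integrable_def e)
  qed
qed

section \<open>Existence and uniqueness\<close>

definition duhamel_map ::
    "real \<Rightarrow> (lattice5 \<Rightarrow> complex) \<Rightarrow> (real \<Rightarrow> lattice5 \<Rightarrow> complex) \<Rightarrow> real \<Rightarrow> lattice5 \<Rightarrow> complex" where
  "duhamel_map k f u t x = conv (propagator t) f x +
     (\<integral>s. orient t s *\<^sub>R conv (propagator (t - s)) (nonlinearity k (u s)) x \<partial>lborel)"

text \<open>The set on which the fixed point is sought. Measurability in time is included because
  the Duhamel integral is a Bochner integral.\<close>

definition admissible :: "real \<Rightarrow> (real \<Rightarrow> lattice5 \<Rightarrow> complex) \<Rightarrow> bool" where
  "admissible M u \<longleftrightarrow> (\<forall>x. (\<lambda>s. u s x) \<in> borel_measurable borel) \<and>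
     (\<forall>s x. norm (u s x) \<le> M * decay s) \<and> (\<forall>s. l2_le M (u s))"

lemma measurable_nonlinearity:
  assumes "(\<lambda>s. u s x) \<in> borel_measurable N"
  shows "(\<lambda>s. nonlinearity k (u s) x) \<in> borel_measurable N"
  unfolding nonlinearity_def using assms by measurable

section \<open>The contraction argument\<close>

text \<open>The first smallness condition grants the datum half of M, the second grants the other
  half to the Duhamel integral, and the third makes the contraction factor 1/2. M <= 1 ensures |u|
  <= 1, so that powers of |u| decrease in the exponent.\<close>

locale small_duhamel =
  fixes k C E M :: real and f :: "lattice5 \<Rightarrow> complex"
  assumes k: "k \<ge> 3" and C: "C > 0" and M: "0 < M" "M \<le> 1"
    and sup_bound: "\<And>t x. norm (propagator t x) \<le> C * decay t"
    and l2_bound: "\<And>t. l2_le C (propagator t)"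
    and f: "l1_le E f"
    and small: "C * E \<le> M / 2" "8 * C * decay_mass * M\<^sup>2 \<le> 1 / 2" "2 * k * C * decay_mass * M\<^sup>2 \<le> 1 / 2"
begin

abbreviation N where "N u s \<equiv> nonlinearity k (u s)"
abbreviation \<Phi> where "\<Phi> \<equiv> duhamel_map k f"

lemma decay_bound_nonneg: "C * decay t \<ge> 0"
  using C decay_nonneg[of t] by simp

lemma admissible_le_1:
  assumes "admissible M u"
  shows "norm (u s x) \<le> 1"
proof -
  have "norm (u s x) \<le> M * decay s" using assms by (simp add: admissible_def)
  also have "\<dots> \<le> 1 * 1" using M decay_le_1 decay_nonneg by (intro mult_mono) auto
  finally show ?thesis by simp
qed

lemma N_l1:
  assumes "admissible M u"
  shows "l1_le (M * decay s * M\<^sup>2) (N u s)"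
proof (rule nonlinearity_l1[OF k])
  show "norm (u s x) \<le> M * decay s" for x using assms by (simp add: admissible_def)
  show "M * decay s \<le> 1" using mult_mono[of M 1 "decay s" 1] M decay_le_1[of s] decay_nonneg[of s] by simp
  show "0 \<le> M * decay s" using M decay_nonneg[of s] by simp
  show "l2_le M (u s)" using assms by (simp add: admissible_def)
qed (use M in simp)

lemma conv_N:
  assumes "admissible M u"
  shows "convolvable (propagator t) (N u s)" "norm (conv (propagator t) (N u s) x) \<le> C * decay t * (M * decay s * M\<^sup>2)"
  by (rule conv_bounded[OF sup_bound N_l1[OF assms] decay_bound_nonneg])+

lemma measurable_conv_N:
  assumes "admissible M u"
  shows "(\<lambda>p. conv (propagator (fst p - snd p)) (N u (snd p)) x) \<in> borel_measurable (borel \<Otimes>\<^sub>M borel)"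
  unfolding conv_def
proof (rule borel_measurable_infsum)
  fix y
  have "(\<lambda>s. N u s y) \<in> borel_measurable borel"
    using assms by (intro measurable_nonlinearity) (simp add: admissible_def)
  from measurable_compose[OF measurable_snd this]
  have 1: "(\<lambda>p. N u (snd p) y) \<in> borel_measurable (borel \<Otimes>\<^sub>M borel)" .
  have "(\<lambda>p. fst p - snd p :: real) \<in> borel_measurable (borel \<Otimes>\<^sub>M borel)" by measurable
  from measurable_compose[OF this measurable_propagator[of "x - y"]]
  have 2: "(\<lambda>p. propagator (fst p - snd p) (x - y)) \<in> borel_measurable (borel \<Otimes>\<^sub>M borel)" .
  from 1 2 show "(\<lambda>p. propagator (fst p - snd p) (x - y) * N u (snd p) y) \<in> borel_measurable (borel \<Otimes>\<^sub>M borel)"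
    by measurable
next
  fix p
  show "(\<lambda>y. propagator (fst p - snd p) (x - y) * N u (snd p) y) summable_on UNIV"
    using conv_N(1)[OF assms] unfolding convolvable_def by blast
qed

lemma measurable_integrand:
  assumes "admissible M u"
  shows "(\<lambda>p. orient (fst p) (snd p) *\<^sub>R conv (propagator (fst p - snd p)) (N u (snd p)) x) \<in> borel_measurable (borel \<Otimes>\<^sub>M borel)"
  using measurable_conv_N[OF assms] by measurable

lemma measurable_integrand2:
  assumes "admissible M u"
  shows "(\<lambda>s. orient t s *\<^sub>R conv (propagator (t - s)) (N u s) x) \<in> borel_measurable borel"
  using measurable_compose[OF _ measurable_integrand[OF assms], of "\<lambda>s. (t, s)" borel] by simp

lemma integrand_bound:
  assumes "admissible M u"
  shows "norm (orient t s *\<^sub>R conv (propagator (t - s)) (N u s) x) \<le> C * M ^ 3 * (decay (t - s) * decay s)"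
proof -
  have "norm (orient t s *\<^sub>R conv (propagator (t - s)) (N u s) x) \<le> 1 * norm (conv (propagator (t - s)) (N u s) x)"
    unfolding norm_scaleR by (intro mult_right_mono abs_orient_le) simp
  also have "\<dots> \<le> C * decay (t - s) * (M * decay s * M\<^sup>2)" using conv_N(2)[OF assms] by simp
  also have "\<dots> = C * M ^ 3 * (decay (t - s) * decay s)" by (simp add: power3_eq_cube power2_eq_square)
  finally show ?thesis .
qed

lemma integrand_integrable:
  assumes "admissible M u"
  shows "integrable lborel (\<lambda>s. orient t s *\<^sub>R conv (propagator (t - s)) (N u s) x)"
proof (rule Bochner_Integration.integrable_bound)
  show "integrable lborel (\<lambda>s. C * M ^ 3 * (decay (t - s) * decay s))"
    by (intro integrable_mult_right decay_conv_integral)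
  show "(\<lambda>s. orient t s *\<^sub>R conv (propagator (t - s)) (N u s) x) \<in> borel_measurable lborel"
    using measurable_integrand2[OF assms] by simp
  show "AE s in lborel. norm (orient t s *\<^sub>R conv (propagator (t - s)) (N u s) x) \<le> norm (C * M ^ 3 * (decay (t - s) * decay s))"
    by (intro AE_I2 order_trans[OF integrand_bound[OF assms]]) (simp only: real_norm_def abs_ge_self)
qed

lemma conv_f: "convolvable (propagator t) f" "norm (conv (propagator t) f x) \<le> C * decay t * E"
  by (rule conv_bounded[OF sup_bound f decay_bound_nonneg])+

text \<open>The integrand is of size C M^3 decay (t - s) decay s in the sup norm, whose time
  integral reproduces the decay. In l2 it is of size C M^3 decay s, which is integrable and yields a
  bound constant in t.\<close>

lemma duhamel_map_admissible:
  assumes u: "admissible M u"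
  shows "admissible M (\<Phi> u)"
  unfolding admissible_def
proof (intro conjI allI)
  let ?I = "\<lambda>t x. \<integral>s. orient t s *\<^sub>R conv (propagator (t - s)) (N u s) x \<partial>lborel"
  show "(\<lambda>t. \<Phi> u t x) \<in> borel_measurable borel" for x
  proof -
    have "(\<lambda>t. propagator t (x - y) * f y) \<in> borel_measurable borel" for y by measurable
    then have "(\<lambda>t. conv (propagator t) f x) \<in> borel_measurable borel"
      unfolding conv_def using conv_f(1) by (intro borel_measurable_infsum) (auto simp: convolvable_def)
    moreover have "(\<lambda>t. ?I t x) \<in> borel_measurable borel"
    proof (rule lborel.borel_measurable_lebesgue_integral)
      have "sets (borel \<Otimes>\<^sub>M lborel :: (real \<times> real) measure) = sets (borel \<Otimes>\<^sub>M borel)"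
        by (intro sets_pair_measure_cong) auto
      then show "(\<lambda>(t, s). orient t s *\<^sub>R conv (propagator (t - s)) (N u s) x) \<in> borel_measurable (borel \<Otimes>\<^sub>M lborel)"
        using measurable_integrand[OF u, of x] by (simp add: case_prod_unfold cong: measurable_cong_sets)
    qed
    ultimately show ?thesis unfolding duhamel_map_def by measurable
  qed
  show "norm (\<Phi> u t x) \<le> M * decay t" for t x
  proof -
    have "norm (?I t x) \<le> (\<integral>s. C * M ^ 3 * (decay (t - s) * decay s) \<partial>lborel)"
      by (intro Bochner_Integration.integral_norm_bound_integral integrand_integrable u integrable_mult_right decay_conv_integral integrand_bound)
    also have "\<dots> = C * M ^ 3 * (\<integral>s. decay (t - s) * decay s \<partial>lborel)" by simp
    also have "\<dots> \<le> C * M ^ 3 * (8 * decay_mass * decay t)"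
      using C M by (intro mult_left_mono decay_conv_integral) auto
    also have "\<dots> = (8 * C * decay_mass * M\<^sup>2) * (M * decay t)" by (simp add: power3_eq_cube power2_eq_square)
    also have "\<dots> \<le> 1 / 2 * (M * decay t)" using M decay_nonneg[of t] by (intro mult_right_mono small) auto
    finally have 1: "norm (?I t x) \<le> 1 / 2 * (M * decay t)" .
    have "norm (conv (propagator t) f x) \<le> (C * E) * decay t" using conv_f(2)[of t x] by (simp add: mult_ac)
    also have "\<dots> \<le> M / 2 * decay t" by (intro mult_right_mono small decay_nonneg)
    finally show ?thesis using norm_triangle_ineq[of "conv (propagator t) f x" "?I t x"] 1
      unfolding duhamel_map_def by simp
  qed
  show "l2_le M (\<Phi> u t)" for t
    unfolding l2_le_def
  proof (intro allI impI)
    fix F :: "lattice5 set" and c :: "lattice5 \<Rightarrow> complex" assume F: "finite F"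
    let ?n = "sqrt (\<Sum>x\<in>F. (norm (c x))\<^sup>2)"
    have n: "?n \<ge> 0" by (simp add: sum_nonneg)
    have 1: "norm (\<Sum>x\<in>F. c x * conv (propagator t) f x) \<le> (C * E) * ?n"
      using C by (intro l2_leD[OF conv_l2[OF l2_bound f] F]) simp
    have int: "integrable lborel (\<lambda>s. c x * (orient t s *\<^sub>R conv (propagator (t - s)) (N u s) x))" for x
      by (intro integrable_mult_right integrand_integrable u)
    \<comment> \<open>In the dual form the pairing with c commutes with the time integral, so the l2
      estimate is needed only at each fixed s.\<close>
    have "(\<Sum>x\<in>F. c x * ?I t x) = (\<integral>s. (\<Sum>x\<in>F. c x * (orient t s *\<^sub>R conv (propagator (t - s)) (N u s) x)) \<partial>lborel)"
    proof -
      have "(\<Sum>x\<in>F. c x * ?I t x) = (\<Sum>x\<in>F. \<integral>s. c x * (orient t s *\<^sub>R conv (propagator (t - s)) (N u s) x) \<partial>lborel)"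
        by (simp only: integral_mult_right_zero)
      then show ?thesis by (rule trans) (rule Bochner_Integration.integral_sum[symmetric], rule int)
    qed
    also have "norm \<dots> \<le> (\<integral>s. C * M ^ 3 * ?n * decay s \<partial>lborel)"
    proof (intro Bochner_Integration.integral_norm_bound_integral Bochner_Integration.integrable_sum int integrable_mult_right decay_integrable)
      fix s
      have "(\<Sum>x\<in>F. c x * (orient t s *\<^sub>R conv (propagator (t - s)) (N u s) x)) = orient t s *\<^sub>R (\<Sum>x\<in>F. c x * conv (propagator (t - s)) (N u s) x)"
        by (simp add: scaleR_sum_right)
      also have "norm \<dots> \<le> 1 * norm (\<Sum>x\<in>F. c x * conv (propagator (t - s)) (N u s) x)"
        unfolding norm_scaleR by (intro mult_right_mono abs_orient_le) simp
      also have "\<dots> \<le> (C * (M * decay s * M\<^sup>2)) * ?n"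
        using C unfolding mult_1 by (intro l2_leD[OF conv_l2[OF l2_bound N_l1[OF u]] F]) simp
      finally show "norm (\<Sum>x\<in>F. c x * (orient t s *\<^sub>R conv (propagator (t - s)) (N u s) x)) \<le> C * M ^ 3 * ?n * decay s"
        by (simp add: power3_eq_cube power2_eq_square mult_ac)
    qed
    also have "\<dots> = (C * decay_mass * M\<^sup>2) * (M * ?n)"
      by (simp add: decay_mass_def power3_eq_cube power2_eq_square mult_ac)
    also have "\<dots> \<le> 1 / 2 * (M * ?n)"
    proof (intro mult_right_mono)
      have "0 \<le> C * decay_mass * M\<^sup>2" using C decay_mass_nonneg by simp
      then show "C * decay_mass * M\<^sup>2 \<le> 1 / 2" using small(2) by simp
    qed (use M n in simp)
    finally have 2: "norm (\<Sum>x\<in>F. c x * ?I t x) \<le> 1 / 2 * (M * ?n)" .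
    have "(C * E) * ?n \<le> M / 2 * ?n" using n by (intro mult_right_mono small)
    moreover have "(\<Sum>x\<in>F. c x * \<Phi> u t x) = (\<Sum>x\<in>F. c x * conv (propagator t) f x) + (\<Sum>x\<in>F. c x * ?I t x)"
      unfolding duhamel_map_def by (simp add: distrib_left sum.distrib)
    ultimately show "norm (\<Sum>x\<in>F. c x * \<Phi> u t x) \<le> M * ?n"
      using 1 2 norm_triangle_ineq[of "\<Sum>x\<in>F. c x * conv (propagator t) f x" "\<Sum>x\<in>F. c x * ?I t x"] by simp
  qed
qed

text \<open>The datum terms cancel. The difference of the nonlinearities is bounded in l1 uniformly
  in s, and the integrable weight decay (t - s) comes from the propagator alone, so \<delta> need
  not decay in time.\<close>

lemma duhamel_map_contraction:
  assumes u: "admissible M u" and v: "admissible M v" and \<delta>: "\<And>s x. norm (u s x - v s x) \<le> \<delta>"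
  shows "norm (\<Phi> u t x - \<Phi> v t x) \<le> \<delta> / 2"
proof -
  let ?g = "\<lambda>u s. orient t s *\<^sub>R conv (propagator (t - s)) (N u s) x"
  have \<delta>0: "\<delta> \<ge> 0" using \<delta>[of 0 0] norm_ge_zero order_trans by blast
  have diff: "\<Phi> u t x - \<Phi> v t x = (\<integral>s. ?g u s - ?g v s \<partial>lborel)"
    unfolding duhamel_map_def using integrand_integrable[OF u] integrand_integrable[OF v] by simp
  have "norm (\<integral>s. ?g u s - ?g v s \<partial>lborel) \<le> (\<integral>s. C * (2 * k * M\<^sup>2 * \<delta>) * decay (t - s) \<partial>lborel)"
  proof (intro Bochner_Integration.integral_norm_bound_integral Bochner_Integration.integrable_diff integrand_integrable u v integrable_mult_right decay_reflect)
    fix s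
    have l1: "l1_le (2 * k * M\<^sup>2 * \<delta>) (\<lambda>x. N u s x - N v s x)"
      using u v M \<delta> admissible_le_1[OF u] admissible_le_1[OF v]
      by (intro nonlinearity_diff_l1[OF k]) (auto simp: admissible_def)
    have "norm (?g u s - ?g v s) = \<bar>orient t s\<bar> * norm (conv (propagator (t - s)) (\<lambda>x. N u s x - N v s x) x)"
      unfolding scaleR_diff_right[symmetric] norm_scaleR conv_diff[OF conv_N(1)[OF u] conv_N(1)[OF v]] ..
    also have "\<dots> \<le> 1 * (C * decay (t - s) * (2 * k * M\<^sup>2 * \<delta>))"
      by (intro mult_mono abs_orient_le conv_bounded(2)[OF sup_bound l1 decay_bound_nonneg]) auto
    finally show "norm (?g u s - ?g v s) \<le> C * (2 * k * M\<^sup>2 * \<delta>) * decay (t - s)" by (simp add: mult_ac)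
  qed
  also have "\<dots> = C * (2 * k * M\<^sup>2 * \<delta>) * decay_mass"
    unfolding decay_reflect(2)[symmetric, of t] by (rule integral_mult_right_zero)
  also have "\<dots> = (2 * k * C * decay_mass * M\<^sup>2) * \<delta>" by (simp only: mult_ac)
  also have "\<dots> \<le> 1 / 2 * \<delta>" by (intro mult_right_mono small \<delta>0)
  finally show ?thesis unfolding diff by simp
qed

text \<open>Every clause is a closed condition on finitely many values at a fixed time, or is
  preserved by sequential limits of measurable functions.\<close>

lemma admissible_limit:
  assumes "\<And>n. admissible M (U n)" "\<And>s x. (\<lambda>n. U n s x) \<longlonglongrightarrow> u s x"
  shows "admissible M u"
  unfolding admissible_def
proof (intro conjI allI)
  show "(\<lambda>s. u s x) \<in> borel_measurable borel" for x
    by (rule borel_measurable_LIMSEQ_metric[of "\<lambda>n s. U n s x"]) (use assms in \<open>auto simp: admissible_def\<close>)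
  show "norm (u s x) \<le> M * decay s" for s x
    by (rule tendsto_upperbound[OF tendsto_norm[OF assms(2)]]) (use assms(1) in \<open>auto simp: admissible_def\<close>)
  show "l2_le M (u s)" for s
    unfolding l2_le_def
  proof (intro allI impI)
    fix F :: "lattice5 set" and c :: "lattice5 \<Rightarrow> complex" assume F: "finite F"
    have "(\<lambda>n. norm (\<Sum>x\<in>F. c x * U n s x)) \<longlonglongrightarrow> norm (\<Sum>x\<in>F. c x * u s x)"
      by (intro tendsto_intros assms)
    then show "norm (\<Sum>x\<in>F. c x * u s x) \<le> M * sqrt (\<Sum>x\<in>F. (norm (c x))\<^sup>2)"
      by (rule tendsto_upperbound) (use assms(1) F in \<open>auto simp: admissible_def l2_le_def\<close>)
  qed
qed

text \<open>Picard iterates from 0 are uniformly Cauchy in space and time. Completeness is used only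
  in the complex numbers, point by point, and the rate is recovered by passing to the limit in the
  Cauchy estimate.\<close>

lemma fixed_point: "\<exists>u. admissible M u \<and> \<Phi> u = u"
proof -
  define U where "U = (\<lambda>n. (\<Phi> ^^ n) (\<lambda>_ _. 0))"
  have U0: "U 0 = (\<lambda>_ _. 0)" and US: "U (Suc n) = \<Phi> (U n)" for n by (simp_all add: U_def)
  have adm: "admissible M (U n)" for n
  proof (induction n)
    case 0
    show ?case unfolding U0 admissible_def l2_le_def using M decay_nonneg by (auto intro!: mult_nonneg_nonneg sum_nonneg)
  next
    case (Suc n)
    then show ?case unfolding US by (rule duhamel_map_admissible)
  qed
  have cauchy: "norm (U (n + j) s x - U n s x) \<le> 2 * (1 / 2) ^ n" for n j s x
  proof (induction n arbitrary: j s x)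
    case 0
    show ?case using admissible_le_1[OF adm[of j], of s x] by (simp add: U0)
  next
    case (Suc n)
    have "norm (\<Phi> (U (n + j)) s x - \<Phi> (U n) s x) \<le> (2 * (1 / 2) ^ n) / 2"
      by (intro duhamel_map_contraction adm Suc.IH)
    then show ?case by (simp add: US)
  qed
  have lim: "\<exists>l. (\<lambda>n. U n s x) \<longlonglongrightarrow> l" for s x
  proof -
    have "Cauchy (\<lambda>n. U n s x)"
    proof (rule CauchyI')
      fix e :: real assume e: "e > 0"
      have "(\<lambda>n. 2 * (1 / 2 :: real) ^ n) \<longlonglongrightarrow> 2 * 0" by (intro tendsto_intros LIMSEQ_power_zero) simp
      then have "eventually (\<lambda>n. 2 * (1 / 2 :: real) ^ n < e) sequentially" using e by (intro order_tendstoD) auto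
      then obtain n0 where n0: "2 * (1 / 2 :: real) ^ n < e" if "n \<ge> n0" for n by (auto simp: eventually_sequentially)
      have "dist (U m s x) (U n s x) < e" if "m \<ge> n0" "n > m" for m n
        using cauchy[of m "n - m" s x] n0[OF that(1)] that(2) by (simp add: dist_norm norm_minus_commute)
      then show "\<exists>M. \<forall>m\<ge>M. \<forall>n>m. dist (U m s x) (U n s x) < e" by blast
    qed
    then show ?thesis using Cauchy_convergent unfolding convergent_def by blast
  qed
  define u where "u = (\<lambda>s x. lim (\<lambda>n. U n s x))"
  have u: "(\<lambda>n. U n s x) \<longlonglongrightarrow> u s x" for s x
    using lim[of s x] unfolding u_def by (simp add: convergent_def[symmetric] convergent_LIMSEQ_iff)
  have au: "admissible M u" by (rule admissible_limit[OF adm u])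
  have close: "norm (u s x - U n s x) \<le> 2 * (1 / 2) ^ n" for n s x
  proof (rule tendsto_upperbound)
    have "(\<lambda>j. U (n + j) s x) \<longlonglongrightarrow> u s x" using LIMSEQ_ignore_initial_segment[OF u, of n] by (simp add: add.commute)
    then show "(\<lambda>j. norm (U (n + j) s x - U n s x)) \<longlonglongrightarrow> norm (u s x - U n s x)" by (intro tendsto_intros)
  qed (use cauchy in auto)
  have "\<Phi> u t x = u t x" for t x
  proof (rule LIMSEQ_unique)
    have "(\<lambda>n. U (Suc n) t x - \<Phi> u t x) \<longlonglongrightarrow> 0"
    proof (rule Lim_null_comparison)
      show "\<forall>\<^sub>F n in sequentially. norm (U (Suc n) t x - \<Phi> u t x) \<le> (1 / 2) ^ n"
      proof (intro always_eventually allI)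
        fix n
        have "norm (\<Phi> u t x - \<Phi> (U n) t x) \<le> (2 * (1 / 2) ^ n) / 2"
          by (intro duhamel_map_contraction au adm close)
        then show "norm (U (Suc n) t x - \<Phi> u t x) \<le> (1 / 2) ^ n" by (simp add: US norm_minus_commute)
      qed
      show "(\<lambda>n. (1 / 2 :: real) ^ n) \<longlonglongrightarrow> 0" by (intro LIMSEQ_power_zero) simp
    qed
    from tendsto_add[OF this tendsto_const[of "\<Phi> u t x"]]
    show "(\<lambda>n. U (Suc n) t x) \<longlonglongrightarrow> \<Phi> u t x" by simp
    show "(\<lambda>n. U (Suc n) t x) \<longlonglongrightarrow> u t x" using u LIMSEQ_Suc by blast
  qed
  then have "\<Phi> u = u" by (intro ext)
  with au show ?thesis by blast
qed

lemma fixed_point_duhamel: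
  assumes "admissible M u" "\<Phi> u = u"
  shows "duhamel_solution k f u"
  unfolding duhamel_solution_def interval_orient
proof (intro allI conjI ballI)
  fix t x
  show "convolvable (propagator t) f" by (rule conv_f)
  show "convolvable (propagator (t - s)) (N u s)" for s by (rule conv_N[OF assms(1)])
  show "integrable lborel (\<lambda>s. orient t s *\<^sub>R conv (propagator (t - s)) (N u s) x)"
    by (rule integrand_integrable[OF assms(1)])
  show "u t x = conv (propagator t) f x + (\<integral>s. orient t s *\<^sub>R conv (propagator (t - s)) (N u s) x \<partial>lborel)"
    using fun_cong[OF fun_cong[OF assms(2)], of t x] unfolding duhamel_map_def by simp
qed

end

section \<open>Uniqueness\<close>

text \<open>The step that turns |s|^n / n! into |t|^(n+1) / (n + 1)! in the Gronwall iteration, for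
  either sign of t.\<close>

lemma abs_power_orient_integral:
  "integrable lborel (\<lambda>s. \<bar>orient t s\<bar> * \<bar>s\<bar> ^ n)"
  "(\<integral>s. \<bar>orient t s\<bar> * \<bar>s\<bar> ^ n \<partial>lborel) \<le> \<bar>t\<bar> ^ Suc n / Suc n"
proof -
  let ?J = "{min 0 t..max 0 t}"
  have i: "integrable lborel (\<lambda>s. indicator ?J s *\<^sub>R \<bar>s\<bar> ^ n)"
    by (intro borel_integrable_compact compact_Icc continuous_intros)
  have le: "\<bar>orient t s\<bar> * \<bar>s\<bar> ^ n \<le> indicator ?J s *\<^sub>R \<bar>s\<bar> ^ n" for s
    by (auto simp: orient_def indicator_def)
  show j: "integrable lborel (\<lambda>s. \<bar>orient t s\<bar> * \<bar>s\<bar> ^ n)"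
    by (rule Bochner_Integration.integrable_bound[OF i], measurable, intro AE_I2) (use le in simp)
  have "(\<integral>s. \<bar>orient t s\<bar> * \<bar>s\<bar> ^ n \<partial>lborel) \<le> (\<integral>s. indicator ?J s *\<^sub>R \<bar>s\<bar> ^ n \<partial>lborel)"
    by (intro integral_mono i j le)
  moreover have "(\<integral>s. indicator ?J s *\<^sub>R \<bar>s\<bar> ^ n \<partial>lborel) = \<bar>t\<bar> ^ Suc n / Suc n"
  proof (cases "t \<ge> 0")
    case True
    have "(\<integral>s. indicator ?J s *\<^sub>R \<bar>s\<bar> ^ n \<partial>lborel) = (\<integral>s. s ^ n * indicator {0..t} s \<partial>lborel)"
      using True by (intro Bochner_Integration.integral_cong) (auto simp: indicator_def)
    then show ?thesis using integral_power[of 0 t n] True by simp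
  next
    case False
    have "(\<integral>s. indicator ?J s *\<^sub>R \<bar>s\<bar> ^ n \<partial>lborel) = (\<integral>s. (- 1) ^ n * (s ^ n * indicator {t..0} s) \<partial>lborel)"
    proof (intro Bochner_Integration.integral_cong refl)
      fix s
      show "indicator ?J s *\<^sub>R \<bar>s\<bar> ^ n = (- 1) ^ n * (s ^ n * indicator {t..0} s)"
      proof (cases "s \<in> {t..0}")
        case True
        then have "\<bar>s\<bar> ^ n = ((- 1) * s) ^ n" by simp
        then show ?thesis using True by (simp only: power_mult_distrib) simp
      next
        case s: False
        then show ?thesis using False by (simp add: indicator_def)
      qed
    qed
    also have "\<dots> = (- 1) ^ n * ((0 ^ Suc n - t ^ Suc n) / Suc n)"
      using False by (simp only: integral_mult_right_zero integral_power)
    also have "\<dots> = (- t) ^ Suc n / Suc n" by (simp add: power_minus[of t])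
    finally show ?thesis using False by simp
  qed
  ultimately show "(\<integral>s. \<bar>orient t s\<bar> * \<bar>s\<bar> ^ n \<partial>lborel) \<le> \<bar>t\<bar> ^ Suc n / Suc n" by (simp only:)
qed

definition locally_bounded :: "(real \<Rightarrow> lattice5 \<Rightarrow> complex) \<Rightarrow> bool" where
  "locally_bounded u \<longleftrightarrow> (\<forall>T. \<exists>B. \<forall>t\<in>{-T..T}. \<forall>x. norm (u t x) \<le> B)"

text \<open>Iterating Duhamel's formula for the difference improves the crude bound 2 B to 2 B (L
  |t|)^n / n! for every n, which tends to 0.\<close>

lemma duhamel_unique:
  assumes k: "k \<ge> 3" and u: "duhamel_solution k f u" "locally_bounded u"
    and v: "duhamel_solution k f v" "locally_bounded v"
  shows "v = u"
proof (intro ext)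
  fix t0 :: real and x0
  define T where "T = \<bar>t0\<bar>"
  obtain Bu where Bu: "norm (u t x) \<le> Bu" if "t \<in> {-T..T}" for t x
    using u(2) unfolding locally_bounded_def by metis
  obtain Bv where Bv: "norm (v t x) \<le> Bv" if "t \<in> {-T..T}" for t x
    using v(2) unfolding locally_bounded_def by metis
  define B where "B = max Bu Bv"
  have B: "norm (u t x) \<le> B" "norm (v t x) \<le> B" if "\<bar>t\<bar> \<le> T" for t x
    using Bu[of t x] Bv[of t x] that by (auto simp: B_def abs_le_iff le_max_iff_disj)
  have B0: "B \<ge> 0" using B(1)[of 0 0] norm_ge_zero order_trans by (metis T_def abs_ge_zero abs_zero)
  define S where "S = T * exp (20 * T\<^sup>2)"
  have T0: "T \<ge> 0" by (simp add: T_def)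
  have S: "l1_le S (propagator \<tau>)" if "\<bar>\<tau>\<bar> \<le> T" for \<tau>
    unfolding l1_le_def
  proof (intro allI impI)
    fix F :: "lattice5 set" assume "finite F"
    then have "(\<Sum>x\<in>F. norm (propagator \<tau> x)) \<le> \<bar>\<tau>\<bar> * exp (20 * \<tau>\<^sup>2)" by (rule propagator_l1)
    also have "\<dots> \<le> S"
    proof -
      have "\<tau>\<^sup>2 \<le> T\<^sup>2" using that T0 abs_le_square_iff[of \<tau> T] by simp
      then show ?thesis unfolding S_def using that T0 by (intro mult_mono) auto
    qed
    finally show "(\<Sum>x\<in>F. norm (propagator \<tau> x)) \<le> S" .
  qed
  have S0: "S \<ge> 0" using T0 by (simp add: S_def)
  \<comment> \<open>The l1 bound S of the propagator on [-T, T] times the Lipschitz constant of the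
    nonlinearity on values of modulus at most B.\<close>
  define L where "L = S * (k * B powr (k - 1))"
  have L0: "L \<ge> 0" using S0 k by (simp add: L_def)
  let ?g = "\<lambda>u t x s. orient t s *\<^sub>R conv (propagator (t - s)) (nonlinearity k (u s)) x"
  have gi: "integrable lborel (?g u t x)" "integrable lborel (?g v t x)" for t x
    using u(1) v(1) unfolding duhamel_solution_def interval_orient by blast+
  have cv: "convolvable (propagator (t - s)) (nonlinearity k (u s))" "convolvable (propagator (t - s)) (nonlinearity k (v s))"
    if "s \<in> closed_segment 0 t" for s t
    using u(1) v(1) that unfolding duhamel_solution_def by blast+
  have diff: "v t x - u t x = (\<integral>s. ?g v t x s - ?g u t x s \<partial>lborel)" for t x
  proof -
    have "v t x = conv (propagator t) f x + (\<integral>s. ?g v t x s \<partial>lborel)"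
      "u t x = conv (propagator t) f x + (\<integral>s. ?g u t x s \<partial>lborel)"
      using u(1) v(1) unfolding duhamel_solution_def interval_orient by blast+
    then show ?thesis using gi[of t x] by simp
  qed
  have bound: "norm (v t x - u t x) \<le> 2 * B * (L ^ n * \<bar>t\<bar> ^ n / fact n)" if "\<bar>t\<bar> \<le> T" for n t x
    using that
  proof (induction n arbitrary: t x)
    case 0
    then show ?case using B[of t x] norm_triangle_ineq4[of "v t x" "u t x"] by simp
  next
    case (Suc n)
    let ?K = "2 * B * (L ^ Suc n / fact n)"
    have "norm (v t x - u t x) \<le> (\<integral>s. ?K * (\<bar>orient t s\<bar> * \<bar>s\<bar> ^ n) \<partial>lborel)"
      unfolding diff
    proof (intro Bochner_Integration.integral_norm_bound_integral Bochner_Integration.integrable_diff gi integrable_mult_right abs_power_orient_integral)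
      fix s
      show "norm (?g v t x s - ?g u t x s) \<le> ?K * (\<bar>orient t s\<bar> * \<bar>s\<bar> ^ n)"
      \<comment> \<open>Convolvability is granted by the definition of a solution only for s between
        0 and t; outside that segment the oriented weight vanishes.\<close>
      proof (cases "s \<in> closed_segment 0 t")
        case False
        then show ?thesis by (simp add: orient_zero)
      next
        case True
        then have s: "\<bar>s\<bar> \<le> T" "\<bar>t - s\<bar> \<le> T" using Suc.prems by (auto simp: closed_segment_eq_real_ivl split: if_splits)
        let ?D = "2 * B * (L ^ n * \<bar>s\<bar> ^ n / fact n)"
        have D0: "?D \<ge> 0" using B0 L0 by simp
        have "norm (nonlinearity k (v s) y - nonlinearity k (u s) y) \<le> (k * B powr (k - 1)) * ?D" for y
        proof -
          have "norm (nonlinearity k (v s) y - nonlinearity k (u s) y) \<le>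
            k * max (norm (v s y)) (norm (u s y)) powr (k - 1) * norm (v s y - u s y)"
            by (rule nonlinearity_lipschitz[OF k])
          also have "\<dots> \<le> k * B powr (k - 1) * ?D"
            using k B[OF s(1)] Suc.IH[OF s(1)] by (intro mult_mono mult_left_mono powr_mono2) (auto simp: le_max_iff_disj)
          finally show ?thesis .
        qed
        moreover have "0 \<le> (k * B powr (k - 1)) * ?D"
          using k by (intro mult_nonneg_nonneg D0) auto
        ultimately have "norm (conv (propagator (t - s)) (\<lambda>y. nonlinearity k (v s) y - nonlinearity k (u s) y) x) \<le> S * ((k * B powr (k - 1)) * ?D)"
          by (rule conv_l1_bounded(2)[OF S[OF s(2)]])
        then have "\<bar>orient t s\<bar> * norm (conv (propagator (t - s)) (\<lambda>y. nonlinearity k (v s) y - nonlinearity k (u s) y) x) \<le>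
            \<bar>orient t s\<bar> * (S * ((k * B powr (k - 1)) * ?D))" by (rule mult_left_mono) simp
        also have "\<dots> = ?K * (\<bar>orient t s\<bar> * \<bar>s\<bar> ^ n)" by (simp add: L_def)
        finally show ?thesis
          unfolding scaleR_diff_right[symmetric] norm_scaleR conv_diff[OF cv(2)[OF True] cv(1)[OF True]] .
      qed
    qed
    also have "\<dots> = ?K * (\<integral>s. \<bar>orient t s\<bar> * \<bar>s\<bar> ^ n \<partial>lborel)" by (rule integral_mult_right_zero)
    also have "\<dots> \<le> ?K * (\<bar>t\<bar> ^ Suc n / Suc n)"
      using B0 L0 by (intro mult_left_mono abs_power_orient_integral) auto
    also have "\<dots> = 2 * B * (L ^ Suc n * \<bar>t\<bar> ^ Suc n / fact (Suc n))" by (simp add: field_simps)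
    finally show ?case .
  qed
  have "(\<lambda>n. 2 * B * (inverse (fact n) * (L * T) ^ n)) \<longlonglongrightarrow> 2 * B * 0"
    by (intro tendsto_mult tendsto_const summable_LIMSEQ_zero[OF summable_exp])
  then have "(\<lambda>n. 2 * B * (L ^ n * T ^ n / fact n)) \<longlonglongrightarrow> 0"
    by (simp add: power_mult_distrib divide_inverse mult_ac)
  moreover have "norm (v t0 x0 - u t0 x0) \<le> 2 * B * (L ^ n * T ^ n / fact n)" for n
    using bound[of t0 x0 n] by (simp add: T_def)
  ultimately have "norm (v t0 x0 - u t0 x0) \<le> 0" by (intro tendsto_lowerbound) auto
  then show "v t0 x0 = u t0 x0" by simp
qed

section \<open>Passage between the l^p classes and the bounds on the solution\<close>

lemma norm_le_lp_norm:
  assumes "in_lp p w" "2 \<le> p"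
  shows "norm (w x) \<le> lp_norm p w"
proof (cases "p = \<infinity>")
  case True
  then have "bdd_above (range (\<lambda>x. norm (w x)))"
    using assms(1) by (auto simp: in_lp_def bounded_iff bdd_above_def)
  then show ?thesis using True by (auto simp: lp_norm_def intro: cSUP_upper)
next
  case False
  define r where "r = real_of_ereal p"
  have r: "r \<ge> 2" using assms(2) False by (cases p) (auto simp: r_def)
  have sm: "(\<lambda>x. norm (w x) powr r) summable_on UNIV" using assms(1) False by (simp add: in_lp_def r_def)
  have "norm (w x) powr r \<le> (\<Sum>\<^sub>\<infinity>x. norm (w x) powr r)"
    using finite_sum_le_infsum[OF sm, of "{x}"] by simp
  then have "(norm (w x) powr r) powr (1 / r) \<le> (\<Sum>\<^sub>\<infinity>x. norm (w x) powr r) powr (1 / r)"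
    using r by (intro powr_mono2) auto
  then show ?thesis using False r by (simp add: lp_norm_def r_def powr_powr)
qed

text \<open>Places the solution classes for all p >= 2 in a single one, so one uniqueness argument
  serves every exponent.\<close>

lemma global_solution_locally_bounded:
  assumes "global_solution_in p k f v" "2 \<le> p"
  shows "locally_bounded v"
  unfolding locally_bounded_def
proof
  fix T :: real
  obtain B where "\<forall>t\<in>{-T..T}. lp_norm p (v t) \<le> B" using assms(1) unfolding global_solution_in_def by blast
  moreover have "norm (v t x) \<le> lp_norm p (v t)" for t x
    using assms unfolding global_solution_in_def by (intro norm_le_lp_norm) auto
  ultimately show "\<exists>B. \<forall>t\<in>{-T..T}. \<forall>x. norm (v t x) \<le> B" by (meson order_trans)
qed

text \<open>For finite r = p, |u|^r <= D^(r-2) |u|^2 with D = M decay t. After the r-th root the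
  powers of M add up to 1, and the decay receives the exponent (r - 2) / r = 1 - 2 / p.\<close>

lemma admissible_lp:
  assumes u: "admissible M u" and M: "0 < M" "M \<le> 1" and p: "2 \<le> p"
  shows "in_lp p (u t)"
    and "lp_norm p (u t) \<le> M * (1 + \<bar>t\<bar>) powr (- (11 / 6) * (1 - real_of_ereal (2 / p)))"
proof -
  have sup: "norm (u t x) \<le> M * decay t" for x using u by (simp add: admissible_def)
  have sq: "(\<Sum>x\<in>F. (norm (u t x))\<^sup>2) \<le> M\<^sup>2" if "finite F" for F
    using u M that by (intro l2_le_sum_squares) (auto simp: admissible_def)
  have "in_lp p (u t) \<and> lp_norm p (u t) \<le> M * (1 + \<bar>t\<bar>) powr (- (11 / 6) * (1 - real_of_ereal (2 / p)))"
  proof (cases "p = \<infinity>")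
    case True
    have "bounded (range (u t))" using sup by (auto simp: bounded_iff)
    moreover have "(SUP x. norm (u t x)) \<le> M * decay t" by (rule cSUP_least) (auto intro: sup)
    ultimately show ?thesis using True by (simp add: in_lp_def lp_norm_def decay_def)
  next
    case False
    define r where "r = real_of_ereal p"
    have r: "r \<ge> 2" "p = ereal r" using p False by (cases p; auto simp: r_def)+
    have q: "real_of_ereal (2 / p) = 2 / r" using r by (simp add: numeral_eq_ereal)
    define D where "D = M * decay t"
    have D: "D > 0" using M decay_pos[of t] by (simp add: D_def)
    have fin: "(\<Sum>x\<in>F. norm (u t x) powr r) \<le> D powr (r - 2) * M\<^sup>2" if "finite F" for F
    proof -
      have "(\<Sum>x\<in>F. norm (u t x) powr r) \<le> (\<Sum>x\<in>F. D powr (r - 2) * (norm (u t x))\<^sup>2)"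
      proof (rule sum_mono)
        fix x
        have "norm (u t x) powr r = norm (u t x) powr (r - 2) * (norm (u t x))\<^sup>2"
          by (cases "u t x = 0") (auto simp: powr_diff powr_numeral)
        also have "\<dots> \<le> D powr (r - 2) * (norm (u t x))\<^sup>2"
          using r sup[of x] by (intro mult_right_mono powr_mono2) (auto simp: D_def)
        finally show "norm (u t x) powr r \<le> D powr (r - 2) * (norm (u t x))\<^sup>2" .
      qed
      also have "\<dots> = D powr (r - 2) * (\<Sum>x\<in>F. (norm (u t x))\<^sup>2)" by (simp add: sum_distrib_left)
      also have "\<dots> \<le> D powr (r - 2) * M\<^sup>2" by (intro mult_left_mono sq that) simp
      finally show ?thesis .
    qed
    have sm: "(\<lambda>x. norm (u t x) powr r) summable_on UNIV"
      using fin by (intro nonneg_bdd_above_summable_on) (auto intro!: bdd_aboveI[of _ "D powr (r - 2) * M\<^sup>2"])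
    have "(\<Sum>\<^sub>\<infinity>x. norm (u t x) powr r) \<le> D powr (r - 2) * M\<^sup>2"
      using fin by (intro infsum_le_finite_sums[OF sm]) auto
    then have "(\<Sum>\<^sub>\<infinity>x. norm (u t x) powr r) powr (1 / r) \<le> (D powr (r - 2) * M\<^sup>2) powr (1 / r)"
      using r by (intro powr_mono2 infsum_nonneg) auto
    also have "D powr (r - 2) * M\<^sup>2 = decay t powr (r - 2) * M powr r"
    proof -
      have "M powr (r - 2) * M\<^sup>2 = M powr r" using M by (simp add: powr_diff powr_numeral)
      then show ?thesis unfolding D_def by (simp add: powr_mult mult_ac)
    qed
    also have "(decay t powr (r - 2) * M powr r) powr (1 / r) = M * (decay t powr ((r - 2) / r))"
      using r M by (simp add: powr_mult powr_powr)
    also have "decay t powr ((r - 2) / r) = (1 + \<bar>t\<bar>) powr (- (11 / 6) * (1 - 2 / r))"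
      unfolding decay_def powr_powr using r by (simp add: diff_divide_distrib)
    finally show ?thesis using False sm q by (simp add: in_lp_def lp_norm_def r_def)
  qed
  then show "in_lp p (u t)" "lp_norm p (u t) \<le> M * (1 + \<bar>t\<bar>) powr (- (11 / 6) * (1 - real_of_ereal (2 / p)))" by auto
qed

lemma l1_le_lp_norm: "in_lp 1 f \<Longrightarrow> lp_norm 1 f \<le> E \<Longrightarrow> l1_le E f"
proof -
  assume f: "in_lp 1 f" "lp_norm 1 f \<le> E"
  then have sm: "(\<lambda>x. norm (f x)) summable_on UNIV" by (simp add: in_lp_def)
  have "(\<Sum>\<^sub>\<infinity>x. norm (f x)) \<le> E" using f(2) by (simp add: lp_norm_def infsum_nonneg)
  moreover have "(\<Sum>x\<in>F. norm (f x)) \<le> (\<Sum>\<^sub>\<infinity>x. norm (f x))" if "finite F" for F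
    by (rule finite_sum_le_infsum[OF sm that]) auto
  ultimately show ?thesis unfolding l1_le_def by (meson order_trans)
qed

theorem theorem5p1:
  fixes k :: real
  assumes "k \<ge> 3"
  shows "\<exists>\<epsilon>>0. \<forall>f\<^sub>2 :: lattice5 \<Rightarrow> complex. in_lp 1 f\<^sub>2 \<and> lp_norm 1 f\<^sub>2 \<le> \<epsilon> \<longrightarrow>
    (\<exists>u. \<forall>p::ereal. 2 \<le> p \<longrightarrow>
       global_solution_in p k f\<^sub>2 u \<and>
       (\<forall>v. global_solution_in p k f\<^sub>2 v \<longrightarrow> v = u) \<and>
       (\<exists>C>0. \<forall>t. lp_norm p (u t)
          \<le> C * (1 + \<bar>t\<bar>) powr (- (11 / 6) * (1 - real_of_ereal (2 / p)))))"
proof -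
  obtain C1 where C1: "C1 > 0" "\<And>t x. norm (propagator t x) \<le> C1 * decay t"
    using propagator_decay by blast
  obtain C2 where C2: "C2 > 0" "\<And>t F c. finite F \<Longrightarrow>
      norm (\<Sum>x\<in>F. c x * propagator t x) \<le> C2 * sqrt (\<Sum>x\<in>F. (norm (c x))\<^sup>2)"
    using propagator_l2 by blast
  \<comment> \<open>One constant that serves for both the sup bound and the l2 bound.\<close>
  define C where "C = C1 + C2"
  have C: "C > 0" using C1 C2 by (simp add: C_def)
  have sup: "norm (propagator t x) \<le> C * decay t" for t x
  proof -
    have "C2 * decay t \<ge> 0" using C2(1) decay_nonneg[of t] by simp
    then show ?thesis using C1(2)[of t x] unfolding C_def distrib_right by linarith
  qed
  have l2: "l2_le C (propagator t)" for t
    unfolding l2_le_def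
  proof (intro allI impI)
    fix F :: "lattice5 set" and c :: "lattice5 \<Rightarrow> complex" assume "finite F"
    from C2(2)[OF this, of c t] have "norm (\<Sum>x\<in>F. c x * propagator t x) \<le> C2 * sqrt (\<Sum>x\<in>F. (norm (c x))\<^sup>2)" .
    also have "\<dots> \<le> C * sqrt (\<Sum>x\<in>F. (norm (c x))\<^sup>2)"
      using C1(1) by (intro mult_right_mono) (auto simp: C_def sum_nonneg)
    finally show "norm (\<Sum>x\<in>F. c x * propagator t x) \<le> C * sqrt (\<Sum>x\<in>F. (norm (c x))\<^sup>2)" .
  qed
  \<comment> \<open>Chosen so that Q M^2 is twice the sum of the two quadratic smallness quantities.
    With M = 1 / (1 + Q) this is at most 1, and each quantity is at most 1/2.\<close>
  define Q where "Q = 2 * (C * decay_mass * (8 + 2 * k))"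
  have Q: "Q \<ge> 0" using C decay_mass_nonneg assms by (simp add: Q_def)
  define M where "M = 1 / (1 + Q)"
  have M: "0 < M" "M \<le> 1" using Q by (auto simp: M_def)
  have QM: "Q * M\<^sup>2 \<le> 1"
  proof -
    have "Q * M \<le> 1" using Q by (simp add: M_def)
    then have "(Q * M) * M \<le> 1 * 1" using M Q by (intro mult_mono) auto
    then show ?thesis by (simp add: power2_eq_square)
  qed
  have CWM: "C * decay_mass * M\<^sup>2 \<ge> 0" using C decay_mass_nonneg by simp
  have Qe: "Q * M\<^sup>2 = 2 * (8 * C * decay_mass * M\<^sup>2) + 2 * (2 * k * C * decay_mass * M\<^sup>2)"
    by (simp add: Q_def algebra_simps)
  have "8 * C * decay_mass * M\<^sup>2 \<ge> 0" "2 * k * C * decay_mass * M\<^sup>2 \<ge> 0"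
    using C decay_mass_nonneg assms by simp_all
  then have small: "8 * C * decay_mass * M\<^sup>2 \<le> 1 / 2" "2 * k * C * decay_mass * M\<^sup>2 \<le> 1 / 2"
    using QM Qe by linarith+
  \<comment> \<open>The largest datum for which the linear part uses no more than half of M.\<close>
  define \<epsilon> where "\<epsilon> = M / (2 * C)"
  have \<epsilon>: "\<epsilon> > 0" "C * \<epsilon> \<le> M / 2" using M C by (auto simp: \<epsilon>_def)
  show ?thesis
  proof (intro exI[of _ \<epsilon>] conjI allI impI \<epsilon>(1))
    fix f :: "lattice5 \<Rightarrow> complex" assume f: "in_lp 1 f \<and> lp_norm 1 f \<le> \<epsilon>"
    interpret small_duhamel k C \<epsilon> M f
      by unfold_locales (use assms C M sup l2 small \<epsilon> l1_le_lp_norm f in auto)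
    obtain u where u: "admissible M u" "duhamel_map k f u = u" using fixed_point by blast
    have sol: "duhamel_solution k f u" by (rule fixed_point_duhamel[OF u])
    show "\<exists>u. \<forall>p::ereal. 2 \<le> p \<longrightarrow> global_solution_in p k f u \<and>
       (\<forall>v. global_solution_in p k f v \<longrightarrow> v = u) \<and>
       (\<exists>C>0. \<forall>t. lp_norm p (u t) \<le> C * (1 + \<bar>t\<bar>) powr (- (11 / 6) * (1 - real_of_ereal (2 / p))))"
    proof (intro exI[of _ u] allI impI)
      fix p :: ereal assume p: "2 \<le> p"
      note lp = admissible_lp[OF u(1) M p]
      \<comment> \<open>Since 2 / p <= 1 the exponent is nonpositive, so the decay estimate also
        gives the locally bounded norm required of a global solution.\<close>
      have le1: "(1 + \<bar>t\<bar>) powr (- (11 / 6) * (1 - real_of_ereal (2 / p))) \<le> 1" for t :: real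
      proof -
        have "real_of_ereal (2 / p) \<le> 1"
          using p by (cases p) auto
        then have "(1 + \<bar>t\<bar>) powr (- (11 / 6) * (1 - real_of_ereal (2 / p))) \<le> (1 + \<bar>t\<bar>) powr 0"
          by (intro powr_mono) auto
        also have "(1 + \<bar>t\<bar>) powr 0 = 1" by (subst powr_zero_eq_one) auto
        finally show ?thesis .
      qed
      have "lp_norm p (u t) \<le> M" for t
      proof (rule order_trans[OF lp(2)])
        show "M * (1 + \<bar>t\<bar>) powr (- (11 / 6) * (1 - real_of_ereal (2 / p))) \<le> M"
          using mult_left_mono[OF le1[of t], of M] M(1) by (simp only: mult_1_right less_imp_le)
      qed
      then have g: "global_solution_in p k f u"
        unfolding global_solution_in_def using sol lp(1) by blast
      moreover have "v = u" if "global_solution_in p k f v" for v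
        using duhamel_unique[OF assms sol global_solution_locally_bounded[OF g p]]
          global_solution_locally_bounded[OF that p] that unfolding global_solution_in_def by blast
      ultimately show "global_solution_in p k f u \<and> (\<forall>v. global_solution_in p k f v \<longrightarrow> v = u) \<and>
         (\<exists>C>0. \<forall>t. lp_norm p (u t) \<le> C * (1 + \<bar>t\<bar>) powr (- (11 / 6) * (1 - real_of_ereal (2 / p))))"
        using M(1) lp(2) by blast
    qed
  qed
qed

end
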